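(* Let $\Delta$ denote either the symmetric algebraic shifting operator $\Delta^s$ or the exterior algebraic shifting operator $\Delta^e$. The following holds for both choices of $\Delta$: for every integer $r$ with $2\leq r\leq 6$ and every graph $G$, if $\{r-1,r\}\in\Delta(G)$ then $G$ has a $K_r$ minor.
   Context: All graphs are finite and simple (no loops, no multiple edges). $K_r$ is the complete graph on $r$ vertices. Contracting an edge $\{v,u\}$ means identifying $v$ and $u$, deleting the resulting loop and one copy of each double edge created, to obtain a new simple graph. A graph $H$ is a minor of $G$ if $H$ can be obtained, up to isomorphism, from a subgraph of $G$ by repeated contraction of edges; $G$ has an $H$ minor if $H$ is a minor of $G$. Algebraic shifting. Let $K$ be a simplicial complex on vertex set $[n]=\{1,\dots,n\}$; a graph $G$ with $n$ vertices is regarded as a simplicial complex of dimension at most $1$ (faces: the empty set, the vertices, the edges) after numbering its vertices by $[n]$. Let $k$ be a field of characteristic zero, large enough for the generic choices below (e.g. $k=\mathbb{R}$). For distinct sets $S,T\subseteq[n]$ of equal size write $S<_L T$ iff $\min(S\triangle T)\in S$. Exterior shifting $\Delta^e$: let $V$ be a $k$-vector space with basis $e_1,\dots,e_n$, and for $S=\{s_1<\dots<s_j\}$ put $e_S=e_{s_1}\wedge\dots\wedge e_{s_j}$. Let $\bigwedge(K)=\bigwedge V/(e_S: S\notin K)$. Let $f_1,\dots,f_n$ be a basis of $V$ that is generic with respect to $e_1,\dots,e_n$, i.e. the entries of the transition matrix are algebraically independent over $\mathbb{Q}$. Define $f_S$ analogously to $e_S$ and let $\tilde f_S$ be its image in $\bigwedge(K)$.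 Then $$\Delta^e(K)=\{S\subseteq[n]: \tilde f_S\notin \mathrm{span}\{\tilde f_{S'}: |S'|=|S|,\ S'<_L S\}\}.$$ Symmetric shifting $\Delta^s$: let $k[K]=k[x_1,\dots,x_n]/I_K$ be the face ring, where $I_K$ is generated by the monomials whose support is not in $K$. Let $y_1,\dots,y_n$ be generic linear combinations of $x_1,\dots,x_n$ (coefficients algebraically independent over $\mathbb{Q}$). For monomials in the $y_i$ of the same degree write $\prod y_i^{a_i}<_L\prod y_i^{b_i}$ iff $a_j>b_j$ for $j=\min\{i:a_i\ne b_i\}$. Let $\tilde m$ denote the image of $m$ in $k[K]$, and let $GIN(K)$ be the set of monomials $m$ in the $y_i$ of degree at most $\dim K+1$ such that $\tilde m\notin\mathrm{span}\{\tilde m': \deg m'=\deg m,\ m'<_L m\}$. Let $gin(K)$ be the set of those $m=y_{i_1}y_{i_2}\cdots y_{i_r}\in GIN(K)$ with $r\le i_1\le i_2\le\dots\le i_r$ and $r\le\dim K+1$, and for such $m$ put $S(m)=\{i_1-r+1,i_2-r+2,\dots,i_r\}$. Then $\Delta^s(K)=\{S(m): m\in gin(K)\}$. Both $\Delta^e(K)$ and $\Delta^s(K)$ are independent of the numbering of the vertices and of the generic choices. *)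

theory Defs
  imports Complex_Main "HOL-Library.Poly_Mapping" "HOL-Library.Function_Algebras"
begin

section \<open>Finite simple graphs and minors\<close>

type_synonym 'a graph = "'a set \<times> 'a set set"

abbreviation verts :: "'a graph \<Rightarrow> 'a set" where "verts \<equiv> fst"
abbreviation edges :: "'a graph \<Rightarrow> 'a set set" where "edges \<equiv> snd"

definition simple_graph :: "'a graph \<Rightarrow> bool" where
  "simple_graph G \<longleftrightarrow> finite (verts G) \<and> (\<forall>e\<in>edges G. e \<subseteq> verts G \<and> card e = 2)"

definition complete_graph :: "nat \<Rightarrow> nat graph" where
  "complete_graph r = ({1..r}, {e. e \<subseteq> {1..r} \<and> card e = 2})"

definition subgraph :: "'a graph \<Rightarrow> 'a graph \<Rightarrow> bool" where
  "subgraph H G \<longleftrightarrow> simple_graph H \<and> verts H \<subseteq> verts G \<and> edges H \<subseteq> edges G"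

definition graph_iso :: "'a graph \<Rightarrow> 'b graph \<Rightarrow> bool" where
  "graph_iso G H \<longleftrightarrow> (\<exists>f. bij_betw f (verts G) (verts H) \<and> edges H = (\<lambda>e. f ` e) ` edges G)"

text \<open>The vertex \<open>u\<close> is identified with \<open>v\<close>. The edge \<open>{v, u}\<close> is mapped to the loop \<open>{v}\<close>,
  which is deleted; double edges disappear because the edges form a set.\<close>

definition contract_edge :: "'a \<Rightarrow> 'a \<Rightarrow> 'a graph \<Rightarrow> 'a graph" where
  "contract_edge v u G =
     (let q = id(u := v) in (q ` verts G, (\<lambda>e. q ` e) ` edges G - {{v}}))"

definition contracts_to :: "'a graph \<Rightarrow> 'a graph \<Rightarrow> bool" where
  "contracts_to G G' \<longleftrightarrow> (\<exists>v u. v \<noteq> u \<and> {v, u} \<in> edges G \<and> G' = contract_edge v u G)"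

definition has_minor :: "'a graph \<Rightarrow> 'b graph \<Rightarrow> bool" where
  "has_minor G H \<longleftrightarrow> (\<exists>G0 G1. subgraph G0 G \<and> contracts_to\<^sup>*\<^sup>* G0 G1 \<and> graph_iso G1 H)"

definition graph_complex :: "'a graph \<Rightarrow> 'a set set" where
  "graph_complex G = {{}} \<union> {{v} |v. v \<in> verts G} \<union> edges G"

definition relabel :: "('a \<Rightarrow> 'b) \<Rightarrow> 'a set set \<Rightarrow> 'b set set" where
  "relabel \<phi> K = (\<lambda>S. \<phi> ` S) ` K"


section \<open>Generic matrices\<close>

text \<open>A polynomial over \<open>\<rat>\<close> in variables indexed by \<open>'i\<close> is an element of
  \<open>('i \<Rightarrow>\<^sub>0 nat) \<Rightarrow>\<^sub>0 rat\<close>: a finitely supported map from exponent vectors to coefficients.\<close>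

definition eval_rat_poly :: "('i \<Rightarrow> 'k::field_char_0) \<Rightarrow> (('i \<Rightarrow>\<^sub>0 nat) \<Rightarrow>\<^sub>0 rat) \<Rightarrow> 'k" where
  "eval_rat_poly a p =
     (\<Sum>m\<in>Poly_Mapping.keys p. of_rat (Poly_Mapping.lookup p m) *
        (\<Prod>i\<in>Poly_Mapping.keys m. a i ^ Poly_Mapping.lookup m i))"

definition algebraically_independent :: "'i set \<Rightarrow> ('i \<Rightarrow> 'k::field_char_0) \<Rightarrow> bool" where
  "algebraically_independent I a \<longleftrightarrow>
     (\<forall>p. (\<forall>m\<in>Poly_Mapping.keys p. Poly_Mapping.keys m \<subseteq> I) \<and> eval_rat_poly a p = 0 \<longrightarrow> p = 0)"

text \<open>Only the entries with indices in \<open>{1..n}\<close> matter. The determinant is a nonzero polynomial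
  with rational coefficients in the entries, so a generic matrix is automatically invertible.\<close>

definition generic_matrix :: "nat \<Rightarrow> (nat \<Rightarrow> nat \<Rightarrow> 'k::field_char_0) \<Rightarrow> bool" where
  "generic_matrix n A \<longleftrightarrow>
     algebraically_independent ({1..n} \<times> {1..n}) (\<lambda>(i, j). A i j)"


section \<open>Ideals and spans in quotients\<close>

text \<open>Both algebras below are given by a carrier \<open>R\<close> inside a larger additive group and a
  multiplication \<open>mul\<close>. They are unital, so closure under multiplication by \<open>R\<close> subsumes closure
  under negation and scalars.\<close>

definition two_sided_ideal ::
    "('v::ab_group_add) set \<Rightarrow> ('v \<Rightarrow> 'v \<Rightarrow> 'v) \<Rightarrow> 'v set \<Rightarrow> bool" where
  "two_sided_ideal R mul I \<longleftrightarrow> I \<subseteq> R \<and> 0 \<in> I \<and> (\<forall>x\<in>I. \<forall>y\<in>I. x + y \<in> I) \<and>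
     (\<forall>x\<in>I. \<forall>a\<in>R. mul a x \<in> I \<and> mul x a \<in> I)"

definition generated_ideal ::
    "('v::ab_group_add) set \<Rightarrow> ('v \<Rightarrow> 'v \<Rightarrow> 'v) \<Rightarrow> 'v set \<Rightarrow> 'v set" where
  "generated_ideal R mul X = two_sided_ideal R mul hull X"

text \<open>\<open>x \<in> span_mod scale I X\<close> says that the class of \<open>x\<close> modulo \<open>I\<close> lies in the span of the
  classes of the elements of \<open>X\<close>, i.e. is the class of some linear combination of \<open>X\<close>.\<close>

definition span_mod ::
    "('k::field \<Rightarrow> 'v \<Rightarrow> 'v) \<Rightarrow> 'v set \<Rightarrow> ('v::ab_group_add) set \<Rightarrow> 'v set" where
  "span_mod scale I X = {x. \<exists>u\<in>module.span scale X. x - u \<in> I}"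


section \<open>Exterior shifting\<close>

text \<open>An element \<open>\<Sum>\<^sub>S a\<^sub>S e\<^sub>S\<close> of the exterior algebra is the function \<open>a\<close> on subsets of \<open>{1..n}\<close>,
  extended by \<open>0\<close>. The product is determined by
  \<open>e\<^sub>S \<and> e\<^sub>T = (-1)^inv(S,T) e\<^sub>S\<^sub>\<union>\<^sub>T\<close> for disjoint \<open>S\<close>, \<open>T\<close>, where \<open>inv(S,T)\<close> is the number of pairs
  \<open>(s, t) \<in> S \<times> T\<close> with \<open>t < s\<close>, and \<open>e\<^sub>S \<and> e\<^sub>T = 0\<close> otherwise.\<close>

type_synonym 'k ext = "nat set \<Rightarrow> 'k"

definition ext_carrier :: "nat \<Rightarrow> ('k::field) ext set" where
  "ext_carrier n = {a. \<forall>S. \<not> S \<subseteq> {1..n} \<longrightarrow> a S = 0}"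

definition ext_scale :: "'k::field \<Rightarrow> 'k ext \<Rightarrow> 'k ext" where
  "ext_scale c a = (\<lambda>S. c * a S)"

definition wedge :: "('k::field) ext \<Rightarrow> 'k ext \<Rightarrow> 'k ext" where
  "wedge a b = (\<lambda>U. \<Sum>S\<in>Pow U.
     (- 1) ^ card {(s, t). s \<in> S \<and> t \<in> U - S \<and> t < s} * a S * b (U - S))"

definition ext_one :: "('k::field) ext" where
  "ext_one = (\<lambda>S. if S = {} then 1 else 0)"

definition ext_gen :: "nat \<Rightarrow> ('k::field) ext" where
  "ext_gen i = (\<lambda>S. if S = {i} then 1 else 0)"

text \<open>For \<open>S = {s\<^sub>1 < \<dots> < s\<^sub>j}\<close> this is \<open>g s\<^sub>1 \<and> \<dots> \<and> g s\<^sub>j\<close>.\<close>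

definition wedge_over :: "(nat \<Rightarrow> ('k::field) ext) \<Rightarrow> nat set \<Rightarrow> 'k ext" where
  "wedge_over g S = foldr wedge (map g (sorted_list_of_set S)) ext_one"

text \<open>The coordinates are indeed those with respect to the basis \<open>e\<^sub>S\<close>.\<close>

lemma wedge_ext_gen:
  assumes "finite S" "\<And>s. s \<in> S \<Longrightarrow> i < s"
  shows "wedge (ext_gen i) (\<lambda>T. if T = S then 1 else 0)
       = (\<lambda>T. if T = insert i S then (1 :: 'k::field) else 0)" (is "?l = ?r")
proof
  fix U
  have i: "i \<notin> S" using assms(2) by blast
  show "?l U = ?r U"
  proof (cases "U = insert i S")
    case True
    have U: "U - {i} = S" using True i by auto
    have e: "{(s, t). s \<in> {i} \<and> t \<in> S \<and> t < s} = {}"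
      using assms(2) by fastforce
    have "?l U = (\<Sum>S'\<in>{{i}}. (- 1) ^ card {(s, t). s \<in> S' \<and> t \<in> U - S' \<and> t < s} *
        ext_gen i S' * (if U - S' = S then 1 else 0))"
      unfolding wedge_def
      by (rule sum.mono_neutral_right) (use assms(1) True in \<open>simp_all add: ext_gen_def\<close>)
    also have "\<dots> = 1"
      by (simp only: sum.insert finite.emptyI empty_iff not_False_eq_True sum.empty U e)
        (simp add: ext_gen_def)
    finally show ?thesis using True by simp
  next
    case False
    have "?l U = 0"
      unfolding wedge_def by (rule sum.neutral) (use False in \<open>auto simp: ext_gen_def\<close>)
    then show ?thesis using False by simp
  qed
qed

lemma wedge_over_ext_gen:
  assumes "finite S"
  shows "wedge_over ext_gen S = (\<lambda>T. if T = S then (1 :: 'k::field) else 0)"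
proof -
  have "foldr wedge (map ext_gen xs) ext_one = (\<lambda>T. if T = set xs then (1 :: 'k) else 0)"
    if "sorted xs" "distinct xs" for xs
    using that
  proof (induction xs)
    case (Cons a xs)
    then have "\<And>s. s \<in> set xs \<Longrightarrow> a < s" by (auto simp: order_less_le)
    with Cons wedge_ext_gen[of "set xs" a] show ?case by simp
  qed (simp add: ext_one_def)
  from this[of "sorted_list_of_set S"] show ?thesis using assms by (simp add: wedge_over_def)
qed

lemma vector_space_ext: "vector_space (ext_scale :: 'k::field \<Rightarrow> _)"
  by unfold_locales (auto simp: ext_scale_def fun_eq_iff algebra_simps)

definition generic_vector :: "nat \<Rightarrow> (nat \<Rightarrow> nat \<Rightarrow> 'k::field) \<Rightarrow> nat \<Rightarrow> 'k ext" where
  "generic_vector n A i = (\<Sum>j\<in>{1..n}. ext_scale (A i j) (ext_gen j))"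

definition ext_face_ideal :: "nat \<Rightarrow> nat set set \<Rightarrow> ('k::field) ext set" where
  "ext_face_ideal n K =
     generated_ideal (ext_carrier n) wedge {wedge_over ext_gen S |S. S \<subseteq> {1..n} \<and> S \<notin> K}"

definition set_lex_less :: "nat set \<Rightarrow> nat set \<Rightarrow> bool" where
  "set_lex_less S T \<longleftrightarrow> card S = card T \<and> S \<noteq> T \<and> Min (sym_diff S T) \<in> S"

definition exterior_shift :: "nat \<Rightarrow> (nat \<Rightarrow> nat \<Rightarrow> 'k::field) \<Rightarrow> nat set set \<Rightarrow> nat set set" where
  "exterior_shift n A K =
     {S. S \<subseteq> {1..n} \<and>
         wedge_over (generic_vector n A) S \<notin> span_mod ext_scale (ext_face_ideal n K)
           {wedge_over (generic_vector n A) S' |S'.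
              S' \<subseteq> {1..n} \<and> card S' = card S \<and> set_lex_less S' S}}"


section \<open>Symmetric shifting\<close>

text \<open>Monomials are exponent vectors; \<open>k[x\<^sub>1,\<dots>,x\<^sub>n]\<close> consists of the polynomials all of whose
  monomials are supported in \<open>{1..n}\<close>.\<close>

type_synonym monomial = "nat \<Rightarrow>\<^sub>0 nat"
type_synonym 'k polynomial = "monomial \<Rightarrow>\<^sub>0 'k"

definition poly_carrier :: "nat \<Rightarrow> ('k::field) polynomial set" where
  "poly_carrier n = {p. \<forall>m\<in>Poly_Mapping.keys p. Poly_Mapping.keys m \<subseteq> {1..n}}"

definition poly_scale :: "'k::field \<Rightarrow> 'k polynomial \<Rightarrow> 'k polynomial" where
  "poly_scale c p = Poly_Mapping.single 0 c * p"

definition poly_var :: "nat \<Rightarrow> ('k::field) polynomial" where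
  "poly_var j = Poly_Mapping.single (Poly_Mapping.single j 1) 1"

lemma vector_space_poly: "vector_space (poly_scale :: 'k::field \<Rightarrow> _)"
  by unfold_locales (auto simp: poly_scale_def algebra_simps mult_single single_add simp flip: mult.assoc)

definition generic_form :: "nat \<Rightarrow> (nat \<Rightarrow> nat \<Rightarrow> 'k::field) \<Rightarrow> nat \<Rightarrow> 'k polynomial" where
  "generic_form n A i = (\<Sum>j\<in>{1..n}. poly_scale (A i j) (poly_var j))"

definition monomial_in :: "(nat \<Rightarrow> ('k::field) polynomial) \<Rightarrow> monomial \<Rightarrow> 'k polynomial" where
  "monomial_in y m = (\<Prod>i\<in>Poly_Mapping.keys m. y i ^ Poly_Mapping.lookup m i)"

lemma monomial_in_poly_var: "monomial_in poly_var m = (Poly_Mapping.single m 1 :: 'k::field polynomial)"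
proof -
  have p: "poly_var i ^ k = (Poly_Mapping.single (Poly_Mapping.single i k) 1 :: 'k polynomial)" for i k
    by (induction k) (auto simp: poly_var_def mult_single single_add[symmetric])
  have "(\<Prod>i\<in>I. Poly_Mapping.single (Poly_Mapping.single i (f i)) 1)
      = (Poly_Mapping.single (\<Sum>i\<in>I. Poly_Mapping.single i (f i)) 1 :: 'k polynomial)"
    if "finite I" for I and f :: "nat \<Rightarrow> nat"
    using that by (induction I rule: finite_induct) (auto simp: mult_single)
  moreover have "(\<Sum>i\<in>Poly_Mapping.keys m. Poly_Mapping.single i (Poly_Mapping.lookup m i)) = m"
    by (rule poly_mapping_eqI) (auto simp: lookup_sum lookup_single when_def in_keys_iff)
  ultimately show ?thesis by (simp add: monomial_in_def p)
qed

definition face_ideal :: "nat \<Rightarrow> nat set set \<Rightarrow> ('k::field) polynomial set" where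
  "face_ideal n K =
     generated_ideal (poly_carrier n) (*)
       {monomial_in poly_var m |m. Poly_Mapping.keys m \<subseteq> {1..n} \<and> Poly_Mapping.keys m \<notin> K}"

definition monomial_degree :: "monomial \<Rightarrow> nat" where
  "monomial_degree m = (\<Sum>i\<in>Poly_Mapping.keys m. Poly_Mapping.lookup m i)"

definition monomial_lex_less :: "monomial \<Rightarrow> monomial \<Rightarrow> bool" where
  "monomial_lex_less a b \<longleftrightarrow> monomial_degree a = monomial_degree b \<and> a \<noteq> b \<and>
     (let j = LEAST i. Poly_Mapping.lookup a i \<noteq> Poly_Mapping.lookup b i
      in Poly_Mapping.lookup a j > Poly_Mapping.lookup b j)"

text \<open>\<open>dim K + 1\<close>, as a natural number.\<close>

definition dim_plus_one :: "nat set set \<Rightarrow> nat" where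
  "dim_plus_one K = Max (card ` K)"

definition GIN :: "nat \<Rightarrow> (nat \<Rightarrow> nat \<Rightarrow> 'k::field) \<Rightarrow> nat set set \<Rightarrow> monomial set" where
  "GIN n A K =
     {m. Poly_Mapping.keys m \<subseteq> {1..n} \<and> monomial_degree m \<le> dim_plus_one K \<and>
         monomial_in (generic_form n A) m \<notin> span_mod poly_scale (face_ideal n K)
           {monomial_in (generic_form n A) m' |m'.
              Poly_Mapping.keys m' \<subseteq> {1..n} \<and> monomial_degree m' = monomial_degree m \<and>
              monomial_lex_less m' m}}"

text \<open>A monomial \<open>y\<^bsub>i\<^sub>1\<^esub> \<cdots> y\<^bsub>i\<^sub>r\<^esub>\<close> with \<open>i\<^sub>1 \<le> \<dots> \<le> i\<^sub>r\<close> is given by its sorted index list. List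
  positions start at \<open>0\<close>, so \<open>is ! j\<close> is \<open>i\<^bsub>j+1\<^esub>\<close>; the subtraction in \<open>shifted_face\<close> does not
  truncate for lists in \<open>gin\<close>, whose entries are at least \<open>r\<close>.\<close>

definition monomial_of_list :: "nat list \<Rightarrow> monomial" where
  "monomial_of_list is = (\<Sum>i\<leftarrow>is. Poly_Mapping.single i 1)"

definition gin :: "nat \<Rightarrow> (nat \<Rightarrow> nat \<Rightarrow> 'k::field) \<Rightarrow> nat set set \<Rightarrow> nat list set" where
  "gin n A K =
     {is. sorted is \<and> monomial_of_list is \<in> GIN n A K \<and>
          (\<forall>i\<in>set is. length is \<le> i) \<and> length is \<le> dim_plus_one K}"

definition shifted_face :: "nat list \<Rightarrow> nat set" where
  "shifted_face is = {is ! j + Suc j - length is |j. j < length is}"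

definition symmetric_shift :: "nat \<Rightarrow> (nat \<Rightarrow> nat \<Rightarrow> 'k::field) \<Rightarrow> nat set set \<Rightarrow> nat set set" where
  "symmetric_shift n A K = shifted_face ` gin n A K"

end

(* Nevo's argument. Write d = r - 2. By linear duality, {r - 1, r} can only lie in a shifting of G if
   G carries a nonzero stress in generic position: a weighting of the ordered pairs of adjacent
   vertices, symmetric for symmetric and antisymmetric for exterior shifting, that is in equilibrium
   at every vertex in d-space. So it suffices that a graph without K_r minor is generically
   stress-free, which goes by induction on the number of vertices. Mader's theorem that a nonempty
   graph has a K_r minor (r <= 6) if all its edges lie in at least r - 2 triangles yields an edge with
   at most d - 1 common neighbours; contract it. Moving its ends together shows that stress-freeness
   passes from the contraction back to G (Whiteley's vertex splitting), and genericity does the rest.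

   Mader's theorem for r < 6 reduces to r = 6 by coning. For r = 6 it is proved together with the
   bound 4n - 10 on the number of edges, which supplies a vertex of degree at most 7 with a link of
   minimum degree at least 4. Unless there is a K_6 minor, that link looks like a triangulated sphere,
   some component outside of it attaches to a clique with at most three vertices, and one recurses
   into this component. *)

theory Submission
  imports Defs "HOL-Computational_Algebra.Polynomial"
begin

section \<open>Clique models\<close>

text \<open>Where d = r - 2 comes from: every pair with an element below r - 1 precedes {r - 1, r},
  so a separating functional is constrained along the first r - 2 generic rows. In symmetric
  shifting {r - 1, r} encodes the square of y_r, which gives one row more; it pays for the diagonal
  of the stress, as squares of variables survive in the face ring. The bound d - 1 is what splitting
  needs: the vector of the contracted edge and those to the common neighbours are at most d vectors
  in d-space. Genericity means independence over the rationals, but positions near the collapsed one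
  involve entries of the matrix itself. Hence there are two specializations: along a curve with
  coefficients in k, then from a point of this curve to the generic matrix. The bound 4n - 10 is
  attained by K_4 and K_5. Degree at most 7 is small enough for two nonadjacent vertices of the link
  to share three neighbours. Edges inside the separating clique may lose triangles in the recursion;
  as it has at most three vertices, the edge count still yields a vertex of small degree outside of
  it.\<close>

definition linked :: "('a \<Rightarrow> 'a \<Rightarrow> bool) \<Rightarrow> 'a set \<Rightarrow> 'a set \<Rightarrow> bool" where
  "linked E B C \<longleftrightarrow> (\<exists>x\<in>B. \<exists>y\<in>C. E x y)"

text \<open>Connectivity is stated through cuts instead of paths: an edge crossing each cut is
  easily pulled back or pushed forward along the map that contracts an edge.\<close>

definition conn :: "('a \<Rightarrow> 'a \<Rightarrow> bool) \<Rightarrow> 'a set \<Rightarrow> bool" where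
  "conn E B \<longleftrightarrow> B \<noteq> {} \<and> (\<forall>S. S \<subset> B \<longrightarrow> S \<noteq> {} \<longrightarrow> linked E S (B - S))"

definition branch_sets :: "('a \<Rightarrow> 'a \<Rightarrow> bool) \<Rightarrow> 'a set \<Rightarrow> 'a set set \<Rightarrow> bool" where
  "branch_sets E V \<B> \<longleftrightarrow> finite \<B> \<and> (\<forall>B\<in>\<B>. B \<subseteq> V \<and> conn E B) \<and>
     (\<forall>B\<in>\<B>. \<forall>C\<in>\<B>. B \<noteq> C \<longrightarrow> B \<inter> C = {} \<and> linked E B C)"

definition clique_model :: "('a \<Rightarrow> 'a \<Rightarrow> bool) \<Rightarrow> 'a set \<Rightarrow> nat \<Rightarrow> bool" where
  "clique_model E V r \<longleftrightarrow> (\<exists>\<B>. branch_sets E V \<B> \<and> card \<B> = r)"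

definition nb :: "('a \<Rightarrow> 'a \<Rightarrow> bool) \<Rightarrow> 'a set \<Rightarrow> 'a \<Rightarrow> 'a set" where
  "nb E V x = {y \<in> V. E x y}"

text \<open>Vertex sets are kept apart from relations, so that induced subgraphs need no new
  relation. Accordingly only the pairs are contracted here, and the vertex set is changed to
  \<open>V - {u}\<close> separately.\<close>

definition contr :: "'a \<Rightarrow> 'a \<Rightarrow> ('a \<Rightarrow> 'a \<Rightarrow> bool) \<Rightarrow> 'a \<Rightarrow> 'a \<Rightarrow> bool" where
  "contr v u E x y \<longleftrightarrow> x \<noteq> y \<and> (\<exists>a b. E a b \<and> (id(u := v)) a = x \<and> (id(u := v)) b = y)"

lemma nb_iff [simp]: "y \<in> nb E V x \<longleftrightarrow> y \<in> V \<and> E x y"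
  by (simp add: nb_def)

lemma finite_nb [simp]: "finite V \<Longrightarrow> finite (nb E V x)"
  by (simp add: nb_def)

lemma linked_mono: "linked E B C \<Longrightarrow> B \<subseteq> B' \<Longrightarrow> C \<subseteq> C' \<Longrightarrow> linked E B' C'"
  unfolding linked_def by blast

lemma linked_le: "linked E B C \<Longrightarrow> E \<le> E' \<Longrightarrow> linked E' B C"
  unfolding linked_def by blast

lemma conn_singleton [simp]: "conn E {x}"
  unfolding conn_def by auto

lemma conn_not_empty: "conn E B \<Longrightarrow> B \<noteq> {}"
  by (simp add: conn_def)

lemma conn_le: "conn E B \<Longrightarrow> E \<le> E' \<Longrightarrow> conn E' B"
  unfolding conn_def using linked_le[of E _ _ E'] by blast

lemma branch_sets_mono:
  assumes "branch_sets E V \<B>" "\<C> \<subseteq> \<B>" "V \<subseteq> V'" "E \<le> E'"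
  shows "branch_sets E' V' \<C>"
proof -
  have "finite \<C>" using assms(1,2) finite_subset[of \<C> \<B>] unfolding branch_sets_def by blast
  moreover have "B \<subseteq> V' \<and> conn E' B" if "B \<in> \<C>" for B
    using assms that conn_le[of E B, OF _ assms(4)] unfolding branch_sets_def by blast
  moreover have "B \<inter> C = {} \<and> linked E' B C" if "B \<in> \<C>" "C \<in> \<C>" "B \<noteq> C" for B C
    using assms(1,2) that linked_le[of E B C, OF _ assms(4)] unfolding branch_sets_def by blast
  ultimately show ?thesis unfolding branch_sets_def by blast
qed

lemma clique_model_mono:
  assumes "clique_model E V r" "V \<subseteq> V'" "E \<le> E'"
  shows "clique_model E' V' r"
  using assms(1) branch_sets_mono[of E V, OF _ order_refl assms(2,3)] unfolding clique_model_def by blast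

locale adjacency =
  fixes E :: "'a \<Rightarrow> 'a \<Rightarrow> bool"
  assumes sym: "E x y \<Longrightarrow> E y x" and irrefl [simp]: "\<not> E x x"
begin

lemma linked_sym: "linked E B C \<Longrightarrow> linked E C B"
  unfolding linked_def using sym by blast

text \<open>A cut that splits \<open>B\<close> or \<open>C\<close> is crossed inside that part. The
  only other cut separates \<open>B\<close> from \<open>C\<close>; these are then disjoint, and the
  linking edge crosses.\<close>

lemma conn_Un:
  assumes "conn E B" "conn E C" "B \<inter> C \<noteq> {} \<or> linked E B C"
  shows "conn E (B \<union> C)"
  unfolding conn_def
proof (intro conjI allI impI)
  show "B \<union> C \<noteq> {}" using assms(1) by (simp add: conn_def)
  fix S assume S: "S \<subset> B \<union> C" "S \<noteq> {}"
  have part: "linked E S (B \<union> C - S)" if "conn E D" "D \<subseteq> B \<union> C" "S \<inter> D \<noteq> {}" "\<not> D \<subseteq> S" for D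
  proof -
    have "linked E (S \<inter> D) (D - S \<inter> D)" using that unfolding conn_def by auto
    then show ?thesis by (rule linked_mono) (use that in auto)
  qed
  consider "S \<inter> B \<noteq> {}" "\<not> B \<subseteq> S" | "S \<inter> C \<noteq> {}" "\<not> C \<subseteq> S"
    | "S \<inter> B = {}" "C \<subseteq> S" | "S \<inter> C = {}" "B \<subseteq> S"
    using S by blast
  then show "linked E S (B \<union> C - S)"
  proof cases
    case 1 then show ?thesis using part assms by blast
  next
    case 2 then show ?thesis using part assms by blast
  next
    case 3
    then have "linked E C B" using assms(3) linked_sym by blast
    then show ?thesis by (rule linked_mono) (use 3 in auto)
  next
    case 4
    then have "linked E B C" using assms(3) by blast
    then show ?thesis by (rule linked_mono) (use 4 in auto)
  qed
qed

lemma conn_pair: "E x y \<Longrightarrow> conn E {x, y}"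
  using conn_Un[of "{x}" "{y}"] by (auto simp: linked_def insert_commute)

lemma conn_clique:
  assumes "T \<noteq> {}" "\<And>x y. x \<in> T \<Longrightarrow> y \<in> T \<Longrightarrow> x \<noteq> y \<Longrightarrow> E x y"
  shows "conn E T"
  unfolding conn_def linked_def using assms by blast

lemma branch_sets_insert:
  assumes "branch_sets E V \<B>" "conn E B" "B \<subseteq> V" "\<And>C. C \<in> \<B> \<Longrightarrow> B \<inter> C = {} \<and> linked E B C"
  shows "branch_sets E V (insert B \<B>)" "card (insert B \<B>) = Suc (card \<B>)"
proof -
  have "B \<notin> \<B>" using assms(2,4) conn_not_empty by blast
  then show "card (insert B \<B>) = Suc (card \<B>)" using assms(1) by (simp add: branch_sets_def)
  show "branch_sets E V (insert B \<B>)"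
    using assms linked_sym unfolding branch_sets_def by (simp add: Int_commute)
qed

lemma adjacency_contr: "adjacency (contr v u E)"
proof
  fix x y assume "contr v u E x y"
  then show "contr v u E y x" unfolding contr_def using sym by metis
qed (simp add: contr_def)

text \<open>Branch sets are lifted to their preimages, so that the one containing \<open>v\<close>,
  if any, receives \<open>u\<close> as well.\<close>

lemma clique_model_contr:
  assumes "clique_model (contr v u E) (V - {u}) r" "E v u" "v \<in> V" "u \<in> V"
  shows "clique_model E V r"
proof -
  let ?q = "id(u := v)"
  have vu: "v \<noteq> u" using assms(2) by auto
  obtain \<B> where \<B>: "branch_sets (contr v u E) (V - {u}) \<B>" "card \<B> = r"
    using assms(1) unfolding clique_model_def by blast
  have qB: "?q ` (?q -` B) = B" if "B \<in> \<B>" for B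
  proof -
    have "u \<notin> B" using that \<B>(1) unfolding branch_sets_def by blast
    then show ?thesis using vu by (auto simp: image_iff split: if_splits)
  qed
  have lk: "linked E (?q -` B) (?q -` C)" if "linked (contr v u E) B C" for B C
    using that unfolding linked_def contr_def by blast
  have cn: "conn E (?q -` B)" if B: "B \<in> \<B>" for B
    unfolding conn_def
  proof (intro conjI allI impI)
    have cB: "conn (contr v u E) B" using B \<B>(1) unfolding branch_sets_def by blast
    then show "?q -` B \<noteq> {}" using qB[OF B] by (auto simp: conn_def)
    fix S assume S: "S \<subset> ?q -` B" "S \<noteq> {}"
    \<comment> \<open>A cut between \<open>u\<close> and \<open>v\<close> is crossed by the
      contracted edge itself. Every other cut is a union of fibres of \<open>?q\<close> and descends
      to the contraction.\<close>
    show "linked E S (?q -` B - S)"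
    proof (cases "u \<in> ?q -` B \<and> (u \<in> S \<longleftrightarrow> v \<notin> S)")
      case True
      then have "u \<in> ?q -` B" "v \<in> ?q -` B" using vu by auto
      then show ?thesis using True assms(2) sym[OF assms(2)] unfolding linked_def by blast
    next
      case False
      have "x \<in> S" if "?q x = ?q y" "y \<in> S" for x y
      proof (cases "x = y")
        case False
        then have "x = u \<and> y = v \<or> x = v \<and> y = u" using that(1) by (auto split: if_splits)
        then show ?thesis using \<open>\<not> (u \<in> _ \<and> _)\<close> that S(1) vu by auto
      qed (use that in simp)
      then have "S = ?q -` (?q ` S)" by blast
      moreover have "?q ` S \<subset> B"
        using S calculation by blast
      with S(2) have "linked (contr v u E) (?q ` S) (B - ?q ` S)"
        using cB unfolding conn_def by blast
      ultimately show ?thesis using lk[of "?q ` S" "B - ?q ` S"] by (simp add: vimage_Diff)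
    qed
  qed
  have "branch_sets E V ((-`) ?q ` \<B>)"
    unfolding branch_sets_def
  proof (intro conjI ballI impI)
    show "finite ((-`) ?q ` \<B>)" using \<B>(1) by (simp add: branch_sets_def)
    fix B' assume "B' \<in> (-`) ?q ` \<B>"
    then obtain B where B: "B \<in> \<B>" "B' = ?q -` B" by blast
    have "B \<subseteq> V" using B(1) \<B>(1) unfolding branch_sets_def by blast
    then show "B' \<subseteq> V" using B(2) assms(4) by (auto split: if_splits)
    show "conn E B'" using cn B by blast
    fix C' assume "C' \<in> (-`) ?q ` \<B>" and ne: "B' \<noteq> C'"
    then obtain C where C: "C \<in> \<B>" "C' = ?q -` C" by blast
    have "B \<inter> C = {}" "linked (contr v u E) B C"
      using B C ne \<B>(1) unfolding branch_sets_def by blast+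
    then show "B' \<inter> C' = {}" "linked E B' C'" using lk B C by blast+
  qed
  moreover have "inj_on ((-`) ?q) \<B>" by (metis inj_onI qB)
  ultimately show ?thesis
    unfolding clique_model_def using \<B>(2) card_image by metis
qed

lemma branch_sets_empty: "branch_sets E V {}"
  by (simp add: branch_sets_def)

lemma branch_sets_3:
  assumes "conn E P" "conn E Q" "conn E S" "P \<union> Q \<union> S \<subseteq> V"
    "P \<inter> Q = {}" "P \<inter> S = {}" "Q \<inter> S = {}" "linked E P Q" "linked E P S" "linked E Q S"
  shows "branch_sets E V {P, Q, S}" "card {P, Q, S} = 3"
proof -
  note 1 = branch_sets_insert[OF branch_sets_empty, of S V]
  note 2 = branch_sets_insert[OF 1(1), of Q]
  note 3 = branch_sets_insert[OF 2(1), of P]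
  show "branch_sets E V {P, Q, S}" using 3(1) assms by blast
  have "P \<noteq> Q" "P \<noteq> S" "Q \<noteq> S" using assms(1-7) conn_not_empty by blast+
  then show "card {P, Q, S} = 3" by simp
qed

lemma card_nb_insert:
  assumes "x \<notin> V" "finite V"
  shows "card (nb E (insert x V) y) = of_bool (E y x) + card (nb E V y)"
proof -
  have "nb E (insert x V) y = (if E y x then insert x (nb E V y) else nb E V y)" by auto
  then show ?thesis using assms by simp
qed

lemma card_nb_empty [simp]: "card (nb E {} y) = 0"
  by (simp add: nb_def)

text \<open>Degree bounds become clauses for a propositional solver: at least two of four hold iff
  no three fail, that is, iff each triple contains one that holds. The next lemma treats four of six
  in the same way, its triples being grouped by how they meet \<open>p\<close> and
  \<open>q\<close>.\<close>

lemma of_bool_two_le: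
  "2 \<le> of_bool a + of_bool b + of_bool c + (of_bool d :: nat) \<longleftrightarrow>
    (a \<or> b \<or> c) \<and> (a \<or> b \<or> d) \<and> (a \<or> c \<or> d) \<and> (b \<or> c \<or> d)"
  by (cases a; cases b; cases c; cases d) simp_all

lemma of_bool_four_le:
  "4 \<le> of_bool a + of_bool b + of_bool c + of_bool d + of_bool p + (of_bool q :: nat) \<longleftrightarrow>
    (a \<or> b \<or> c) \<and> (a \<or> b \<or> d) \<and> (a \<or> c \<or> d) \<and> (b \<or> c \<or> d) \<and> (p \<or> q \<or> a) \<and> (p \<or> q \<or> b) \<and>
    (p \<or> q \<or> c) \<and> (p \<or> q \<or> d) \<and>
    (p \<and> q \<or> (a \<or> b) \<and> (a \<or> c) \<and> (a \<or> d) \<and> (b \<or> c) \<and> (b \<or> d) \<and> (c \<or> d))"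
  by (cases a; cases b; cases c; cases d; cases p; cases q) simp_all

(* A and B will be the neighbourhoods of two further vertices of degree at least 4, so that the three
   branch sets extend to a clique model containing those two vertices as singletons. *)
lemma rooted_triangle:
  assumes R: "finite R" "card R \<le> 5"
    and deg: "\<And>x. x \<in> R \<Longrightarrow> 4 \<le> card (nb E R x) + of_bool (x \<in> A) + of_bool (x \<in> B)"
    and AB: "3 \<le> card (R \<inter> A \<inter> B)"
  shows "\<exists>\<B>. branch_sets E R \<B> \<and> card \<B> = 3 \<and> (\<forall>X\<in>\<B>. X \<inter> A \<noteq> {} \<and> X \<inter> B \<noteq> {})" (is ?thesis)
proof (rule ccontr)
  assume contra: "\<not> ?thesis"
  have no: False if "conn E P" "conn E Q" "conn E S" "P \<union> Q \<union> S \<subseteq> R"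
    "P \<inter> Q = {}" "P \<inter> S = {}" "Q \<inter> S = {}" "linked E P Q" "linked E P S" "linked E Q S"
    "P \<inter> A \<noteq> {}" "P \<inter> B \<noteq> {}" "Q \<inter> A \<noteq> {}" "Q \<inter> B \<noteq> {}" "S \<inter> A \<noteq> {}" "S \<inter> B \<noteq> {}" for P Q S
    using contra branch_sets_3[of P Q S R] that by blast
  obtain K where K: "K \<subseteq> R \<inter> A \<inter> B" "card K = 3" "finite K"
    using AB obtain_subset_with_card_n by metis
  obtain c d e where cde: "K = {c, d, e}" "c \<noteq> d" "c \<noteq> e" "d \<noteq> e"
    using K(2) by (auto simp: card_3_iff)
  have RK: "R = K \<union> (R - K)" and fR: "finite (R - K)" using K R by auto
  have "card (R - K) \<le> 2" using K R by (simp add: card_Diff_subset)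
  have good: "c \<in> A" "d \<in> A" "e \<in> A" "c \<in> B" "d \<in> B" "e \<in> B" using K(1) cde by auto
  have bs: "E y x \<longleftrightarrow> E x y" for x y using sym by blast
  consider "R - K = {}" | f where "R - K = {f}" | f g where "R - K = {f, g}" "f \<noteq> g"
  proof -
    have "card (R - K) = 0 \<or> card (R - K) = 1 \<or> card (R - K) = 2" using \<open>card (R - K) \<le> 2\<close> by linarith
    then show thesis using that fR by (auto simp: card_1_singleton_iff card_2_iff)
  qed
  then show False
  proof cases
    case 1
    then have Re: "R = {c, d, e}" using RK cde by auto
    show False
      using deg[of c] deg[of d] deg[of e] no[of "{c}" "{d}" "{e}"] cde good
      unfolding Re by (auto simp: card_nb_insert linked_def of_bool_def split: if_splits)
  next
    case (2 f)
    then have Re: "R = {c, d, e, f}" using RK cde by auto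
    have f: "f \<notin> {c, d, e}" using 2 cde by auto
    show False
      using deg[of c] deg[of d] deg[of e] deg[of f] no[of "{c}" "{d}" "{e}"]
        no[of "{c,f}" "{d}" "{e}"] no[of "{c}" "{d}" "{e,f}"] cde good f
      unfolding Re by (auto simp: card_nb_insert linked_def of_bool_def conn_pair bs split: if_splits)
  next
    case (3 f g)
    then have Re: "R = {c, d, e, f, g}" using RK cde by auto
    have fg: "f \<notin> {c, d, e}" "g \<notin> {c, d, e}" "f \<noteq> g" using 3 cde by auto
    have cn: "conn E {x, y, z}" if "E x y \<and> E y z \<or> E x y \<and> E x z \<or> E x z \<and> E y z" for x y z
      using that conn_Un[of "{x, y}" "{z}"] conn_Un[of "{x, z}" "{y}"] conn_pair[of x y] conn_pair[of x z]
      by (auto simp: linked_def insert_commute bs)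
    have neq: "c \<noteq> d" "c \<noteq> e" "d \<noteq> e" "c \<noteq> f" "d \<noteq> f" "e \<noteq> f" "c \<noteq> g" "d \<noteq> g" "e \<noteq> g" "f \<noteq> g"
      using cde fg by auto
    note dist = cde(2-4) fg good bs
    \<comment> \<open>From here to \<open>n3\<close> a selection of models is excluded: the three
      singletons; one or both of \<open>f\<close>, \<open>g\<close> merged into one of
      \<open>c\<close>, \<open>d\<close>, \<open>e\<close>; \<open>f\<close> and \<open>g\<close>
      merged into different ones; \<open>f\<close> in place of one of the three. In twelve truth
      values, ten edges and the memberships of \<open>f\<close> in \<open>A\<close> and
      \<open>B\<close>, this already contradicts the degrees of \<open>c\<close>, \<open>d\<close>,
      \<open>e\<close>, \<open>f\<close>.\<close>
    have n: "\<not> (E c d \<and> E c e \<and> E d e)"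
      "\<not> (E c f \<and> (E c d \<or> E f d) \<and> (E c e \<or> E f e) \<and> E d e)"
      "\<not> (E c g \<and> (E c d \<or> E g d) \<and> (E c e \<or> E g e) \<and> E d e)"
      "\<not> (E e f \<and> (E c e \<or> E c f) \<and> (E d e \<or> E d f) \<and> E c d)"
      using no[of "{c}" "{d}" "{e}"] no[of "{c,f}" "{d}" "{e}"] no[of "{c,g}" "{d}" "{e}"]
       no[of "{c}" "{d}" "{e,f}"] dist
      unfolding Re by (auto simp: linked_def conn_pair)
    have n': "\<not> (E d f \<and> E e g \<and> (E c d \<or> E c f) \<and> (E c e \<or> E c g) \<and> (E d e \<or> E d g \<or> E f e \<or> E f g))"
      "\<not> (E d g \<and> E e f \<and> (E c d \<or> E c g) \<and> (E c e \<or> E c f) \<and> (E d e \<or> E d f \<or> E g e \<or> E g f))"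
      using no[of "{c}" "{d,f}" "{e,g}"] no[of "{c}" "{d,g}" "{e,f}"] dist
      unfolding Re by (auto simp: linked_def conn_pair)
    have n'': "\<not> (f \<in> A \<and> f \<in> B \<and> E c d \<and> E c f \<and> E d f)"
      "\<not> (f \<in> A \<and> f \<in> B \<and> E c e \<and> E c f \<and> E e f)"
      "\<not> (f \<in> A \<and> f \<in> B \<and> E d e \<and> E d f \<and> E e f)"
      using no[of "{c}" "{d}" "{f}"] no[of "{c}" "{e}" "{f}"] no[of "{d}" "{e}" "{f}"] dist
      unfolding Re by (auto simp: linked_def conn_pair)
    have n3: "\<not> ((E d f \<and> E f g \<or> E d f \<and> E d g \<or> E d g \<and> E f g) \<and> (E c d \<or> E c f \<or> E c g) \<and>
        (E e d \<or> E e f \<or> E e g) \<and> E c e)"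
      "\<not> ((E e f \<and> E f g \<or> E e f \<and> E e g \<or> E e g \<and> E f g) \<and> (E c e \<or> E c f \<or> E c g) \<and>
        (E d e \<or> E d f \<or> E d g) \<and> E c d)"
      using no[of "{c}" "{d,f,g}" "{e}"] no[of "{c}" "{d}" "{e,f,g}"] dist cn[of d f g] cn[of e f g]
      unfolding Re by (auto simp: linked_def)
    \<comment> \<open>Each edge gets one orientation, so that it is a single atom for
      \<open>sat\<close>.\<close>
    have or: "E d c = E c d" "E e c = E c e" "E f c = E c f" "E g c = E c g" "E e d = E d e"
      "E f d = E d f" "E g d = E d g" "E f e = E e f" "E g e = E e g" "E g f = E f g"
      using sym by blast+
    have "card (nb E R c) = of_bool (E c d) + of_bool (E c e) + of_bool (E c f) + of_bool (E c g)"
      "card (nb E R d) = of_bool (E c d) + of_bool (E d e) + of_bool (E d f) + of_bool (E d g)"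
      "card (nb E R e) = of_bool (E c e) + of_bool (E d e) + of_bool (E e f) + of_bool (E e g)"
      "card (nb E R f) = of_bool (E c f) + of_bool (E d f) + of_bool (E e f) + of_bool (E f g)"
      using neq unfolding Re by (simp_all add: card_nb_insert or)
    note cards = this
    have "2 \<le> of_bool (E c d) + of_bool (E c e) + of_bool (E c f) + (of_bool (E c g) :: nat)"
       "2 \<le> of_bool (E c d) + of_bool (E d e) + of_bool (E d f) + (of_bool (E d g) :: nat)"
       "2 \<le> of_bool (E c e) + of_bool (E d e) + of_bool (E e f) + (of_bool (E e g) :: nat)"
       "4 \<le> of_bool (E c f) + of_bool (E d f) + of_bool (E e f) + of_bool (E f g) +
          of_bool (f \<in> A) + (of_bool (f \<in> B) :: nat)"
      using deg[of c] deg[of d] deg[of e] deg[of f] good unfolding cards by (simp_all add: Re)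
    then show False using n n' n'' n3 unfolding or of_bool_two_le of_bool_four_le by sat
  qed
qed

section \<open>Mader's theorem\<close>

text \<open>With \<open>A\<close> and \<open>B\<close> the neighbourhoods of \<open>x\<close> and
  \<open>y\<close>, the degree of a vertex in \<open>H\<close> is its degree in the rest plus its
  two memberships, which is the count in \<open>rooted_triangle\<close>.\<close>

lemma link_triangle:
  assumes H: "finite H" "card H \<le> 7" and deg: "\<And>h. h \<in> H \<Longrightarrow> 4 \<le> card (nb E H h)"
    and xy: "x \<in> H" "y \<in> H" "x \<noteq> y" and c: "3 \<le> card (nb E H x \<inter> nb E H y)"
  shows "\<exists>\<B>. branch_sets E (H - {x, y}) \<B> \<and> card \<B> = 3 \<and>
    (\<forall>X\<in>\<B>. linked E {x} X \<and> linked E {y} X)"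
proof -
  let ?R = "H - {x, y}"
  have HR: "H = insert x (insert y ?R)" using xy by auto
  have "4 \<le> card (nb E ?R h) + of_bool (h \<in> nb E H x) + of_bool (h \<in> nb E H y)" if "h \<in> ?R" for h
  proof -
    have "card (nb E H h) = of_bool (E h x) + (of_bool (E h y) + card (nb E ?R h))"
      using xy(3) H(1) by (subst HR) (simp add: card_nb_insert)
    moreover have "E h x = E x h" "E h y = E y h" using sym by blast+
    ultimately show ?thesis using deg[of h] that by simp
  qed
  moreover have "card ?R \<le> 5" using H xy by (simp add: card_Diff_subset)
  moreover have "?R \<inter> nb E H x \<inter> nb E H y = nb E H x \<inter> nb E H y" by auto
  ultimately obtain \<B> where \<B>: "branch_sets E ?R \<B>" "card \<B> = 3"
    "\<forall>X\<in>\<B>. X \<inter> nb E H x \<noteq> {} \<and> X \<inter> nb E H y \<noteq> {}"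
    using rooted_triangle[of ?R "nb E H x" "nb E H y"] H(1) c by auto
  moreover have "linked E {x} X \<and> linked E {y} X" if "X \<in> \<B>" for X
    using \<B>(3) that unfolding linked_def by fastforce
  ultimately show ?thesis by blast
qed

section \<open>The link of a vertex of degree at most 7\<close>

context
  fixes V H v
  assumes fin: "finite V" and H: "H = nb E V v" and v: "v \<in> V" and small: "card H \<le> 7"
    and deg: "\<forall>h\<in>H. 4 \<le> card (nb E H h)" and no_K6: "\<not> clique_model E V 6"
begin

lemma finite_link: "finite H"
  using fin H by simp

text \<open>The three branch sets in the link, \<open>{y}\<close>, \<open>D\<close> and
  \<open>{v}\<close> form a K_6 model: \<open>D\<close> reaches the three sets through
  \<open>x\<close>, and \<open>v\<close> reaches every set that meets its link.\<close>

lemma no_rooted_K5: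
  assumes "x \<in> H" "y \<in> H" "x \<noteq> y" "3 \<le> card (nb E H x \<inter> nb E H y)"
    and D: "conn E D" "D \<inter> H = {x}" "v \<notin> D" "D \<subseteq> V" "linked E D {y}"
  shows False
proof -
  obtain \<B> where \<B>: "branch_sets E (H - {x, y}) \<B>" "card \<B> = 3"
    "\<forall>X\<in>\<B>. linked E {x} X \<and> linked E {y} X"
    using link_triangle[OF finite_link small _ assms(1-4)] deg by blast
  have sub: "X \<subseteq> H - {x, y}" "X \<noteq> {}" if "X \<in> \<B>" for X
    using \<B>(1) that conn_not_empty[of E X] unfolding branch_sets_def by auto
  have vH: "v \<notin> H" "H \<subseteq> V" and vl: "linked E {v} X" if "X \<inter> H \<noteq> {}" for X
    using that H unfolding linked_def by auto
  have "branch_sets E V \<B>"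
    by (rule branch_sets_mono[OF \<B>(1)]) (use H in auto)
  note 1 = branch_sets_insert[OF this, of "{y}"]
  have b1: "branch_sets E V (insert {y} \<B>)" "card (insert {y} \<B>) = 4"
    using 1 assms(2) sub \<B>(2,3) H by fastforce+
  note 2 = branch_sets_insert[OF b1(1), of D]
  have "D \<inter> C = {} \<and> linked E D C" if "C \<in> insert {y} \<B>" for C
  proof (cases "C = {y}")
    case True
    then show ?thesis using D assms(2,3) by auto
  next
    case False
    then have C: "C \<in> \<B>" using that by blast
    then have "linked E {x} C" using \<B>(3) by blast
    then have "linked E D C" by (rule linked_mono) (use D(2) in auto)
    then show ?thesis using sub[OF C] D(2) by auto
  qed
  then have b2: "branch_sets E V (insert D (insert {y} \<B>))" "card (insert D (insert {y} \<B>)) = 5"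
    using 2 D b1(2) by simp_all
  note 3 = branch_sets_insert[OF b2(1), of "{v}"]
  have "{v} \<inter> C = {} \<and> linked E {v} C" if "C \<in> insert D (insert {y} \<B>)" for C
  proof -
    have "C \<inter> H \<noteq> {}" "v \<notin> C"
      using that D assms(1,2) sub H by fastforce+
    then show ?thesis using vl by auto
  qed
  then have "clique_model E V 6" unfolding clique_model_def using 3 v b2(2) by fastforce
  then show False using no_K6 by blast
qed

text \<open>The case \<open>D = {x}\<close> of \<open>no_rooted_K5\<close>. As in a triangulated
  sphere, an edge of the link lies in at most two of its triangles.\<close>

lemma link_edge:
  assumes "x \<in> H" "y \<in> H" "E x y"
  shows "card (nb E H x \<inter> nb E H y) \<le> 2"
proof (rule ccontr)
  assume "\<not> ?thesis"
  moreover have "x \<noteq> y" "v \<noteq> x" "x \<in> V" using assms H irrefl by auto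
  ultimately show False using no_rooted_K5[of x y "{x}"] assms by (simp add: linked_def)
qed

text \<open>Two neighbourhoods of size at least four among the five remaining vertices overlap in
  three, and \<open>C\<close> replaces the missing edge. So the attachments in the link of a
  connected set outside form a clique.\<close>

lemma link_nonedge:
  assumes xy: "x \<in> H" "y \<in> H" "x \<noteq> y" "\<not> E x y"
    and C: "conn E C" "C \<subseteq> V - H - {v}" "linked E C {x}" "linked E C {y}"
  shows False
proof -
  have "nb E H x \<union> nb E H y \<subseteq> H - {x, y}" using assms sym by auto
  then have "card (nb E H x \<union> nb E H y) \<le> card (H - {x, y})"
    using finite_link by (intro card_mono) auto
  moreover have "card (H - {x, y}) \<le> 5" using small finite_link xy by (simp add: card_Diff_subset)
  moreover have "card (nb E H x) + card (nb E H y) =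
      card (nb E H x \<union> nb E H y) + card (nb E H x \<inter> nb E H y)"
    by (rule card_Un_Int) (use finite_link in simp_all)
  ultimately have "3 \<le> card (nb E H x \<inter> nb E H y)"
    using bspec[OF deg xy(1)] bspec[OF deg xy(2)] by linarith
  moreover have "conn E (insert x C)" using conn_Un[OF C(1) conn_singleton[of E x]] C(3) by simp
  moreover have "linked E (insert x C) {y}" using C(4) unfolding linked_def by blast
  moreover have "insert x C \<inter> H = {x}" "v \<notin> insert x C" "insert x C \<subseteq> V" using C xy H by auto
  ultimately show False using no_rooted_K5[of x y "insert x C"] xy by blast
qed

text \<open>A vertex \<open>e\<close> of the link outside a K_4 has at most two neighbours beyond
  these five vertices, hence two neighbours \<open>p\<close> and \<open>q\<close> in the K_4. The
  edge between \<open>p\<close> and \<open>q\<close> then lies in three triangles, formed with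
  \<open>e\<close> and with the other two vertices of the K_4.\<close>

lemma link_clique:
  assumes K: "K \<subseteq> H" "\<And>x y. x \<in> K \<Longrightarrow> y \<in> K \<Longrightarrow> x \<noteq> y \<Longrightarrow> E x y"
  shows "card K \<le> 3"
proof (rule ccontr)
  assume "\<not> ?thesis"
  then have "4 \<le> card K" by simp
  from obtain_subset_with_card_n[OF this] obtain K' where K': "K' \<subseteq> K" "card K' = 4" "finite K'" .
  have "K' \<noteq> {}" using K'(2) by auto
  then obtain a where a: "a \<in> K'" by blast
  have "a \<in> H" using a K K' by blast
  have "card (K' - {a}) = 3" using a K' by simp
  then have "\<not> nb E H a \<subseteq> K' - {a}"
    using bspec[OF deg \<open>a \<in> H\<close>] card_mono[of "K' - {a}" "nb E H a"] K'(3) by auto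
  then obtain e where "e \<in> nb E H a" "e \<notin> K' - {a}" by blast
  then have e: "e \<in> H" "e \<notin> K'" by auto
  have KH: "K' \<subseteq> H" using K K' by blast
  have "nb E H e \<subseteq> (nb E H e \<inter> K') \<union> (H - insert e K')" by auto
  then have "card (nb E H e) \<le> card ((nb E H e \<inter> K') \<union> (H - insert e K'))"
    using finite_link by (intro card_mono) auto
  also have "\<dots> \<le> card (nb E H e \<inter> K') + card (H - insert e K')" by (rule card_Un_le)
  also have "card (H - insert e K') = card H - 5"
    using e KH K' by (subst card_Diff_subset) auto
  finally have "2 \<le> card (nb E H e \<inter> K')" using bspec[OF deg e(1)] small by linarith
  from obtain_subset_with_card_n[OF this]
  obtain L where "L \<subseteq> nb E H e \<inter> K'" "card L = 2" "finite L" .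
  then obtain p q where pq: "p \<in> K'" "q \<in> K'" "p \<noteq> q" "E e p" "E e q"
    by (auto simp: card_2_iff)
  have "insert e (K' - {p, q}) \<subseteq> nb E H p \<inter> nb E H q"
    using pq K(2) K'(1) KH e(1) sym by (simp add: subset_iff)
  then have "card (insert e (K' - {p, q})) \<le> card (nb E H p \<inter> nb E H q)"
    using finite_link by (intro card_mono) auto
  moreover have "card (insert e (K' - {p, q})) = 3"
    using K' pq e by (simp add: card_Diff_subset)
  moreover have "card (nb E H p \<inter> nb E H q) \<le> 2"
    using link_edge[of p q] pq K K' by blast
  ultimately show False by linarith
qed

end

text \<open>\<open>C\<close> is the component of \<open>W\<close> around \<open>D\<close>, obtained
  as a maximal connected set; by maximality it absorbs every connected set that touches it.\<close>

lemma maximal_conn: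
  assumes "finite W" "conn E D" "D \<subseteq> W"
  obtains C where "conn E C" "D \<subseteq> C" "C \<subseteq> W"
    "\<And>C'. conn E C' \<Longrightarrow> C' \<subseteq> W \<Longrightarrow> C \<inter> C' \<noteq> {} \<or> linked E C C' \<Longrightarrow> C' \<subseteq> C"
proof -
  define \<C> where "\<C> = {C. conn E C \<and> D \<subseteq> C \<and> C \<subseteq> W}"
  have "finite \<C>" by (rule finite_subset[of _ "Pow W"]) (use assms(1) in \<open>auto simp: \<C>_def\<close>)
  moreover have "D \<in> \<C>" using assms by (simp add: \<C>_def)
  ultimately obtain C where C: "C \<in> \<C>" and mx: "\<forall>C'\<in>\<C>. C \<subseteq> C' \<longrightarrow> C = C'"
    using finite_has_maximal2[of \<C> D] by blast
  show thesis
  proof (rule that[of C])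
    fix C' assume "conn E C'" "C' \<subseteq> W" "C \<inter> C' \<noteq> {} \<or> linked E C C'"
    then have "C \<union> C' \<in> \<C>" using C conn_Un[of C C'] by (auto simp: \<C>_def)
    then show "C' \<subseteq> C" using mx by blast
  qed (use C in \<open>auto simp: \<C>_def\<close>)
qed

definition clique :: "'a set \<Rightarrow> bool" where
  "clique T \<longleftrightarrow> (\<forall>x\<in>T. \<forall>y\<in>T. x \<noteq> y \<longrightarrow> E x y)"

(* The edges inside the clique T are exempt, because T will separate V from the rest of a larger
   graph, where they may have lost common neighbours. *)
definition rich :: "'a set \<Rightarrow> 'a set \<Rightarrow> bool" where
  "rich V T \<longleftrightarrow> T \<subseteq> V \<and> clique T \<and>
     (\<forall>x\<in>V. \<forall>y\<in>V. E x y \<longrightarrow> \<not> (x \<in> T \<and> y \<in> T) \<longrightarrow> 4 \<le> card (nb E V x \<inter> nb E V y))"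

text \<open>Some edge of the link has a common neighbour beyond the link and \<open>v\<close>; the
  component of this neighbour, together with its attachments, is the new graph. It must avoid
  \<open>T\<close>, because edges inside \<open>T\<close> need not lie in four triangles. Therefore
  a set \<open>S\<close> is excluded before the edge is chosen.\<close>

lemma rich_step:
  assumes V: "finite V" and T: "rich V T" and v: "v \<in> V" "v \<notin> T" and H: "nb E V v \<noteq> {}"
    "card (nb E V v) \<le> 7" and no_K6: "\<not> clique_model E V 6"
  obtains V' T' x y where "V' \<subset> V" "rich V' T'" "card T' \<le> 3" "x \<in> V'" "y \<in> V'" "x \<notin> T'" "E x y"
proof -
  define H where "H = nb E V v"
  have fH: "finite H" and HV: "H \<subseteq> V" "v \<notin> H" using V by (auto simp: H_def)
  have deg: "4 \<le> card (nb E H h)" if "h \<in> H" for h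
  proof -
    have "nb E V v \<inter> nb E V h = nb E H h" by (auto simp: H_def)
    moreover have "h \<in> V" "E v h" using that by (auto simp: H_def)
    ultimately show ?thesis using T v unfolding rich_def by metis
  qed
  have deg': "\<forall>h\<in>H. 4 \<le> card (nb E H h)" using deg by blast
  have H7: "card H \<le> 7" using H(2) by (simp add: H_def)
  note edge = link_edge[OF V H_def v(1) H7 deg' no_K6]
  note nonedge = link_nonedge[OF V H_def v(1) H7 deg' no_K6]
  note small_clique = link_clique[OF V H_def v(1) H7 deg' no_K6]
  let ?W = "V - H - {v}"
  have att: "clique {x \<in> H. linked E C {x}}" "card {x \<in> H. linked E C {x}} \<le> 3"
    if C: "conn E C" "C \<subseteq> ?W" for C
  proof -
    show 1: "clique {x \<in> H. linked E C {x}}" unfolding clique_def using nonedge[OF _ _ _ _ C] by blast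
    show "card {x \<in> H. linked E C {x}} \<le> 3"
      by (rule small_clique) (use 1 in \<open>auto simp: clique_def\<close>)
  qed
  have TV: "T \<subseteq> V" "clique T" using T by (auto simp: rich_def)
  \<comment> \<open>\<open>S\<close> contains whatever part of the link may lead to
    \<open>T\<close>. If \<open>T\<close> lies in the link, it is \<open>T\<close> itself. Otherwise
    \<open>T - H\<close>, being a clique, lies in one component \<open>D\<close> beyond the link,
    and \<open>S\<close> consists of the attachments of \<open>D\<close>.\<close>
  obtain S where S: "S \<subseteq> H" "card S \<le> 3" "T \<inter> H \<subseteq> S"
    and disj: "\<And>C x. conn E C \<Longrightarrow> C \<subseteq> ?W \<Longrightarrow> x \<in> H - S \<Longrightarrow> linked E C {x} \<Longrightarrow> C \<inter> T = {}"
  proof (cases "T - H = {}")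
    case True
    show thesis
    proof (rule that[of "T \<inter> H"])
      show "card (T \<inter> H) \<le> 3" using small_clique[of "T \<inter> H"] TV(2) by (auto simp: clique_def)
    qed (use True in auto)
  next
    case False
    have TW: "T - H \<subseteq> ?W" using TV v by blast
    have "conn E (T - H)" using False TV(2) by (intro conn_clique) (auto simp: clique_def)
    from maximal_conn[OF _ this TW] V obtain D where D: "conn E D" "T - H \<subseteq> D" "D \<subseteq> ?W"
      "\<And>C'. conn E C' \<Longrightarrow> C' \<subseteq> ?W \<Longrightarrow> D \<inter> C' \<noteq> {} \<or> linked E D C' \<Longrightarrow> C' \<subseteq> D"
      by (metis finite_Diff)
    show thesis
    proof (rule that[of "{x \<in> H. linked E D {x}}"])
      show "card {x \<in> H. linked E D {x}} \<le> 3" by (rule att) (use D in auto)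
      show "T \<inter> H \<subseteq> {x \<in> H. linked E D {x}}"
      proof
        fix x assume x: "x \<in> T \<inter> H"
        obtain t where t: "t \<in> T - H" using False by blast
        then have "t \<noteq> x" using x by blast
        then have "t \<in> D" "E t x" using t x D(2) TV(2) unfolding clique_def by blast+
        then show "x \<in> {x \<in> H. linked E D {x}}" using x by (auto simp: linked_def)
      qed
      fix C x assume C: "conn E C" "C \<subseteq> ?W" "x \<in> H - {x \<in> H. linked E D {x}}" "linked E C {x}"
      have "C \<inter> D = {}"
      proof (rule ccontr)
        assume "C \<inter> D \<noteq> {}"
        then have "C \<subseteq> D" using D(4)[OF C(1,2)] by blast
        then have "linked E D {x}" using C(4) linked_mono by blast
        then show False using C(3) by blast
      qed
      then show "C \<inter> T = {}" using C(2) D(2) by blast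
    qed auto
  qed
  obtain h where "h \<in> H" using H unfolding H_def by blast
  have "insert h (nb E H h) \<subseteq> H" "card (insert h (nb E H h)) = Suc (card (nb E H h))"
    using \<open>h \<in> H\<close> fH by auto
  then have "5 \<le> card H" using card_mono[OF fH, of "insert h (nb E H h)"] deg[OF \<open>h \<in> H\<close>] by linarith
  then have "\<not> H \<subseteq> S" using S(2) card_mono[of S H] S(1) fH finite_subset by fastforce
  then obtain x where x: "x \<in> H" "x \<notin> S" by blast
  have "nb E H x \<noteq> {}" using deg[OF x(1)] by auto
  then obtain y where y: "y \<in> H" "E x y" by auto
  \<comment> \<open>As \<open>x\<close> is not in \<open>T\<close>, the edge has four common
    neighbours. The vertex \<open>v\<close> and at most two vertices of the link account for three,
    so one lies beyond.\<close>
  have "4 \<le> card (nb E V x \<inter> nb E V y)"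
    using T x y S(3) HV unfolding rich_def by blast
  moreover have "card (insert v (nb E H x \<inter> nb E H y)) \<le> 3"
    using edge[OF x(1) y] card_insert_le_m1[of 3 "nb E H x \<inter> nb E H y" v] by simp
  ultimately have "\<not> nb E V x \<inter> nb E V y \<subseteq> insert v (nb E H x \<inter> nb E H y)"
    using card_mono[of "insert v (nb E H x \<inter> nb E H y)" "nb E V x \<inter> nb E V y"] fH by auto
  then obtain w where "w \<in> nb E V x \<inter> nb E V y" "w \<notin> insert v (nb E H x \<inter> nb E H y)" by blast
  then have w: "w \<in> ?W" "E x w" "E y w" by auto
  obtain C where C: "conn E C" "w \<in> C" "C \<subseteq> ?W"
    and mx: "\<And>C'. conn E C' \<Longrightarrow> C' \<subseteq> ?W \<Longrightarrow> C \<inter> C' \<noteq> {} \<or> linked E C C' \<Longrightarrow> C' \<subseteq> C"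
    using maximal_conn[of ?W "{w}"] V w(1) by (metis conn_singleton empty_subsetI finite_Diff insert_subset)
  define T' where "T' = {x \<in> H. linked E C {x}}"
  have CT: "C \<inter> T = {}"
    by (rule disj[OF C(1,3), of x]) (use x w C(2) sym in \<open>auto simp: linked_def\<close>)
  \<comment> \<open>An edge leaving \<open>C\<close> ends in an attachment: no vertex of
    \<open>C\<close> is adjacent to \<open>v\<close>, and anything else would be absorbed. Hence
    edges with an end in \<open>C\<close> keep all their triangles.\<close>
  have close: "b \<in> C \<union> T'" if "a \<in> C" "E a b" "b \<in> V" for a b
  proof (cases "b \<in> H")
    case True
    then show ?thesis using that by (auto simp: T'_def linked_def)
  next
    case False
    moreover have "b \<noteq> v" using that C(3) sym by (auto simp: H_def)
    ultimately have "{b} \<subseteq> C" using that by (intro mx) (auto simp: linked_def)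
    then show ?thesis by blast
  qed
  have nbC: "nb E (C \<union> T') a = nb E V a" if "a \<in> C" for a
    using close[OF that] C(3) HV by (auto simp: T'_def)
  have rich': "rich (C \<union> T') T'"
    unfolding rich_def
  proof (intro conjI ballI impI)
    show "clique T'" using att(1)[OF C(1,3)] by (simp add: T'_def)
    have key: "4 \<le> card (nb E (C \<union> T') a \<inter> nb E (C \<union> T') b)" if "a \<in> C" "b \<in> C \<union> T'" "E a b" for a b
    proof -
      have "nb E (C \<union> T') a \<inter> nb E (C \<union> T') b = nb E V a \<inter> nb E V b"
        using nbC[OF that(1)] C(3) HV by (auto simp: T'_def)
      moreover have "a \<in> V" "b \<in> V" "a \<notin> T" using that CT C(3) HV by (auto simp: T'_def)
      ultimately show ?thesis using T that(3) unfolding rich_def by auto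
    qed
    fix a b assume ab: "a \<in> C \<union> T'" "b \<in> C \<union> T'" "E a b" "\<not> (a \<in> T' \<and> b \<in> T')"
    then show "4 \<le> card (nb E (C \<union> T') a \<inter> nb E (C \<union> T') b)"
      using key[of a b] key[of b a] sym[of a b] by (auto simp: Int_commute)
  qed simp
  show thesis
  proof (rule that[of "C \<union> T'" T' w x])
    show "C \<union> T' \<subset> V" using C(3) HV v by (auto simp: T'_def)
    show "card T' \<le> 3" using att(2)[OF C(1,3)] by (simp add: T'_def)
    show "w \<notin> T'" using w by (auto simp: T'_def)
    show "x \<in> C \<union> T'" using x w C(2) sym by (auto simp: T'_def linked_def)
  qed (use rich' w C(2) sym in auto)
qed

end

text \<open>For a symmetric irreflexive relation this is twice the number of edges, so that the
  bound 4n - 10 reads 8n - 20.\<close>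

definition degsum :: "('a \<Rightarrow> 'a \<Rightarrow> bool) \<Rightarrow> 'a set \<Rightarrow> nat" where
  "degsum E V = card (Sigma V (nb E V))"

lemma degsum_eq_sum: "finite V \<Longrightarrow> degsum E V = (\<Sum>x\<in>V. card (nb E V x))"
  unfolding degsum_def by (rule card_SigmaI) auto

context adjacency
begin

text \<open>Iterates \<open>rich_step\<close>, which needs a vertex off \<open>T\<close> with
  between 1 and 7 neighbours. If all non-isolated vertices off \<open>T\<close> had degree at least
  8, the bound 8n - 20 would force \<open>T\<close> to be a triangle with degree sum at most 4, but
  each of its vertices has degree at least 2.\<close>

lemma rich_imp_K6:
  assumes "finite V" "rich V T" "card T \<le> 3" "x \<in> V" "y \<in> V" "x \<notin> T" "E x y"
    and "\<And>V'. V' \<subseteq> V \<Longrightarrow> 4 \<le> card V' \<Longrightarrow> degsum E V' + 20 \<le> 8 * card V'"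
  shows "clique_model E V 6"
  using assms
proof (induction "card V" arbitrary: V T x y rule: less_induct)
  case less
  note fin = less.prems(1) and rich = less.prems(2)
  \<comment> \<open>Isolated vertices are left out of the count, as their degree 0 would hide the
    wanted vertex.\<close>
  define V0 where "V0 = {x \<in> V. nb E V x \<noteq> {}}"
  have f0: "finite V0" and V0V: "V0 \<subseteq> V" using fin by (auto simp: V0_def)
  have nb0: "nb E V0 z = nb E V z" if "z \<in> V0" for z
    using that sym by (fastforce simp: V0_def)
  have xy: "nb E V x \<inter> nb E V y \<subseteq> V0" using sym less.prems(4) by (fastforce simp: V0_def)
  have "4 \<le> card (nb E V x \<inter> nb E V y)" using rich less.prems unfolding rich_def by blast
  also have "\<dots> \<le> card V0" by (rule card_mono[OF f0 xy])
  finally have bound: "degsum E V0 + 20 \<le> 8 * card V0" using less.prems(8) V0V by blast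
  have "\<exists>v\<in>V0 - T. card (nb E V v) \<le> 7"
  proof (rule ccontr)
    assume *: "\<not> ?thesis"
    have fT: "finite T" "card T \<le> 3" "clique T"
      using rich less.prems(3) fin finite_subset unfolding rich_def by auto
    have "degsum E V0 = (\<Sum>z\<in>V0. card (nb E V z))"
      using degsum_eq_sum[OF f0] nb0 by simp
    also have "\<dots> = (\<Sum>z\<in>V0 - T. card (nb E V z)) + (\<Sum>z\<in>V0 \<inter> T. card (nb E V z))"
      by (subst sum.union_disjoint[symmetric]) (use f0 fT in \<open>auto intro!: sum.cong\<close>)
    finally have 1: "degsum E V0 = (\<Sum>z\<in>V0 - T. card (nb E V z)) + (\<Sum>z\<in>V0 \<inter> T. card (nb E V z))" .
    have "(\<Sum>z\<in>V0 - T. 8) \<le> (\<Sum>z\<in>V0 - T. card (nb E V z))"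
      by (rule sum_mono) (use * in force)
    then have 2: "8 * card (V0 - T) \<le> (\<Sum>z\<in>V0 - T. card (nb E V z))" by simp
    have 3: "card V0 = card (V0 - T) + card (V0 \<inter> T)"
      by (subst card_Un_disjoint[symmetric]) (use f0 fT in \<open>auto intro!: arg_cong[where f = card]\<close>)
    have c3: "card (V0 \<inter> T) \<le> 3" using card_mono[OF fT(1), of "V0 \<inter> T"] fT(2) by simp
    then have "card (V0 \<inter> T) = 3" and 4: "(\<Sum>z\<in>V0 \<inter> T. card (nb E V z)) \<le> 4"
      using bound 1 2 3 by linarith+
    moreover have "(\<Sum>z\<in>V0 \<inter> T. 2) \<le> (\<Sum>z\<in>V0 \<inter> T. card (nb E V z))"
    proof (rule sum_mono)
      fix z assume z: "z \<in> V0 \<inter> T"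
      have "(V0 \<inter> T) - {z} \<subseteq> nb E V z" using z fT(3) V0V unfolding clique_def by (simp add: subset_iff) metis
      then have "card ((V0 \<inter> T) - {z}) \<le> card (nb E V z)" using fin by (intro card_mono) auto
      then show "2 \<le> card (nb E V z)" using z f0 \<open>card (V0 \<inter> T) = 3\<close> by simp
    qed
    ultimately show False by simp
  qed
  then obtain v where v: "v \<in> V" "v \<notin> T" "nb E V v \<noteq> {}" "card (nb E V v) \<le> 7"
    unfolding V0_def by blast
  show ?case
  proof (rule ccontr)
    assume no: "\<not> ?case"
    obtain V' T' x' y' where *: "V' \<subset> V" "rich V' T'" "card T' \<le> 3" "x' \<in> V'" "y' \<in> V'" "x' \<notin> T'" "E x' y'"
      using rich_step[OF fin rich v no] .
    have "clique_model E V' 6"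
    proof (rule less.hyps[OF _ _ *(2-7)])
      show "card V' < card V" "finite V'" using * fin psubset_card_mono finite_subset by blast+
      show "degsum E V'' + 20 \<le> 8 * card V''" if "V'' \<subseteq> V'" "4 \<le> card V''" for V''
        using that * less.prems(8) by blast
    qed
    then show False using no clique_model_mono[of E V' 6 V E] * by blast
  qed
qed

lemma degsum_remove:
  assumes "finite V" "v \<in> V"
  shows "degsum E V \<le> degsum E (V - {v}) + 2 * card (nb E V v)"
proof -
  let ?N = "nb E V v"
  have "Sigma V (nb E V) \<subseteq> Sigma (V - {v}) (nb E (V - {v})) \<union> ({v} \<times> ?N \<union> ?N \<times> {v})"
    using sym by auto
  then have "degsum E V \<le> card (Sigma (V - {v}) (nb E (V - {v})) \<union> ({v} \<times> ?N \<union> ?N \<times> {v}))"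
    unfolding degsum_def by (intro card_mono) (use assms in auto)
  also have "\<dots> \<le> degsum E (V - {v}) + (card ({v} \<times> ?N) + card (?N \<times> {v}))"
    using card_Un_le[of "Sigma (V - {v}) (nb E (V - {v}))" "{v} \<times> ?N \<union> ?N \<times> {v}"]
      card_Un_le[of "{v} \<times> ?N" "?N \<times> {v}"] unfolding degsum_def by linarith
  finally show ?thesis by (simp add: card_cartesian_product)
qed

text \<open>The contraction loses the edge itself and one edge for each common neighbour.
  \<open>?X\<close> collects the lost ordered pairs; on the others the induced map is
  injective.\<close>

lemma degsum_contr:
  assumes "finite V" "v \<in> V" "u \<in> V" "E v u"
  shows "degsum E V \<le> degsum (contr v u E) (V - {u}) + 2 * card (nb E V v \<inter> nb E V u) + 2"
proof -
  let ?q = "id(u := v)" and ?N = "nb E V v \<inter> nb E V u" and ?P = "Sigma V (nb E V)"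
  let ?X = "{(u, v), (v, u)} \<union> ({u} \<times> ?N \<union> ?N \<times> {u})"
  let ?P' = "Sigma (V - {u}) (nb (contr v u E) (V - {u}))"
  have vu: "v \<noteq> u" using assms(4) by auto
  have key: "a \<in> V \<and> b \<in> V \<and> E a b \<and> (a = u \<longrightarrow> b \<noteq> v \<and> \<not> E v b) \<and> (b = u \<longrightarrow> a \<noteq> v \<and> \<not> E v a)"
    if "(a, b) \<in> ?P - ?X" for a b
    using that sym[of a b] by auto
  have q: "x = y \<or> x = u \<and> y = v \<or> x = v \<and> y = u" if "?q x = ?q y" for x y
    using that by (auto split: if_splits)
  have "inj_on (map_prod ?q ?q) (?P - ?X)"
  proof (rule inj_onI)
    fix p p' assume p: "p \<in> ?P - ?X" "p' \<in> ?P - ?X" "map_prod ?q ?q p = map_prod ?q ?q p'"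
    obtain a b a' b' where ab: "p = (a, b)" "p' = (a', b')" by (cases p, cases p')
    have "?q a = ?q a'" "?q b = ?q b'" using p(3) by (simp_all add: ab)
    then show "p = p'"
      using key[OF p(1)[unfolded ab]] key[OF p(2)[unfolded ab]] q[of a a'] q[of b b']
        sym[of a b] sym[of a' b'] sym[of a v]
      unfolding ab by (metis irrefl sym)
  qed
  moreover have "map_prod ?q ?q ` (?P - ?X) \<subseteq> ?P'"
  proof (rule image_subsetI)
    fix p assume p: "p \<in> ?P - ?X"
    obtain a b where ab: "p = (a, b)" by (cases p)
    note k = key[OF p[unfolded ab]]
    have "?q a \<noteq> ?q b" using k q[of a b] irrefl by metis
    then have "contr v u E (?q a) (?q b)" using k unfolding contr_def by blast
    then show "map_prod ?q ?q p \<in> ?P'" using k vu assms(2) by (simp add: ab)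
  qed
  ultimately have 1: "card (?P - ?X) \<le> degsum (contr v u E) (V - {u})"
    unfolding degsum_def using assms(1) by (intro card_inj_on_le) auto
  have "?P \<subseteq> (?P - ?X) \<union> ?X" by blast
  then have "degsum E V \<le> card ((?P - ?X) \<union> ?X)"
    unfolding degsum_def by (intro card_mono) (use assms(1) in auto)
  moreover have "card ((?P - ?X) \<union> ?X) \<le> card (?P - ?X) + card ?X" by (rule card_Un_le)
  moreover have "card ?X \<le> card {(u, v), (v, u)} + (card ({u} \<times> ?N) + card (?N \<times> {u}))"
    using card_Un_le[of "{(u, v), (v, u)}" "{u} \<times> ?N \<union> ?N \<times> {u}"]
      card_Un_le[of "{u} \<times> ?N" "?N \<times> {u}"] by linarith
  moreover have "card {(u, v), (v, u)} = 2" using vu by simp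
  moreover have "card ({u} \<times> ?N) = card ?N" "card (?N \<times> {u}) = card ?N"
    by (simp_all add: card_cartesian_product)
  ultimately show ?thesis using 1 by linarith
qed

end

text \<open>In a minimal counterexample each edge lies in four triangles, since contracting it would
  otherwise lose at most 8 ordered pairs, the slope of the bound. Deleting one edge restores the
  bound, so it is exceeded only slightly and some degree is at most 7.\<close>

theorem mader_K6:
  assumes "adjacency E" "finite V" "4 \<le> card V" "\<not> clique_model E V 6"
  shows "degsum E V + 20 \<le> 8 * card V"
  using assms
proof (induction "card V" arbitrary: E V rule: less_induct)
  case smaller: less
  show ?case
    using smaller.prems
  proof (induction "degsum E V" arbitrary: E rule: less_induct)
    case less
    interpret adjacency E by fact
    note fin = less.prems(2)
    show ?case
    proof (rule ccontr)
      assume neg: "\<not> ?case"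
      have sub: "degsum E V' + 20 \<le> 8 * card V'" if "V' \<subset> V" "4 \<le> card V'" for V'
      proof (rule smaller.hyps[OF _ less.prems(1) _ that(2)])
        show "card V' < card V" using that fin psubset_card_mono by blast
        show "finite V'" using that fin finite_subset by blast
        show "\<not> clique_model E V' 6" using less.prems(4) that clique_model_mono[of E V' 6 V E] by blast
      qed
      have nbc: "card (nb E V x) \<le> card V - 1" if "x \<in> V" for x
      proof -
        have "nb E V x \<subseteq> V - {x}" by auto
        then have "card (nb E V x) \<le> card (V - {x})" using fin by (intro card_mono) auto
        then show ?thesis using that fin by simp
      qed
      have "degsum E V \<le> (\<Sum>x\<in>V. card V - 1)"
        unfolding degsum_eq_sum[OF fin] by (rule sum_mono) (rule nbc)
      then have "degsum E V \<le> card V * (card V - 1)" by simp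
      \<comment> \<open>Equality holds in both cases: the 6 edges of K_4 and the 10 edges of K_5 fix
        the constants in 4n - 10.\<close>
      moreover have "card V * (card V - 1) + 20 \<le> 8 * card V" if "card V = 4 \<or> card V = 5"
        using that by auto
      ultimately have n6: "6 \<le> card V" using neg less.prems(3) by fastforce
      have mindeg: "5 \<le> card (nb E V v)" if "v \<in> V" for v
      proof (rule ccontr)
        assume "\<not> 5 \<le> card (nb E V v)"
        then have "degsum E V \<le> degsum E (V - {v}) + 8" using degsum_remove[OF fin that] by linarith
        moreover have "degsum E (V - {v}) + 20 \<le> 8 * card (V - {v})"
          by (rule sub) (use that fin n6 in auto)
        ultimately show False using neg that fin n6 by simp
      qed
      have "rich V {}"
        unfolding rich_def
      proof (intro conjI ballI impI)
        fix v u assume vu: "v \<in> V" "u \<in> V" "E v u"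
        show "4 \<le> card (nb E V v \<inter> nb E V u)"
        proof (rule ccontr)
          assume "\<not> ?thesis"
          then have 1: "degsum E V \<le> degsum (contr v u E) (V - {u}) + 8"
            using degsum_contr[OF fin vu] by linarith
          have "degsum (contr v u E) (V - {u}) + 20 \<le> 8 * card (V - {u})"
          proof (rule smaller.hyps)
            show "adjacency (contr v u E)" by (rule adjacency_contr)
            show "\<not> clique_model (contr v u E) (V - {u}) 6"
              using less.prems(4) clique_model_contr vu by blast
            show "finite (V - {u})" "4 \<le> card (V - {u})" using fin n6 vu by auto
            show "card (V - {u}) < card V" using fin vu by (meson card_Diff1_less)
          qed
          then show False using 1 neg vu fin n6 by simp
        qed
      qed (auto simp: clique_def)
      obtain a where a: "a \<in> V" using n6 by fastforce
      have "nb E V a \<noteq> {}" using mindeg[OF a] by auto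
      then obtain b where b: "b \<in> V" "E a b" by auto
      define E' where "E' = (\<lambda>x y. E x y \<and> {x, y} \<noteq> {a, b})"
      have S: "Sigma V (nb E V) = insert (a, b) (insert (b, a) (Sigma V (nb E' V)))"
        using a b sym by (auto simp: E'_def doubleton_eq_iff)
      have "a \<noteq> b" using b by auto
      have fS: "finite (Sigma V (nb E' V))" using fin by auto
      have "(a, b) \<notin> insert (b, a) (Sigma V (nb E' V))" "(b, a) \<notin> Sigma V (nb E' V)"
        using \<open>a \<noteq> b\<close> by (auto simp: E'_def)
      then have D: "degsum E V = degsum E' V + 2" unfolding degsum_def S using fS by simp
      have "degsum E' V + 20 \<le> 8 * card V"
      proof (rule less.hyps)
        show "adjacency E'" by unfold_locales (use sym in \<open>auto simp: E'_def insert_commute\<close>)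
        have "E' \<le> E" by (auto simp: E'_def)
        then show "\<not> clique_model E' V 6"
          using less.prems(4) clique_model_mono[of E' V 6 V E] by blast
      qed (use D less.prems in auto)
      then have upper: "degsum E V < 8 * card V" using D by linarith
      have "\<exists>v\<in>V. card (nb E V v) \<le> 7"
      proof (rule ccontr)
        assume "\<not> ?thesis"
        then have "(\<Sum>x\<in>V. 8) \<le> degsum E V"
          unfolding degsum_eq_sum[OF fin] by (intro sum_mono) force
        then show False using upper by simp
      qed
      then obtain v where v: "v \<in> V" "card (nb E V v) \<le> 7" by blast
      have "nb E V v \<noteq> {}" using mindeg[OF v(1)] by auto
      \<comment> \<open>This step is taken outside of \<open>rich_imp_K6\<close>, which assumes the
        bound on all subsets: the bound fails on \<open>V\<close> itself and is known by induction
        on proper subsets only.\<close>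
      from rich_step[OF fin \<open>rich V {}\<close> v(1) _ this v(2) less.prems(4)]
      obtain V' T' x y where *: "V' \<subset> V" "rich V' T'" "card T' \<le> 3" "x \<in> V'" "y \<in> V'" "x \<notin> T'" "E x y"
        by blast
      have "clique_model E V' 6"
      proof (rule rich_imp_K6[OF _ *(2-7)])
        show "finite V'" using * fin finite_subset by blast
        show "degsum E V'' + 20 \<le> 8 * card V''" if "V'' \<subseteq> V'" "4 \<le> card V''" for V''
          using sub that * by blast
      qed
      then show False using less.prems(4) clique_model_mono[of E V' 6 V E] * by blast
    qed
qed
qed

text \<open>Made a predicate of \<open>r\<close> for the descent from 6. The vertices are natural
  numbers because the cone needs a fresh apex.\<close>

definition triangle_clique :: "nat \<Rightarrow> bool" where
  "triangle_clique r \<longleftrightarrow> (\<forall>(E :: nat \<Rightarrow> nat \<Rightarrow> bool) V. adjacency E \<longrightarrow> finite V \<longrightarrow>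
     (\<exists>x\<in>V. \<exists>y\<in>V. E x y) \<longrightarrow>
     (\<forall>x\<in>V. \<forall>y\<in>V. E x y \<longrightarrow> r - 2 \<le> card (nb E V x \<inter> nb E V y)) \<longrightarrow> clique_model E V r)"

lemma triangle_clique_6: "triangle_clique 6"
  unfolding triangle_clique_def
proof (intro allI impI)
  fix E :: "nat \<Rightarrow> nat \<Rightarrow> bool" and V
  assume "adjacency E" and fin: "finite V" and ex: "\<exists>x\<in>V. \<exists>y\<in>V. E x y"
    and tri: "\<forall>x\<in>V. \<forall>y\<in>V. E x y \<longrightarrow> 6 - 2 \<le> card (nb E V x \<inter> nb E V y)"
  interpret adjacency E by fact
  obtain x y where xy: "x \<in> V" "y \<in> V" "E x y" using ex by blast
  show "clique_model E V 6"
  proof (rule ccontr)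
    assume no: "\<not> clique_model E V 6"
    have "clique_model E V 6"
    proof (rule rich_imp_K6[of V "{}" x y])
      show "rich V {}" using tri by (simp add: rich_def clique_def)
      fix V' assume V': "V' \<subseteq> V" "4 \<le> card V'"
      have "\<not> clique_model E V' 6" using no clique_model_mono[of E V' 6 V E] V' by blast
      then show "degsum E V' + 20 \<le> 8 * card V'"
        using mader_K6[OF \<open>adjacency E\<close> _ V'(2)] fin V'(1) finite_subset by blast
    qed (use fin xy in auto)
    then show False using no by blast
  qed
qed

text \<open>An apex joined to all vertices raises every triangle count by one, and discarding the
  branch set of the apex from a K_{r+1} model leaves a K_r model. Isolated vertices go first: their
  edge to the apex would lie in no triangle.\<close>

lemma triangle_clique_cone:
  assumes "triangle_clique (Suc r)" "2 \<le> r"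
  shows "triangle_clique r"
  unfolding triangle_clique_def
proof (intro allI impI)
  fix E :: "nat \<Rightarrow> nat \<Rightarrow> bool" and V
  assume adj: "adjacency E" and fin: "finite V" and ex: "\<exists>x\<in>V. \<exists>y\<in>V. E x y"
    and tri: "\<forall>x\<in>V. \<forall>y\<in>V. E x y \<longrightarrow> r - 2 \<le> card (nb E V x \<inter> nb E V y)"
  interpret adjacency E by fact
  define V0 where "V0 = {x \<in> V. nb E V x \<noteq> {}}"
  have f0: "finite V0" and V0V: "V0 \<subseteq> V" using fin by (auto simp: V0_def)
  have nb0: "nb E V x \<subseteq> V0" if "x \<in> V" for x using that sym by (fastforce simp: V0_def)
  obtain z where z: "z \<notin> V0" using f0 by (meson ex_new_if_finite infinite_UNIV_nat)
  define E' where "E' = (\<lambda>x y. x \<in> V0 \<and> y \<in> V0 \<and> E x y \<or> x = z \<and> y \<in> V0 \<or> y = z \<and> x \<in> V0)"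
  let ?V = "insert z V0"
  have "adjacency E'"
    by unfold_locales (use sym z in \<open>auto simp: E'_def\<close>)
  moreover have "\<exists>x\<in>?V. \<exists>y\<in>?V. E' x y" using ex nb0 by (fastforce simp: E'_def)
  moreover have "Suc r - 2 \<le> card (nb E' ?V x \<inter> nb E' ?V y)" if xy: "x \<in> ?V" "y \<in> ?V" "E' x y" for x y
  proof -
    \<comment> \<open>The edge from \<open>a\<close> to the apex lies in as many triangles as
      \<open>a\<close> has neighbours: \<open>b\<close> and the r - 2 common neighbours with
      \<open>b\<close>.\<close>
    have apex: "Suc r - 2 \<le> card (nb E V a)" if a: "a \<in> V0" for a
    proof -
      obtain b where b: "b \<in> V" "E a b" using a by (auto simp: V0_def)
      have "insert b (nb E V a \<inter> nb E V b) \<subseteq> nb E V a" using b by auto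
      then have "card (insert b (nb E V a \<inter> nb E V b)) \<le> card (nb E V a)"
        using fin by (intro card_mono) auto
      moreover have "r - 2 \<le> card (nb E V a \<inter> nb E V b)" using tri a b V0V by blast
      ultimately show ?thesis using fin by simp
    qed
    have a1: "nb E V a \<subseteq> nb E' ?V z \<inter> nb E' ?V a" if "a \<in> V0" for a
      using that nb0[OF subsetD[OF V0V that]] V0V by (auto simp: E'_def)
    have "card (nb E V a) \<le> card (nb E' ?V z \<inter> nb E' ?V a)" if "a \<in> V0" for a
      by (rule card_mono[OF _ a1[OF that]]) (use f0 in auto)
    note a2 = le_trans[OF apex this]
    consider "x = z" "y \<in> V0" | "y = z" "x \<in> V0" | "x \<in> V0" "y \<in> V0" "E x y"
      using xy(3) unfolding E'_def by blast
    then show ?thesis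
    proof cases
      case 3
      have "insert z (nb E V x \<inter> nb E V y) \<subseteq> nb E' ?V x \<inter> nb E' ?V y"
        using 3 nb0[OF subsetD[OF V0V 3(1)]] V0V by (auto simp: E'_def)
      then have "card (insert z (nb E V x \<inter> nb E V y)) \<le> card (nb E' ?V x \<inter> nb E' ?V y)"
        using f0 by (intro card_mono) auto
      moreover have "z \<notin> nb E V x \<inter> nb E V y" using nb0[of x] 3 V0V z by blast
      moreover have "r - 2 \<le> card (nb E V x \<inter> nb E V y)" using tri 3 V0V by blast
      ultimately show ?thesis using fin assms(2) by simp
    qed (use a2 in \<open>auto simp: Int_commute\<close>)
  qed
  ultimately have "clique_model E' ?V (Suc r)"
    using assms(1) f0 unfolding triangle_clique_def by (meson finite_insert)
  then obtain \<B> where \<B>: "branch_sets E' ?V \<B>" "card \<B> = Suc r" unfolding clique_model_def by blast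
  have f\<B>: "finite \<B>" using \<B>(1) by (simp add: branch_sets_def)
  have "card {B \<in> \<B>. z \<in> B} \<le> Suc 0"
    using \<B>(1) f\<B> unfolding branch_sets_def by (subst card_le_Suc0_iff_eq) (simp, blast)
  moreover have "card \<B> = card {B \<in> \<B>. z \<in> B} + card {B \<in> \<B>. z \<notin> B}"
    by (subst card_Un_disjoint[symmetric]) (use f\<B> in \<open>auto intro!: arg_cong[where f = card]\<close>)
  ultimately have "r \<le> card {B \<in> \<B>. z \<notin> B}" using \<B>(2) by linarith
  from obtain_subset_with_card_n[OF this]
  obtain \<C> where \<C>: "\<C> \<subseteq> {B \<in> \<B>. z \<notin> B}" "card \<C> = r" "finite \<C>" .
  have sub: "B \<subseteq> V0" if "B \<in> \<C>" for B
    using that \<C> \<B>(1) unfolding branch_sets_def by blast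
  have lk: "linked E B C" if "linked E' B C" "B \<subseteq> V0" "C \<subseteq> V0" for B C
    using that z unfolding linked_def E'_def by blast
  have "conn E B" if "B \<in> \<C>" for B
  proof -
    have "conn E' B" using that \<C> \<B>(1) unfolding branch_sets_def by blast
    then show ?thesis using lk sub[OF that] unfolding conn_def by (meson Diff_subset order_trans psubset_imp_subset)
  qed
  then have "branch_sets E V \<C>"
    using \<C> \<B>(1) sub lk V0V unfolding branch_sets_def by (simp add: subset_iff)
  then show "clique_model E V r" unfolding clique_model_def using \<C>(2) by blast
qed

theorem clique_model_if_triangles:
  fixes E :: "nat \<Rightarrow> nat \<Rightarrow> bool"
  assumes "2 \<le> r" "r \<le> 6" "adjacency E" "finite V" "x \<in> V" "y \<in> V" "E x y"
    "\<And>x y. x \<in> V \<Longrightarrow> y \<in> V \<Longrightarrow> E x y \<Longrightarrow> r - 2 \<le> card (nb E V x \<inter> nb E V y)"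
  shows "clique_model E V r"
proof -
  have "triangle_clique r"
    using assms(2,1)
    by (induction r rule: inc_induct) (simp_all add: triangle_clique_6 triangle_clique_cone)
  then show ?thesis using assms unfolding triangle_clique_def by blast
qed

section \<open>Stresses\<close>

(* P is thought of as a ring of polynomial functions, t0 as a special point and F as the filter of
   generic points. *)
definition specializes :: "('t \<Rightarrow> 'k::field) set \<Rightarrow> 't \<Rightarrow> 't filter \<Rightarrow> bool" where
  "specializes P t0 F \<longleftrightarrow> (\<lambda>_. 1) \<in> P \<and> (\<forall>f\<in>P. \<forall>g\<in>P. (\<lambda>t. f t * g t) \<in> P \<and> (\<lambda>t. f t - g t) \<in> P) \<and>
     (\<forall>f\<in>P. f t0 \<noteq> 0 \<longrightarrow> (\<forall>\<^sub>F t in F. f t \<noteq> 0))"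

lemma specializesD:
  assumes "specializes P t0 F"
  shows "(\<lambda>_. 1) \<in> P" "(\<lambda>_. 0) \<in> P" "f \<in> P \<Longrightarrow> g \<in> P \<Longrightarrow> (\<lambda>t. f t * g t) \<in> P"
    "f \<in> P \<Longrightarrow> g \<in> P \<Longrightarrow> (\<lambda>t. f t - g t) \<in> P" "f \<in> P \<Longrightarrow> (\<lambda>t. - f t) \<in> P"
    "f \<in> P \<Longrightarrow> f t0 \<noteq> 0 \<Longrightarrow> \<forall>\<^sub>F t in F. f t \<noteq> 0"
proof -
  show 1: "(\<lambda>_. 1) \<in> P" using assms by (simp add: specializes_def)
  have d: "(\<lambda>t. f t - g t) \<in> P" if "f \<in> P" "g \<in> P" for f g
    using assms that unfolding specializes_def by blast
  show 0: "(\<lambda>_. 0) \<in> P" using d[OF 1 1] by simp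
  show "f \<in> P \<Longrightarrow> g \<in> P \<Longrightarrow> (\<lambda>t. f t - g t) \<in> P" by (rule d)
  show "f \<in> P \<Longrightarrow> (\<lambda>t. - f t) \<in> P" using d[OF 0, of f] by simp
  show "f \<in> P \<Longrightarrow> g \<in> P \<Longrightarrow> (\<lambda>t. f t * g t) \<in> P"
    "f \<in> P \<Longrightarrow> f t0 \<noteq> 0 \<Longrightarrow> \<forall>\<^sub>F t in F. f t \<noteq> 0"
    using assms unfolding specializes_def by blast+
qed

(* Gaussian elimination without division, so that all entries stay in P. *)
lemma eventually_trivial_kernel:
  fixes M :: "'t \<Rightarrow> 'r \<Rightarrow> 'c \<Rightarrow> 'k::field"
  assumes P: "specializes P t0 F" and "finite C"
    and "\<And>r c. r \<in> R \<Longrightarrow> c \<in> C \<Longrightarrow> (\<lambda>t. M t r c) \<in> P"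
    and "\<And>w. (\<And>r. r \<in> R \<Longrightarrow> (\<Sum>c\<in>C. M t0 r c * w c) = 0) \<Longrightarrow> \<forall>c\<in>C. w c = 0"
  shows "\<forall>\<^sub>F t in F. \<forall>w. (\<forall>r\<in>R. (\<Sum>c\<in>C. M t r c * w c) = 0) \<longrightarrow> (\<forall>c\<in>C. w c = 0)"
  using assms(2-)
proof (induction C arbitrary: M rule: finite_induct)
  case empty
  then show ?case by simp
next
  case (insert c C)
  note fin = \<open>finite C\<close> and c = \<open>c \<notin> C\<close>
  have "\<exists>r\<in>R. M t0 r c \<noteq> 0"
  proof (rule ccontr)
    assume "\<not> ?thesis"
    then have "(\<Sum>c'\<in>insert c C. M t0 r c' * (if c' = c then 1 else 0)) = 0" if "r \<in> R" for r
      using that fin c by (auto intro!: sum.neutral)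
    from insert.prems(2)[OF this] show False by simp
  qed
  then obtain r0 where r0: "r0 \<in> R" "M t0 r0 c \<noteq> 0" by blast
  define M' where "M' t r c' = M t r0 c * M t r c' - M t r c * M t r0 c'" for t r c'
  have M'_sum: "(\<Sum>c'\<in>C. M' t r c' * w c') =
      M t r0 c * (\<Sum>c'\<in>C. M t r c' * w c') - M t r c * (\<Sum>c'\<in>C. M t r0 c' * w c')" for t r w
    by (simp add: M'_def sum_distrib_left sum_subtractf algebra_simps)
  have "\<forall>\<^sub>F t in F. \<forall>w. (\<forall>r\<in>R. (\<Sum>c'\<in>C. M' t r c' * w c') = 0) \<longrightarrow> (\<forall>c'\<in>C. w c' = 0)"
  proof (rule insert.IH)
    show "(\<lambda>t. M' t r c') \<in> P" if "r \<in> R" "c' \<in> C" for r c'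
      unfolding M'_def by (intro specializesD[OF P] insert.prems(1)) (use that r0 in auto)
    fix w assume w: "\<And>r. r \<in> R \<Longrightarrow> (\<Sum>c'\<in>C. M' t0 r c' * w c') = 0"
    \<comment> \<open>Back substitution at the special point: the value at \<open>c\<close> is
      chosen so that the pivot row \<open>r0\<close> is satisfied, which turns a solution of the
      reduced system into one of the full system.\<close>
    define w' where "w' = w(c := - (\<Sum>c'\<in>C. M t0 r0 c' * w c') / M t0 r0 c)"
    have w'C: "(\<Sum>c'\<in>C. M t0 r c' * w' c') = (\<Sum>c'\<in>C. M t0 r c' * w c')" for r
      using c by (intro sum.cong) (auto simp: w'_def)
    have "(\<Sum>c'\<in>insert c C. M t0 r c' * w' c') = 0" if "r \<in> R" for r
    proof -
      have "M t0 r0 c * (\<Sum>c'\<in>insert c C. M t0 r c' * w' c') = (\<Sum>c'\<in>C. M' t0 r c' * w c')"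
        using r0 fin c by (simp add: M'_sum w'C) (simp add: w'_def algebra_simps)
      then show ?thesis using w[OF that] r0 by simp
    qed
    from insert.prems(2)[OF this] have 0: "w' c' = 0" if "c' \<in> C" for c' using that by blast
    show "\<forall>c'\<in>C. w c' = 0"
    proof
      fix c' assume "c' \<in> C"
      then show "w c' = 0" using 0[of c'] c by (cases "c' = c") (auto simp: w'_def)
    qed
  qed
  moreover have "\<forall>\<^sub>F t in F. M t r0 c \<noteq> 0"
    using specializesD(6)[OF P, of "\<lambda>t. M t r0 c"] insert.prems(1) r0 by blast
  ultimately show ?case
  proof eventually_elim
    case (elim t)
    show ?case
    proof (intro allI impI)
      fix w assume w: "\<forall>r\<in>R. (\<Sum>c'\<in>insert c C. M t r c' * w c') = 0"
      then have w: "(\<Sum>c'\<in>C. M t r c' * w c') = - M t r c * w c" if "r \<in> R" for r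
        using that fin c by (simp add: eq_neg_iff_add_eq_0 add.commute)
      then have "\<forall>r\<in>R. (\<Sum>c'\<in>C. M' t r c' * w c') = 0"
        using r0(1) by (simp add: M'_sum)
      then have 0: "\<forall>c'\<in>C. w c' = 0" using elim by blast
      then have "M t r0 c * w c = 0" using w[OF r0(1)] by simp
      then show "\<forall>c'\<in>insert c C. w c' = 0" using 0 elim by simp
    qed
  qed
qed

text \<open>\<open>e a i j\<close> is coordinate \<open>a\<close> of the vector by which the pair
  (i, j) acts at \<open>i\<close>. It is kept arbitrary so that one edge can be rescaled while its
  ends collapse. The sign \<open>s\<close> is 1 in the symmetric and -1 in the exterior
  case.\<close>

definition stress :: "'k::field \<Rightarrow> nat set \<Rightarrow> ('v \<Rightarrow> 'v \<Rightarrow> bool) \<Rightarrow> 'v set \<Rightarrow>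
    (nat \<Rightarrow> 'v \<Rightarrow> 'v \<Rightarrow> 'k) \<Rightarrow> ('v \<Rightarrow> 'v \<Rightarrow> 'k) \<Rightarrow> bool" where
  "stress s D E V e w \<longleftrightarrow> (\<forall>i\<in>V. \<forall>j\<in>V. w i j = s * w j i) \<and> (\<forall>i\<in>V. \<forall>j\<in>V. \<not> E i j \<longrightarrow> w i j = 0) \<and>
     (\<forall>i\<in>V. \<forall>a\<in>D. (\<Sum>j\<in>V. e a i j * w i j) = 0)"

definition stress_free :: "'k::field \<Rightarrow> nat set \<Rightarrow> ('v \<Rightarrow> 'v \<Rightarrow> bool) \<Rightarrow> 'v set \<Rightarrow>
    (nat \<Rightarrow> 'v \<Rightarrow> 'v \<Rightarrow> 'k) \<Rightarrow> bool" where
  "stress_free s D E V e \<longleftrightarrow> (\<forall>w. stress s D E V e w \<longrightarrow> (\<forall>i\<in>V. \<forall>j\<in>V. w i j = 0))"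

text \<open>Stresses are the kernel of a linear system with unknowns indexed by ordered pairs. Rows
  \<open>Inl\<close> express equilibrium, rows \<open>Inr\<close> with flag \<open>True\<close> the
  (anti)symmetry, and those with flag \<open>False\<close> the vanishing on non-edges; the latter
  two kinds have constant entries.\<close>

lemma eventually_stress_free:
  fixes e :: "'t \<Rightarrow> nat \<Rightarrow> 'v \<Rightarrow> 'v \<Rightarrow> 'k::field"
  assumes P: "specializes P t0 F" and V: "finite V" and s: "s = 1 \<or> s = - 1"
    and e: "\<And>a i j. a \<in> D \<Longrightarrow> i \<in> V \<Longrightarrow> j \<in> V \<Longrightarrow> (\<lambda>t. e t a i j) \<in> P"
    and free: "stress_free s D E V (e t0)"
  shows "\<forall>\<^sub>F t in F. stress_free s D E V (e t)"
proof -
  define R where "R = (\<lambda>(i, a). Inl (i, a)) ` (V \<times> D) \<union> (\<lambda>(i, j). Inr (True, i, j)) ` (V \<times> V)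
    \<union> (\<lambda>(i, j). Inr (False, i, j)) ` {(i, j). i \<in> V \<and> j \<in> V \<and> \<not> E i j}"
  define M where "M t r c = (case r of
      Inl (i, a) \<Rightarrow> if fst c = i then e t a i (snd c) else 0
    | Inr (b, i, j) \<Rightarrow> (if c = (i, j) then 1 else 0) - (if b \<and> c = (j, i) then s else 0))" for t r c
  have eq1: "(\<Sum>c\<in>V \<times> V. M t (Inl (i, a)) c * w c) = (\<Sum>j\<in>V. e t a i j * w (i, j))" if "i \<in> V" for t i a w
  proof -
    have "(\<Sum>c\<in>V \<times> V. M t (Inl (i, a)) c * w c) =
        (\<Sum>i'\<in>V. \<Sum>j\<in>V. (if i' = i then e t a i j * w (i, j) else 0))"
      unfolding sum.cartesian_product by (rule sum.cong) (auto simp: M_def)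
    also have "\<dots> = (\<Sum>i'\<in>V. if i' = i then \<Sum>j\<in>V. e t a i j * w (i, j) else 0)"
      by (rule sum.cong) auto
    finally show ?thesis using that V by simp
  qed
  have del: "(\<Sum>c\<in>V \<times> V. (if c = c0 then x else 0) * w c) = x * w c0" if "c0 \<in> V \<times> V" for x c0 and w :: "'v \<times> 'v \<Rightarrow> 'k"
  proof -
    have "(\<Sum>c\<in>V \<times> V. (if c = c0 then x else 0) * w c) = (\<Sum>c\<in>V \<times> V. if c = c0 then x * w c0 else 0)"
      by (rule sum.cong) auto
    then show ?thesis using that V by simp
  qed
  have eq2: "(\<Sum>c\<in>V \<times> V. M t (Inr (b, i, j)) c * w c) = w (i, j) - (if b then s * w (j, i) else 0)"
    if "i \<in> V" "j \<in> V" for t i j b w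
    using del[of "(i, j)" 1 w] del[of "(j, i)" s w] that
    by (cases b) (simp_all add: M_def left_diff_distrib sum_subtractf)
  have st: "(\<forall>r\<in>R. (\<Sum>c\<in>V \<times> V. M t r c * w c) = 0) \<longleftrightarrow> stress s D E V (e t) (\<lambda>i j. w (i, j))" for t w
  proof -
    have "(\<forall>r\<in>R. Q r) \<longleftrightarrow> (\<forall>i\<in>V. \<forall>j\<in>V. Q (Inr (True, i, j))) \<and>
        (\<forall>i\<in>V. \<forall>j\<in>V. \<not> E i j \<longrightarrow> Q (Inr (False, i, j))) \<and> (\<forall>i\<in>V. \<forall>a\<in>D. Q (Inl (i, a)))" for Q
      unfolding R_def by (simp add: ball_Un) blast
    then show ?thesis by (simp add: eq1 eq2 stress_def)
  qed
  have "\<forall>\<^sub>F t in F. \<forall>w. (\<forall>r\<in>R. (\<Sum>c\<in>V \<times> V. M t r c * w c) = 0) \<longrightarrow> (\<forall>c\<in>V \<times> V. w c = 0)"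
  proof (rule eventually_trivial_kernel[OF P])
    have sP: "(\<lambda>_. s) \<in> P" using s specializesD(1,5)[OF P] by auto
    have const: "(\<lambda>_. (if A then 1 else 0) - (if B then s else 0)) \<in> P" for A B
      by (rule specializesD(4)[OF P]) (use specializesD(1,2)[OF P] sP in \<open>cases A; cases B; simp\<close>)+
    fix r c assume "r \<in> R" "c \<in> V \<times> V"
    then show "(\<lambda>t. M t r c) \<in> P"
    proof (cases r)
      case (Inl p)
      then show ?thesis using e \<open>r \<in> R\<close> \<open>c \<in> V \<times> V\<close> specializesD(2)[OF P]
        by (cases p; cases "fst c = fst p") (auto simp: R_def M_def)
    next
      case (Inr p)
      then show ?thesis using const by (cases p) (simp add: M_def)
    qed
  next
    fix w assume "\<And>r. r \<in> R \<Longrightarrow> (\<Sum>c\<in>V \<times> V. M t0 r c * w c) = 0"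
    then have "stress s D E V (e t0) (\<lambda>i j. w (i, j))" using st by blast
    then show "\<forall>c\<in>V \<times> V. w c = 0" using free unfolding stress_free_def by auto
  qed (use V in simp)
  then show ?thesis
  proof eventually_elim
    case (elim t)
    show ?case unfolding stress_free_def
    proof (intro allI impI)
      fix w assume "stress s D E V (e t) w"
      then have "\<forall>r\<in>R. (\<Sum>c\<in>V \<times> V. M t r c * case_prod w c) = 0" using st[of t "case_prod w"] by simp
      then show "\<forall>i\<in>V. \<forall>j\<in>V. w i j = 0" using elim by fastforce
    qed
  qed
qed

text \<open>At the collapsed position \<open>u\<close> and \<open>v\<close> see all other vertices
  alike. Adding the weights of \<open>u\<close> to those of \<open>v\<close> gives a stress of the
  contraction; the edge \<open>uv\<close> cancels by \<open>uv\<close>. As that stress vanishes, the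
  weights at \<open>u\<close> and \<open>v\<close> are opposite off these two vertices, hence
  supported on common neighbours, and equilibrium at \<open>u\<close> is a linear relation excluded
  by \<open>indep\<close>.\<close>

lemma (in adjacency) stress_free_split:
  fixes e :: "nat \<Rightarrow> 'a \<Rightarrow> 'a \<Rightarrow> 'k::field"
  assumes V: "finite V" "u \<in> V" "v \<in> V" "E v u" and s: "s * s = 1"
    and e: "\<And>a j. a \<in> D \<Longrightarrow> j \<in> V - {u, v} \<Longrightarrow> e a u j = e a v j \<and> e a j u = e a j v"
    and uv: "\<And>a. a \<in> D \<Longrightarrow> e a u v + s * e a v u = 0"
    and indep: "\<And>l m. (\<And>a. a \<in> D \<Longrightarrow> l * e a u v + (\<Sum>j\<in>nb E V v \<inter> nb E V u. m j * e a u j) = 0) \<Longrightarrow>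
        l = 0 \<and> (\<forall>j\<in>nb E V v \<inter> nb E V u. m j = 0)"
    and free: "stress_free s D (contr v u E) (V - {u}) e"
  shows "stress_free s D E V e"
  unfolding stress_free_def
proof (intro allI impI)
  fix w assume "stress s D E V e w"
  then have w_sym: "w i j = s * w j i" and w_supp: "\<not> E i j \<Longrightarrow> w i j = 0"
    and w_eq: "a \<in> D \<Longrightarrow> (\<Sum>j\<in>V. e a i j * w i j) = 0" if "i \<in> V" "j \<in> V" for i j a
    using that unfolding stress_def by blast+
  have vu: "v \<noteq> u" using V(4) by auto
  have fin: "finite (V - {u, v})" using V by simp
  let ?U = "V - {u, v}"
  have Vi: "(\<Sum>j\<in>V. f j) = f u + f v + (\<Sum>j\<in>?U. f j)" for f :: "'a \<Rightarrow> 'k"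
  proof -
    have "V = insert u (insert v ?U)" using V by auto
    then show ?thesis using fin vu by (metis Diff_iff add.assoc finite_insert insert_iff sum.insert)
  qed
  have Vu: "(\<Sum>j\<in>V - {u}. f j) = f v + (\<Sum>j\<in>?U. f j)" for f :: "'a \<Rightarrow> 'k"
  proof -
    have "V - {u} = insert v ?U" using V vu by auto
    then show ?thesis using fin by simp
  qed
  \<comment> \<open>The diagonal is zero because the contracted edge would become a loop.\<close>
  define w' where "w' i j = (if i = j then 0 else w i j + (if i = v then w u j else 0) +
    (if j = v then w i u else 0))" for i j
  have "stress s D (contr v u E) (V - {u}) e w'"
    unfolding stress_def
  proof (intro conjI ballI impI)
    fix i j assume ij: "i \<in> V - {u}" "j \<in> V - {u}"
    show "w' i j = s * w' j i"
      using w_sym[of i j] w_sym[of u j] w_sym[of i u] ij V by (auto simp: w'_def algebra_simps)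
    let ?q = "id(u := v)"
    assume no: "\<not> contr v u E i j"
    have im: "contr v u E (?q x) (?q y)" if "E x y" "?q x \<noteq> ?q y" for x y
      using that unfolding contr_def by blast
    have "w i j = 0" "i = v \<longrightarrow> w u j = 0" "j = v \<longrightarrow> w i u = 0" if "i \<noteq> j"
      using no im[of i j] im[of u j] im[of i u] that ij V w_supp[of i j] w_supp[of u j] w_supp[of i u] by auto
    then show "w' i j = 0" by (auto simp: w'_def)
  next
    fix i a assume i: "i \<in> V - {u}" and a: "a \<in> D"
    show "(\<Sum>j\<in>V - {u}. e a i j * w' i j) = 0"
    proof (cases "i = v")
      case True
      have "(\<Sum>j\<in>?U. e a v j * w' v j) = (\<Sum>j\<in>?U. e a v j * w v j) + (\<Sum>j\<in>?U. e a u j * w u j)"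
        unfolding sum.distrib[symmetric] using e a by (intro sum.cong) (auto simp: w'_def algebra_simps)
      also have "(\<Sum>j\<in>?U. e a v j * w v j) = - (e a v u * w v u + e a v v * w v v)"
        using w_eq[of v v a] V a unfolding Vi by (metis add_eq_0_iff)
      also have "(\<Sum>j\<in>?U. e a u j * w u j) = - (e a u u * w u u + e a u v * w u v)"
        using w_eq[of u u a] V a unfolding Vi by (metis add_eq_0_iff)
      also have "- (e a v u * w v u + e a v v * w v v) + - (e a u u * w u u + e a u v * w u v) =
          - (e a u v + s * e a v u) * w u v"
        using w_supp[of v v] w_supp[of u u] w_sym[of v u] V by (simp add: algebra_simps)
      finally show ?thesis using uv[OF a] True by (simp add: Vu w'_def)
    next
      case False
      then have iU: "i \<in> ?U" using i by auto
      have "(\<Sum>j\<in>?U. e a i j * w' i j) = (\<Sum>j\<in>?U. e a i j * w i j)"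
        using False iU w_supp[of i i] by (intro sum.cong) (auto simp: w'_def)
      then show ?thesis using w_eq[of i i a] a i False e[OF a iU]
        unfolding Vi Vu by (simp add: w'_def algebra_simps)
    qed
  qed
  then have 0: "w' i j = 0" if "i \<in> V - {u}" "j \<in> V - {u}" for i j
    using free that unfolding stress_free_def by blast
  have UU: "w i j = 0" if "i \<in> ?U" "j \<in> ?U" for i j
    using 0[of i j] that w_supp[of i j] by (cases "i = j") (auto simp: w'_def)
  have vj: "w v j = - w u j" if "j \<in> ?U" for j
    using 0[of v j] that V vu by (auto simp: w'_def eq_neg_iff_add_eq_0)
  let ?N = "nb E V v \<inter> nb E V u"
  have non: "w u j = 0" if "j \<in> ?U - ?N" for j
    using vj[of j] w_supp[of v j] w_supp[of u j] that V by auto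
  have "w u v * e a u v + (\<Sum>j\<in>?N. w u j * e a u j) = 0" if a: "a \<in> D" for a
  proof -
    have "(\<Sum>j\<in>?N. w u j * e a u j) = (\<Sum>j\<in>?U. e a u j * w u j)"
      by (rule sum.mono_neutral_cong_left) (use fin non in auto)
    then show ?thesis using w_eq[of u u a] a V w_supp[of u u] unfolding Vi by (simp add: algebra_simps)
  qed
  from indep[OF this] have "w u v = 0" "\<And>j. j \<in> ?N \<Longrightarrow> w u j = 0" by blast+
  then have u0: "w u j = 0" if "j \<in> V" for j
    using non[of j] w_supp[of u u] that V by (cases "j \<in> ?N") auto
  have v0: "w v j = 0" if "j \<in> V" for j
    using vj[of j] u0[of j] u0[of v] w_supp[of v v] w_sym[of v u] that V by (cases "j = u \<or> j = v") auto
  show "\<forall>i\<in>V. \<forall>j\<in>V. w i j = 0"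
  proof (intro ballI)
    fix i j assume "i \<in> V" "j \<in> V"
    then show "w i j = 0"
      using UU[of i j] u0[of i] u0[of j] v0[of i] v0[of j] w_sym[of i j] by (cases "i \<in> ?U \<and> j \<in> ?U") auto
  qed
qed

section \<open>Generic matrices and stress-freeness\<close>

definition mono_eval :: "('i \<Rightarrow> 'k::field_char_0) \<Rightarrow> ('i \<Rightarrow>\<^sub>0 nat) \<Rightarrow> 'k" where
  "mono_eval a m = (\<Prod>i\<in>Poly_Mapping.keys m. a i ^ Poly_Mapping.lookup m i)"

lemma mono_eval_superset:
  assumes "finite I" "Poly_Mapping.keys m \<subseteq> I"
  shows "mono_eval a m = (\<Prod>i\<in>I. a i ^ Poly_Mapping.lookup m i)"
  unfolding mono_eval_def by (rule prod.mono_neutral_left) (use assms in \<open>auto simp: in_keys_iff\<close>)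

lemma mono_eval_add: "mono_eval a (m + m') = mono_eval a m * mono_eval a m'"
proof -
  let ?I = "Poly_Mapping.keys m \<union> Poly_Mapping.keys m'"
  have "Poly_Mapping.keys (m + m') \<subseteq> ?I" by (rule Poly_Mapping.keys_add)
  then show ?thesis
    by (simp add: mono_eval_superset[of ?I] lookup_add power_add prod.distrib)
qed

lemma eval_rat_poly_superset:
  assumes "finite M" "Poly_Mapping.keys p \<subseteq> M"
  shows "eval_rat_poly a p = (\<Sum>m\<in>M. of_rat (Poly_Mapping.lookup p m) * mono_eval a m)"
  unfolding eval_rat_poly_def mono_eval_def[symmetric]
  by (rule sum.mono_neutral_left) (use assms in \<open>auto simp: in_keys_iff\<close>)

lemma eval_rat_poly_add: "eval_rat_poly a (p + q) = eval_rat_poly a p + eval_rat_poly a q"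
proof -
  let ?M = "Poly_Mapping.keys p \<union> Poly_Mapping.keys q"
  have "Poly_Mapping.keys (p + q) \<subseteq> ?M" by (rule Poly_Mapping.keys_add)
  then show ?thesis
    by (simp add: eval_rat_poly_superset[of ?M] lookup_add of_rat_add distrib_right sum.distrib)
qed

lemma eval_rat_poly_minus: "eval_rat_poly a (p - q) = eval_rat_poly a p - eval_rat_poly a q"
  using eval_rat_poly_add[of a "p - q" q] by (simp add: algebra_simps)

lemma eval_rat_poly_single: "eval_rat_poly a (Poly_Mapping.single m c) = of_rat c * mono_eval a m"
  by (subst eval_rat_poly_superset[of "{m}"]) auto

lemma poly_mapping_induct_sum [case_names single sum]:
  fixes p :: "'i \<Rightarrow>\<^sub>0 'k::comm_monoid_add"
  assumes "\<And>m c. Q (Poly_Mapping.single m c)" "\<And>p q. Q p \<Longrightarrow> Q q \<Longrightarrow> Q (p + q)"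
  shows "Q p"
proof -
  have "Q (\<Sum>m\<in>S. Poly_Mapping.single m (Poly_Mapping.lookup p m))" if "finite S" for S
    using that assms(1)[of _ 0] by (induction S rule: finite_induct) (auto simp: assms)
  moreover have "p = (\<Sum>m\<in>Poly_Mapping.keys p. Poly_Mapping.single m (Poly_Mapping.lookup p m))"
    by (rule poly_mapping_eqI) (auto simp: lookup_sum lookup_single when_def in_keys_iff)
  ultimately show ?thesis by (metis finite_keys)
qed

lemma eval_rat_poly_mult: "eval_rat_poly a (p * q) = eval_rat_poly a p * eval_rat_poly a q"
proof (induction p rule: poly_mapping_induct_sum)
  case (single m c)
  show ?case
  proof (induction q rule: poly_mapping_induct_sum)
    case (single m' c')
    show ?case by (simp add: mult_single eval_rat_poly_single mono_eval_add of_rat_mult)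
  next
    case (sum p1 p2)
    then show ?case by (simp add: distrib_left eval_rat_poly_add)
  qed
next
  case (sum p1 p2)
  then show ?case by (simp add: distrib_right eval_rat_poly_add)
qed

definition matrix_polys :: "nat \<Rightarrow> ((nat \<Rightarrow> nat \<Rightarrow> 'k::field_char_0) \<Rightarrow> 'k) set" where
  "matrix_polys n = {\<lambda>B. eval_rat_poly (\<lambda>(i, j). B i j) p |p.
     \<forall>m\<in>Poly_Mapping.keys p. Poly_Mapping.keys m \<subseteq> {1..n} \<times> {1..n}}"

lemma matrix_polysI:
  assumes "\<And>m. m \<in> Poly_Mapping.keys p \<Longrightarrow> Poly_Mapping.keys m \<subseteq> {1..n} \<times> {1..n}"
    and "\<And>B. f B = eval_rat_poly (\<lambda>(i, j). B i j) p"
  shows "f \<in> matrix_polys n"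
  unfolding matrix_polys_def using assms by (auto intro!: exI[of _ p])

lemma matrix_polys_entry:
  assumes "i \<in> {1..n}" "j \<in> {1..n}"
  shows "(\<lambda>B. B i j) \<in> matrix_polys n"
  by (rule matrix_polysI[of "Poly_Mapping.single (Poly_Mapping.single (i, j) 1) 1"])
    (use assms in \<open>auto simp: eval_rat_poly_single mono_eval_def split: if_splits\<close>)

text \<open>A polynomial that is nonzero at some point is not the zero polynomial, so it cannot
  vanish at algebraically independent entries. Thus any matrix \<open>B\<close> may serve as the
  special point.\<close>

lemma specializes_generic:
  assumes "generic_matrix n A"
  shows "specializes (matrix_polys n) B (principal {A})"
  unfolding specializes_def
proof (intro conjI ballI impI)
  show "(\<lambda>_. 1) \<in> matrix_polys n"
    by (rule matrix_polysI[of "Poly_Mapping.single 0 1"])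
      (auto simp: eval_rat_poly_single mono_eval_def simp del: single_one split: if_splits)
  fix f g :: "(nat \<Rightarrow> nat \<Rightarrow> 'a) \<Rightarrow> 'a"
  assume "f \<in> matrix_polys n"
  then obtain p where p: "\<And>m. m \<in> Poly_Mapping.keys p \<Longrightarrow> Poly_Mapping.keys m \<subseteq> {1..n} \<times> {1..n}"
    "\<And>B. f B = eval_rat_poly (\<lambda>(i, j). B i j) p" unfolding matrix_polys_def by auto
  {
    assume "g \<in> matrix_polys n"
    then obtain q where q: "\<And>m. m \<in> Poly_Mapping.keys q \<Longrightarrow> Poly_Mapping.keys m \<subseteq> {1..n} \<times> {1..n}"
      "\<And>B. g B = eval_rat_poly (\<lambda>(i, j). B i j) q" unfolding matrix_polys_def by auto
    show "(\<lambda>B. f B - g B) \<in> matrix_polys n"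
    proof (rule matrix_polysI[of "p - q"])
      fix m assume "m \<in> Poly_Mapping.keys (p - q)"
      then have "m \<in> Poly_Mapping.keys p \<union> Poly_Mapping.keys q"
        using keys_diff[of p q] by blast
      then show "Poly_Mapping.keys m \<subseteq> {1..n} \<times> {1..n}" using p(1) q(1) by blast
    qed (simp add: p(2) q(2) eval_rat_poly_minus)
    show "(\<lambda>B. f B * g B) \<in> matrix_polys n"
    proof (rule matrix_polysI[of "p * q"])
      fix m assume "m \<in> Poly_Mapping.keys (p * q)"
      then obtain m1 m2 where m: "m1 \<in> Poly_Mapping.keys p" "m2 \<in> Poly_Mapping.keys q" "m = m1 + m2"
        using keys_mult[of p q] by blast
      then show "Poly_Mapping.keys m \<subseteq> {1..n} \<times> {1..n}"
        using p(1)[OF m(1)] q(1)[OF m(2)] Poly_Mapping.keys_add[of m1 m2] by blast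
    qed (simp add: p(2) q(2) eval_rat_poly_mult)
  }
  assume "f B \<noteq> 0"
  then have "p \<noteq> 0" using p(2)[of B] by (auto simp: eval_rat_poly_def)
  then have "f A \<noteq> 0"
    using assms p unfolding generic_matrix_def algebraically_independent_def by auto
  then show "\<forall>\<^sub>F B in principal {A}. f B \<noteq> 0" by (simp add: eventually_principal)
qed

text \<open>The columns in \<open>C\<close> are specialized to distinct unit vectors and column
  \<open>x\<close> to zero. The optional subtraction of column \<open>x\<close> covers directions of
  edges starting at \<open>x\<close> and plain columns in one statement.\<close>

lemma generic_independent:
  fixes A :: "nat \<Rightarrow> nat \<Rightarrow> 'k::field_char_0"
  assumes A: "generic_matrix n A" and C: "C \<subseteq> {1..n}" "card C \<le> d" "d \<le> n"
    and x: "\<And>j. j \<in> C \<Longrightarrow> Q j \<Longrightarrow> x \<in> {1..n} - C"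
    and zero: "\<And>a. a \<in> {1..d} \<Longrightarrow> (\<Sum>j\<in>C. (A a j - (if Q j then A a x else 0)) * m j) = 0"
  shows "\<forall>j\<in>C. m j = 0"
proof -
  have fC: "finite C" using C(1) finite_subset by blast
  obtain g where g: "inj_on g C" "g ` C \<subseteq> {1..d}"
    using card_le_inj[OF fC, of "{1..d}"] C(2) by auto
  define B :: "nat \<Rightarrow> nat \<Rightarrow> 'k" where "B a j = (if j \<in> C \<and> a = g j then 1 else 0)" for a j
  define M where "M B a j = B a j - (if Q j then B a x else 0)" for B :: "nat \<Rightarrow> nat \<Rightarrow> 'k" and a j
  have "\<forall>\<^sub>F B in principal {A}. \<forall>w. (\<forall>a\<in>{1..d}. (\<Sum>j\<in>C. M B a j * w j) = 0) \<longrightarrow> (\<forall>j\<in>C. w j = 0)"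
  proof (rule eventually_trivial_kernel[OF specializes_generic[OF A, of B] fC])
    note P = specializesD[OF specializes_generic[OF A, of B]]
    fix a j assume aj: "a \<in> {1..d}" "j \<in> C"
    then have "(\<lambda>B. B a j) \<in> matrix_polys n" "Q j \<Longrightarrow> (\<lambda>B. B a x) \<in> matrix_polys n"
      using C x[OF aj(2)] by (auto intro!: matrix_polys_entry)
    then show "(\<lambda>B. M B a j) \<in> matrix_polys n"
      unfolding M_def using P(2,4) by (cases "Q j") simp_all
  next
    fix w assume w: "\<And>a. a \<in> {1..d} \<Longrightarrow> (\<Sum>j\<in>C. M B a j * w j) = 0"
    show "\<forall>j\<in>C. w j = 0"
    proof
      fix j0 assume j0: "j0 \<in> C"
      have "(\<Sum>j\<in>C. M B (g j0) j * w j) = (\<Sum>j\<in>C. if j = j0 then w j else 0)"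
      proof (rule sum.cong)
        fix j assume j: "j \<in> C"
        have "Q j \<Longrightarrow> B (g j0) x = 0" using x[OF j] by (simp add: B_def)
        moreover have "g j0 = g j \<longleftrightarrow> j = j0" using g(1) j j0 by (auto dest: inj_onD)
        ultimately show "M B (g j0) j * w j = (if j = j0 then w j else 0)"
          using j by (simp add: M_def B_def)
      qed simp
      also have "\<dots> = w j0" using j0 fC by simp
      finally show "w j0 = 0" using w[of "g j0"] g(2) j0 by auto
    qed
  qed
  then show ?thesis using zero unfolding eventually_principal M_def by blast
qed

text \<open>Serves curves through a degenerate position. Their coefficients are entries of the
  generic matrix and hence not rational, so that \<open>specializes_generic\<close> does not apply
  to them.\<close>

lemma specializes_poly:
  "specializes {\<lambda>t :: 'k::field_char_0. poly p t |p. True} 0 cofinite"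
  unfolding specializes_def
proof (intro conjI ballI impI)
  show "(\<lambda>_. 1) \<in> {\<lambda>t :: 'k. poly p t |p. True}" by (auto intro!: exI[of _ 1])
  fix f g :: "'k \<Rightarrow> 'k" assume "f \<in> {\<lambda>t. poly p t |p. True}"
  then obtain p where p: "f = poly p" by auto
  {
    assume "g \<in> {\<lambda>t. poly p t |p. True}"
    then obtain q where q: "g = poly q" by auto
    show "(\<lambda>t. f t * g t) \<in> {\<lambda>t. poly p t |p. True}" unfolding p q by (auto intro!: exI[of _ "p * q"])
    show "(\<lambda>t. f t - g t) \<in> {\<lambda>t. poly p t |p. True}" unfolding p q by (auto intro!: exI[of _ "p - q"])
  }
  assume "f 0 \<noteq> 0"
  then have "p \<noteq> 0" using p by auto
  then show "\<forall>\<^sub>F t in cofinite. f t \<noteq> 0" unfolding p eventually_cofinite by (simp add: poly_roots_finite)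
qed

(* For s = 1 these are the directions p_j - p_i of rigidity theory, for s = -1 the vectors p_j of
   Kalai's hyperconnectivity. *)
definition edge_vec :: "'k::field \<Rightarrow> (nat \<Rightarrow> nat \<Rightarrow> 'k) \<Rightarrow> nat \<Rightarrow> nat \<Rightarrow> nat \<Rightarrow> 'k" where
  "edge_vec s A a i j = A a j - (if s = 1 then A a i else 0)"

lemma stress_free_cong:
  assumes "\<And>a i j. a \<in> D \<Longrightarrow> i \<in> V \<Longrightarrow> j \<in> V \<Longrightarrow> e a i j = e' a i j"
  shows "stress_free s D E V e \<longleftrightarrow> stress_free s D E V e'"
proof -
  have "(\<Sum>j\<in>V. e a i j * w i j) = (\<Sum>j\<in>V. e' a i j * w i j)" if "a \<in> D" "i \<in> V" for a i w
    by (rule sum.cong) (simp_all add: assms that)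
  then have "(\<forall>i\<in>V. \<forall>a\<in>D. (\<Sum>j\<in>V. e a i j * w i j) = 0) \<longleftrightarrow>
      (\<forall>i\<in>V. \<forall>a\<in>D. (\<Sum>j\<in>V. e' a i j * w i j) = 0)" for w
    by simp
  then have "stress s D E V e w \<longleftrightarrow> stress s D E V e' w" for w unfolding stress_def by (simp only:)
  then show ?thesis unfolding stress_free_def by (simp only:)
qed

text \<open>Reduces the generic case to exhibiting a single stress-free position \<open>B\<close>,
  however special.\<close>

lemma generic_stress_free_transfer:
  fixes A :: "nat \<Rightarrow> nat \<Rightarrow> 'k::field_char_0"
  assumes "generic_matrix n A" "V \<subseteq> {1..n}" "d \<le> n" "s = 1 \<or> s = - 1"
    and "stress_free s {1..d} E V (edge_vec s B)"
  shows "stress_free s {1..d} E V (edge_vec s A)"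
proof -
  note P = specializes_generic[OF assms(1), of B]
  have "\<forall>\<^sub>F B in principal {A}. stress_free s {1..d} E V (edge_vec s B)"
  proof (rule eventually_stress_free[where e = "edge_vec s", OF P _ assms(4) _ assms(5)])
    show "finite V" using assms(2) finite_subset by blast
    fix a i j assume "a \<in> {1..d}" "i \<in> V" "j \<in> V"
    then have "(\<lambda>B. B a j) \<in> matrix_polys n" "(\<lambda>B. B a i) \<in> matrix_polys n"
      using assms(2,3) by (auto intro!: matrix_polys_entry)
    then show "(\<lambda>B. edge_vec s B a i j) \<in> matrix_polys n"
      unfolding edge_vec_def using specializesD(2,4)[OF P] by (cases "s = 1") simp_all
  qed
  then show ?thesis by (simp add: eventually_principal)
qed

theorem generic_stress_free:
  fixes A :: "nat \<Rightarrow> nat \<Rightarrow> 'k::field_char_0"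
  assumes A: "generic_matrix n A" and r: "2 \<le> r" "r \<le> 6" "r \<le> n" and s: "s = 1 \<or> s = - 1"
    and "adjacency E" "V \<subseteq> {1..n}" "\<not> clique_model E V r"
  shows "stress_free s {1..r - 2} E V (edge_vec s A)"
  using assms(6-8)
proof (induction "card V" arbitrary: E V rule: less_induct)
  case less
  interpret adjacency E by fact
  note Vn = less.prems(2)
  have fin: "finite V" using Vn finite_subset by blast
  let ?D = "{1..r - 2}"
  show ?case
  proof (cases "\<exists>x\<in>V. \<exists>y\<in>V. E x y")
    case False
    then show ?thesis unfolding stress_free_def stress_def by blast
  next
    case True
    have "\<exists>x\<in>V. \<exists>y\<in>V. E x y \<and> card (nb E V x \<inter> nb E V y) < r - 2"
    proof (rule ccontr)
      assume "\<not> ?thesis"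
      then have tri: "\<And>x y. x \<in> V \<Longrightarrow> y \<in> V \<Longrightarrow> E x y \<Longrightarrow> r - 2 \<le> card (nb E V x \<inter> nb E V y)"
        by (meson not_le)
      from True obtain x y where "x \<in> V" "y \<in> V" "E x y" by blast
      from clique_model_if_triangles[OF r(1,2) less.prems(1) fin this tri]
      show False using less.prems(3) by blast
    qed
    then obtain v u where vu: "v \<in> V" "u \<in> V" "E v u" and small: "card (nb E V v \<inter> nb E V u) < r - 2"
      by blast
    let ?N = "nb E V v \<inter> nb E V u"
    have ne: "v \<noteq> u" "u \<noteq> v" using vu by auto
    have IH: "stress_free s ?D (contr v u E) (V - {u}) (edge_vec s A)"
    proof (rule less.hyps)
      show "card (V - {u}) < card V" by (rule card_Diff1_less[OF fin vu(2)])
      show "\<not> clique_model (contr v u E) (V - {u}) r"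
        using clique_model_contr[OF _ vu(3,1,2)] less.prems(3) by blast
      show "V - {u} \<subseteq> {1..n}" using Vn by blast
    qed (rule adjacency_contr)
    (* The vertex u moves to v as t tends to 0. For s = 1 the direction of the edge uv, which tends to 0,
       is divided by t. *)
    define B where "B t a j = (if j = u then A a v + t * A a u else A a j)" for t a j
    \<comment> \<open>At t = 0 the vector of the edge \<open>uv\<close>, seen from \<open>u\<close>,
      is minus column \<open>u\<close> of \<open>A\<close> for \<open>s = 1\<close> and column
      \<open>v\<close> for \<open>s = -1\<close>; \<open>z\<close> names this column.\<close>
    define z where "z = (if s = 1 then u else v)"
    define e where "e t a i j = (if s = 1 \<and> i = u \<and> j = v then - A a u
      else if s = 1 \<and> i = v \<and> j = u then A a u else edge_vec s (B t) a i j)" for t a i j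
    have free: "stress_free s ?D E V (e 0)"
    proof (rule stress_free_split[OF fin vu(2,1,3)])
      show "s * s = 1" using s by auto
      show "e 0 a u j = e 0 a v j \<and> e 0 a j u = e 0 a j v" if "j \<in> V - {u, v}" for a j
        using that ne by (simp add: e_def edge_vec_def B_def)
      show "e 0 a u v + s * e 0 a v u = 0" for a
        using s ne by (auto simp: e_def edge_vec_def B_def)
      \<comment> \<open>Away from \<open>u\<close> nothing depends on t, so the induction hypothesis
        for \<open>A\<close> itself applies.\<close>
      show "stress_free s ?D (contr v u E) (V - {u}) (e 0)"
        by (rule stress_free_cong[THEN iffD1, OF _ IH]) (simp add: e_def edge_vec_def B_def)
      fix l m assume lm: "\<And>a. a \<in> ?D \<Longrightarrow> l * e 0 a u v + (\<Sum>j\<in>?N. m j * e 0 a u j) = 0"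
      define m' where "m' j = (if j = z then (if s = 1 then - l else l) else m j)" for j
      have zN: "z \<notin> ?N" by (auto simp: z_def)
      have fN: "finite ?N" using fin by auto
      have N: "u \<notin> ?N" "v \<notin> ?N" by auto
      \<comment> \<open>Fewer than r - 2 common neighbours and \<open>z\<close> make at most r - 2
        columns, in r - 2 rows. For \<open>s = 1\<close> the vectors to common neighbours start at
        \<open>v\<close>, where \<open>u\<close> has moved, whereas column \<open>z\<close> is a
        pure direction from which nothing is subtracted.\<close>
      have "\<forall>j\<in>insert z ?N. m' j = 0"
      proof (rule generic_independent[OF A, where x = v and Q = "\<lambda>j. s = 1 \<and> j \<noteq> z" and d = "r - 2"])
        show "insert z ?N \<subseteq> {1..n}" using vu Vn by (auto simp: z_def)
        show "card (insert z ?N) \<le> r - 2" using zN fN small by simp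
        show "r - 2 \<le> n" using r by simp
        show "v \<in> {1..n} - insert z ?N" if "s = 1 \<and> j \<noteq> z" for j
          using that vu Vn ne by (auto simp: z_def)
        fix a assume a: "a \<in> ?D"
        have "(\<Sum>j\<in>?N. (A a j - (if s = 1 \<and> j \<noteq> z then A a v else 0)) * m' j) =
            (\<Sum>j\<in>?N. m j * e 0 a u j)"
        proof (rule sum.cong)
          fix j assume "j \<in> ?N"
          then have "j \<noteq> z" "j \<noteq> u" "j \<noteq> v" using zN N by blast+
          then show "(A a j - (if s = 1 \<and> j \<noteq> z then A a v else 0)) * m' j = m j * e 0 a u j"
            using ne by (simp add: m'_def e_def edge_vec_def B_def)
        qed simp
        moreover have "A a z * m' z = l * e 0 a u v"
          using s ne by (auto simp: m'_def z_def e_def edge_vec_def B_def)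
        ultimately show "(\<Sum>j\<in>insert z ?N. (A a j - (if s = 1 \<and> j \<noteq> z then A a v else 0)) * m' j) = 0"
          using lm[OF a] zN fN by simp
      qed
      then show "l = 0 \<and> (\<forall>j\<in>?N. m j = 0)" using zN by (auto simp: m'_def split: if_splits)
    qed
    have poly: "(\<lambda>t. e t a i j) \<in> {\<lambda>t. poly p t |p. True}" for a i j
    proof -
      define b where "b i = (if i = u then [:A a v, A a u:] else [:A a i:])" for i
      have b: "B t a i = poly (b i) t" for t i by (simp add: B_def b_def)
      let ?p = "if s = 1 \<and> i = u \<and> j = v then [:- A a u:]
        else if s = 1 \<and> i = v \<and> j = u then [:A a u:] else b j - (if s = 1 then b i else 0)"
      have "e t a i j = poly ?p t" for t
        unfolding e_def edge_vec_def b by simp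
      then show ?thesis by blast
    qed
    have "\<forall>\<^sub>F t in cofinite. stress_free s ?D E V (e t)"
      by (rule eventually_stress_free[where e = e, OF specializes_poly fin s poly free])
    moreover have "\<forall>\<^sub>F t :: 'k in cofinite. t \<noteq> 0" by (simp add: eventually_cofinite)
    ultimately have "\<forall>\<^sub>F t in cofinite. stress_free s ?D E V (e t) \<and> t \<noteq> 0" by (rule eventually_conj)
    moreover have "(cofinite :: 'k filter) \<noteq> bot"
      using infinite_UNIV_char_0 by simp
    ultimately obtain t where t: "stress_free s ?D E V (e t)" "t \<noteq> 0"
      using eventually_happens' by blast
    have "stress_free s ?D E V (edge_vec s (B t))"
      unfolding stress_free_def
    proof (intro allI impI)
      fix w assume w: "stress s ?D E V (edge_vec s (B t)) w"
      \<comment> \<open>For \<open>s = 1\<close> the division of the edge vector by t is compensated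
        in the weight, so that all products remain the same.\<close>
      define w' where "w' i j = (if s = 1 \<and> {i, j} = {u, v} then t * w i j else w i j)" for i j
      have ew: "e t a i j * w' i j = edge_vec s (B t) a i j * w i j" for a i j
        using ne by (auto simp: e_def w'_def edge_vec_def B_def doubleton_eq_iff)
      have "stress s ?D E V (e t) w'"
        unfolding stress_def ew
      proof (intro conjI ballI impI)
        fix i j assume ij: "i \<in> V" "j \<in> V"
        then have "w i j = s * w j i" using w unfolding stress_def by blast
        then show "w' i j = s * w' j i" by (simp add: w'_def insert_commute)
        assume "\<not> E i j"
        then have "w i j = 0" using w ij unfolding stress_def by blast
        then show "w' i j = 0" by (simp add: w'_def)
      next
        fix i a assume "i \<in> V" "a \<in> ?D"
        then show "(\<Sum>j\<in>V. edge_vec s (B t) a i j * w i j) = 0" using w unfolding stress_def by blast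
      qed
      then have 0: "w' i j = 0" if "i \<in> V" "j \<in> V" for i j
        using t(1) that unfolding stress_free_def by blast
      have "w i j = 0" if "i \<in> V" "j \<in> V" for i j
        using 0[OF that] t(2) unfolding w'_def by (metis mult_eq_0_iff)
      then show "\<forall>i\<in>V. \<forall>j\<in>V. w i j = 0" by blast
    qed
    moreover have "r - 2 \<le> n" using r by simp
    ultimately show ?thesis
      by (intro generic_stress_free_transfer[OF A Vn _ s])
  qed
qed

(* With an additional row of ones, the diagonal entries of a linear stress are determined by the others,
   which then form an affine stress. *)
lemma generic_linear_stress_free:
  fixes A :: "nat \<Rightarrow> nat \<Rightarrow> 'k::field_char_0"
  assumes A: "generic_matrix n A" and V: "V \<subseteq> {1..n}" "Suc d \<le> n" and E: "\<And>i. \<not> E i i"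
    and free: "stress_free 1 {1..d} E V (edge_vec 1 A)"
  shows "stress_free 1 {1..Suc d} (\<lambda>i j. E i j \<or> i = j) V (\<lambda>a i j. A a j)"
proof -
  define B where "B a j = (if a = Suc d then 1 else A a j)" for a j
  note P = specializes_generic[OF A, of B]
  have fin: "finite V" using V finite_subset by blast
  have "stress_free 1 {1..Suc d} (\<lambda>i j. E i j \<or> i = j) V (\<lambda>a i j. B a j)"
    unfolding stress_free_def
  proof (intro allI impI)
    fix w assume "stress 1 {1..Suc d} (\<lambda>i j. E i j \<or> i = j) V (\<lambda>a i j. B a j) w"
    then have w: "\<And>i j. i \<in> V \<Longrightarrow> j \<in> V \<Longrightarrow> w i j = w j i"
      "\<And>i j. i \<in> V \<Longrightarrow> j \<in> V \<Longrightarrow> \<not> E i j \<Longrightarrow> i \<noteq> j \<Longrightarrow> w i j = 0"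
      "\<And>i a. i \<in> V \<Longrightarrow> a \<in> {1..Suc d} \<Longrightarrow> (\<Sum>j\<in>V. B a j * w i j) = 0"
      unfolding stress_def by auto
    have row: "(\<Sum>j\<in>V. w i j) = 0" if "i \<in> V" for i
      using w(3)[OF that, of "Suc d"] by (simp add: B_def)
    define w' where "w' i j = (if i = j then 0 else w i j)" for i j
    have "stress 1 {1..d} E V (edge_vec 1 A) w'"
      unfolding stress_def
    proof (intro conjI ballI impI)
      fix i a assume i: "i \<in> V" "a \<in> {1..d}"
      have "(\<Sum>j\<in>V. edge_vec 1 A a i j * w' i j) = (\<Sum>j\<in>V. B a j * w i j - A a i * w i j)"
        using i by (intro sum.cong) (auto simp: edge_vec_def w'_def B_def algebra_simps)
      also have "\<dots> = (\<Sum>j\<in>V. B a j * w i j) - A a i * (\<Sum>j\<in>V. w i j)"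
        by (simp add: sum_subtractf sum_distrib_left)
      finally show "(\<Sum>j\<in>V. edge_vec 1 A a i j * w' i j) = 0" using w(3)[of i a] row i by simp
    qed (use w in \<open>auto simp: w'_def\<close>)
    then have 0: "w' i j = 0" if "i \<in> V" "j \<in> V" for i j using free that unfolding stress_free_def by blast
    have diag: "w i i = 0" if "i \<in> V" for i
    proof -
      have "(\<Sum>j\<in>V. w i j) = w i i + (\<Sum>j\<in>V - {i}. w i j)" by (rule sum.remove[OF fin that])
      also have "(\<Sum>j\<in>V - {i}. w i j) = 0"
      proof (intro sum.neutral ballI)
        fix j assume "j \<in> V - {i}"
        then show "w i j = 0" using 0[OF that, of j] by (auto simp: w'_def split: if_splits)
      qed
      finally show ?thesis using row[OF that] by simp
    qed
    show "\<forall>i\<in>V. \<forall>j\<in>V. w i j = 0"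
    proof (intro ballI)
      fix i j assume "i \<in> V" "j \<in> V"
      then show "w i j = 0" using 0[of i j] diag[of i] by (cases "i = j") (auto simp: w'_def)
    qed
  qed
  then have "\<forall>\<^sub>F B in principal {A}. stress_free 1 {1..Suc d} (\<lambda>i j. E i j \<or> i = j) V (\<lambda>a i j. B a j)"
  proof (rule eventually_stress_free[OF P fin _ _, rotated 2])
    fix a i j assume "a \<in> {1..Suc d}" "i \<in> V" "j \<in> V"
    then show "(\<lambda>B. B a j) \<in> matrix_polys n" using V by (auto intro!: matrix_polys_entry)
  qed simp
  then show ?thesis by (simp add: eventually_principal)
qed

section \<open>Clique models and minors\<close>

lemma branch_sets_image:
  assumes \<B>: "branch_sets E V \<B>" and f: "inj_on f V"
    and E: "\<And>x y. x \<in> V \<Longrightarrow> y \<in> V \<Longrightarrow> E x y \<Longrightarrow> E' (f x) (f y)"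
  shows "branch_sets E' (f ` V) ((`) f ` \<B>)" "card ((`) f ` \<B>) = card \<B>"
proof -
  have sub: "B \<subseteq> V" if "B \<in> \<B>" for B using \<B> that unfolding branch_sets_def by blast
  have lk: "linked E' (f ` B) (f ` C)" if "linked E B C" "B \<subseteq> V" "C \<subseteq> V" for B C
    using that E unfolding linked_def by blast
  have cn: "conn E' (f ` B)" if B: "B \<in> \<B>" for B
    unfolding conn_def
  proof (intro conjI allI impI)
    have c: "conn E B" using B \<B> unfolding branch_sets_def by blast
    then show "f ` B \<noteq> {}" using conn_not_empty by blast
    fix S assume S: "S \<subset> f ` B" "S \<noteq> {}"
    then obtain S' where S': "S' \<subseteq> B" "S = f ` S'" by (meson psubset_imp_subset subset_imageE)
    have "linked E S' (B - S')" using c S S' unfolding conn_def by blast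
    then have "linked E' (f ` S') (f ` (B - S'))" by (rule lk) (use S' sub[OF B] in auto)
    moreover have "f ` (B - S') = f ` B - f ` S'"
      by (rule inj_on_image_set_diff[OF f]) (use S' sub[OF B] in auto)
    ultimately show "linked E' S (f ` B - S)" using S'(2) by simp
  qed
  show "branch_sets E' (f ` V) ((`) f ` \<B>)"
    unfolding branch_sets_def
  proof (intro conjI ballI impI)
    show "finite ((`) f ` \<B>)" using \<B> by (simp add: branch_sets_def)
    fix B' assume "B' \<in> (`) f ` \<B>"
    then obtain B where B: "B \<in> \<B>" "B' = f ` B" by blast
    then show "B' \<subseteq> f ` V" "conn E' B'" using sub cn by blast+
    fix C' assume "C' \<in> (`) f ` \<B>" and ne: "B' \<noteq> C'"
    then obtain C where C: "C \<in> \<B>" "C' = f ` C" by blast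
    have BC: "B \<inter> C = {}" "linked E B C" using \<B> B C ne unfolding branch_sets_def by blast+
    then have "f ` (B \<inter> C) = B' \<inter> C'"
      using inj_on_image_Int[OF f sub[OF B(1)] sub[OF C(1)]] B C by simp
    then show "B' \<inter> C' = {}" using BC(1) by simp
    show "linked E' B' C'" using lk BC(2) sub B C by blast
  qed
  have "inj_on ((`) f) \<B>"
    by (rule inj_onI) (use inj_on_image_eq_iff[OF f sub sub] in simp)
  then show "card ((`) f ` \<B>) = card \<B>" by (rule card_image)
qed

definition edge_rel :: "'a graph \<Rightarrow> 'a \<Rightarrow> 'a \<Rightarrow> bool" where
  "edge_rel G x y \<longleftrightarrow> {x, y} \<in> edges G"

lemma edge_rel_neq: "simple_graph G \<Longrightarrow> edge_rel G x y \<Longrightarrow> x \<noteq> y"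
  unfolding simple_graph_def edge_rel_def by fastforce

lemma complete_graph_iso:
  assumes "simple_graph H" "card (verts H) = r"
    and "\<And>x y. x \<in> verts H \<Longrightarrow> y \<in> verts H \<Longrightarrow> x \<noteq> y \<Longrightarrow> edge_rel H x y"
  shows "graph_iso H (complete_graph r)"
proof -
  have fin: "finite (verts H)" using assms(1) by (simp add: simple_graph_def)
  then obtain f where f: "bij_betw f (verts H) {1..r}"
    using assms(2) by (metis card_atLeastAtMost diff_Suc_1 finite_atLeastAtMost finite_same_card_bij)
  have edges: "edges H = {e. e \<subseteq> verts H \<and> card e = 2}"
    using assms(1,3) unfolding simple_graph_def edge_rel_def by (auto simp: card_2_iff)
  have inj: "inj_on f (verts H)" using f by (rule bij_betw_imp_inj_on)
  have "{e. e \<subseteq> {1..r} \<and> card e = 2} = (`) f ` edges H"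
  proof (intro set_eqI iffI)
    fix e assume e: "e \<in> {e. e \<subseteq> {1..r} \<and> card e = 2}"
    then obtain e' where e': "e' \<subseteq> verts H" "e = f ` e'"
      using f by (metis (no_types, lifting) bij_betw_imp_surj_on mem_Collect_eq subset_imageE)
    have "card e' = 2" using card_image[OF inj_on_subset[OF inj e'(1)]] e e'(2) by simp
    then show "e \<in> (`) f ` edges H" using e' unfolding edges by blast
  next
    fix e assume "e \<in> (`) f ` edges H"
    then obtain e' where e': "e' \<subseteq> verts H" "card e' = 2" "e = f ` e'" unfolding edges by blast
    then have "card e = 2" using card_image[OF inj_on_subset[OF inj e'(1)]] by simp
    moreover have "e \<subseteq> {1..r}" using e' f bij_betw_imp_surj_on by blast
    ultimately show "e \<in> {e. e \<subseteq> {1..r} \<and> card e = 2}" by blast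
  qed
  then show ?thesis unfolding graph_iso_def complete_graph_def using f by auto
qed

lemma contract_edge_simple:
  assumes G: "simple_graph G" and xy: "{x, y} \<in> edges G" "x \<noteq> y"
  shows "simple_graph (contract_edge x y G)"
proof -
  let ?q = "id(y := x)"
  have "?q ` e \<subseteq> ?q ` verts G \<and> card (?q ` e) = 2" if e: "e \<in> edges G" "?q ` e \<noteq> {x}" for e
  proof -
    have e2: "e \<subseteq> verts G" "card e = 2" using G e(1) unfolding simple_graph_def by blast+
    obtain a b where ab: "e = {a, b}" "a \<noteq> b" using e2(2) by (meson card_2_iff)
    then have "?q a \<noteq> ?q b" using e(2) xy(2) by (auto split: if_splits)
    moreover have "?q ` e = {?q a, ?q b}" unfolding ab(1) by (simp only: image_insert image_empty)
    ultimately have "card (?q ` e) = 2" by (simp only: card_2_iff) blast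
    then show ?thesis using e2(1) by blast
  qed
  then show ?thesis using G unfolding simple_graph_def contract_edge_def Let_def by auto
qed

text \<open>The identified vertices lie in the same branch set, so distinct branch sets stay
  disjoint; an edge between them does not become a loop.\<close>

lemma contract_branch_sets:
  assumes G: "simple_graph G" and \<B>: "branch_sets (edge_rel G) (verts G) \<B>"
    and xy: "B0 \<in> \<B>" "x \<in> B0" "y \<in> B0" "edge_rel G x y"
  shows "branch_sets (edge_rel (contract_edge x y G)) (verts (contract_edge x y G)) ((`) (id(y := x)) ` \<B>)"
    "card ((`) (id(y := x)) ` \<B>) = card \<B>"
proof -
  define q where "q = id(y := x)"
  let ?G = "contract_edge x y G"
  have vG: "verts ?G = q ` verts G" and eG: "edges ?G = (`) q ` edges G - {{x}}"
    by (simp_all add: contract_edge_def Let_def q_def)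
  have sub: "B \<subseteq> verts G" "conn (edge_rel G) B" if "B \<in> \<B>" for B
    using \<B> that unfolding branch_sets_def by blast+
  have pair: "B \<inter> C = {}" "linked (edge_rel G) B C" if "B \<in> \<B>" "C \<in> \<B>" "B \<noteq> C" for B C
    using \<B> that unfolding branch_sets_def by blast+
  have q: "a = b \<or> a = x \<and> b = y \<or> a = y \<and> b = x" if "q a = q b" for a b
    using that unfolding q_def by (auto split: if_splits)
  have edge: "edge_rel ?G (q a) (q b)" if "edge_rel G a b" "q a \<noteq> q b" for a b
  proof -
    have "{q a, q b} \<in> (`) q ` edges G"
      using imageI[OF that(1)[unfolded edge_rel_def], of "(`) q"] by (simp only: image_insert image_empty)
    moreover have "{q a, q b} \<noteq> {x}" using that(2) by auto
    ultimately show ?thesis unfolding edge_rel_def eG by blast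
  qed
  have cn: "conn (edge_rel ?G) (q ` B)" if B: "B \<in> \<B>" for B
    unfolding conn_def
  proof (intro conjI allI impI)
    show "q ` B \<noteq> {}" using sub(2)[OF B] conn_not_empty by blast
    fix S assume S: "S \<subset> q ` B" "S \<noteq> {}"
    define S0 where "S0 = {a \<in> B. q a \<in> S}"
    have "S0 \<subset> B" "S0 \<noteq> {}" using S unfolding S0_def by blast+
    then have "linked (edge_rel G) S0 (B - S0)" using sub(2)[OF B] unfolding conn_def by blast
    then obtain a b where ab: "a \<in> S0" "b \<in> B - S0" "edge_rel G a b" unfolding linked_def by blast
    then have "q a \<in> S" "q b \<in> q ` B - S" unfolding S0_def by blast+
    moreover have "edge_rel ?G (q a) (q b)" using edge[OF ab(3)] calculation by (metis DiffD2)
    ultimately show "linked (edge_rel ?G) S (q ` B - S)" unfolding linked_def by blast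
  qed
  have disj: "q ` B \<inter> q ` C = {}" if BC: "B \<in> \<B>" "C \<in> \<B>" "B \<noteq> C" for B C
  proof (rule ccontr)
    assume "\<not> ?thesis"
    then obtain b c where bc: "b \<in> B" "c \<in> C" "q b = q c" by blast
    have "b \<noteq> c" using bc pair(1)[OF BC] by blast
    then have "b \<in> B0" "c \<in> B0" using q[OF bc(3)] xy by blast+
    then have "B = B0" "C = B0" using pair(1)[OF BC(1) xy(1)] pair(1)[OF BC(2) xy(1)] bc by blast+
    then show False using BC(3) by simp
  qed
  show "branch_sets (edge_rel ?G) (verts ?G) ((`) (id(y := x)) ` \<B>)"
    unfolding branch_sets_def q_def[symmetric]
  proof (intro conjI ballI impI)
    show "finite ((`) q ` \<B>)" using \<B> by (simp add: branch_sets_def)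
    fix B' assume "B' \<in> (`) q ` \<B>"
    then obtain B where B: "B \<in> \<B>" "B' = q ` B" by blast
    then show "conn (edge_rel ?G) B'" using cn by blast
    show "B' \<subseteq> verts ?G" using B sub(1) unfolding vG by blast
    fix C' assume "C' \<in> (`) q ` \<B>" and ne: "B' \<noteq> C'"
    then obtain C where C: "C \<in> \<B>" "C' = q ` C" by blast
    have BC: "B \<noteq> C" using B C ne by blast
    show d: "B' \<inter> C' = {}" using disj[OF B(1) C(1) BC] B C by simp
    obtain b c where bc: "b \<in> B" "c \<in> C" "edge_rel G b c"
      using pair(2)[OF B(1) C(1) BC] unfolding linked_def by blast
    then have "q b \<in> B'" "q c \<in> C'" using B C by blast+
    moreover have "edge_rel ?G (q b) (q c)" using edge[OF bc(3)] calculation d by (metis disjoint_iff)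
    ultimately show "linked (edge_rel ?G) B' C'" unfolding linked_def by blast
  qed
  have "inj_on ((`) q) \<B>"
  proof (rule inj_onI, rule ccontr)
    fix B C assume BC: "B \<in> \<B>" "C \<in> \<B>" "q ` B = q ` C" "B \<noteq> C"
    then have "q ` B = {}" using disj[of B C] by blast
    then show False using sub(2)[OF BC(1)] conn_not_empty by blast
  qed
  then show "card ((`) (id(y := x)) ` \<B>) = card \<B>" unfolding q_def[symmetric] by (rule card_image)
qed

text \<open>A branch set that is not a singleton contains an edge to contract. Once all are
  singletons, they are the vertices, and any two are adjacent.\<close>

lemma branch_sets_contracts_to_complete:
  assumes "simple_graph G" "branch_sets (edge_rel G) (verts G) \<B>" "\<Union>\<B> = verts G" "card \<B> = r"
  shows "\<exists>G'. contracts_to\<^sup>*\<^sup>* G G' \<and> graph_iso G' (complete_graph r)"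
  using assms
proof (induction "card (verts G)" arbitrary: G \<B> rule: less_induct)
  case less
  note G = less.prems(1) and \<B> = less.prems(2)
  have fin: "finite (verts G)" using G by (simp add: simple_graph_def)
  have pair: "linked (edge_rel G) B C" if "B \<in> \<B>" "C \<in> \<B>" "B \<noteq> C" for B C
    using \<B> that unfolding branch_sets_def by blast
  show ?case
  proof (cases "\<forall>B\<in>\<B>. \<exists>x. B = {x}")
    case True
    then have eq: "\<B> = (\<lambda>x. {x}) ` verts G" unfolding less.prems(3)[symmetric] by fastforce
    have "card (verts G) = r" using less.prems(4) unfolding eq by (subst (asm) card_image) auto
    moreover have "edge_rel G x y" if "x \<in> verts G" "y \<in> verts G" "x \<noteq> y" for x y
    proof -
      have "{x} \<in> \<B>" "{y} \<in> \<B>" unfolding eq using that(1,2) by simp_all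
      moreover have "{x} \<noteq> {y}" using that(3) by simp
      ultimately have "linked (edge_rel G) {x} {y}" by (rule pair)
      then show ?thesis by (simp add: linked_def)
    qed
    ultimately show ?thesis using complete_graph_iso[OF G] by blast
  next
    case False
    then obtain B where B: "B \<in> \<B>" "\<nexists>x. B = {x}" by blast
    have cB: "conn (edge_rel G) B" using B(1) \<B> unfolding branch_sets_def by blast
    then obtain a where a: "a \<in> B" using conn_not_empty by blast
    then have "{a} \<subset> B" using B(2) by blast
    then have "linked (edge_rel G) {a} (B - {a})" using cB unfolding conn_def by blast
    then obtain b where b: "b \<in> B" "edge_rel G a b" unfolding linked_def by blast
    have ab: "a \<noteq> b" using edge_rel_neq[OF G b(2)] .
    let ?q = "id(b := a)" and ?G = "contract_edge a b G"
    have e: "{a, b} \<in> edges G" using b(2) by (simp add: edge_rel_def)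
    then have V: "{a, b} \<subseteq> verts G" using G unfolding simple_graph_def by blast
    have vG: "verts ?G = ?q ` verts G" by (simp add: contract_edge_def Let_def)
    have "?q ` verts G \<subseteq> verts G - {b}" using V ab by auto
    then have "verts ?G \<subset> verts G" using V unfolding vG by blast
    then have "card (verts ?G) < card (verts G)" using fin by (rule psubset_card_mono[rotated])
    moreover have "simple_graph ?G" by (rule contract_edge_simple[OF G e ab])
    moreover note contract_branch_sets[OF G \<B> B(1) a b(1) b(2)]
    moreover have "\<Union> ((`) ?q ` \<B>) = verts ?G" unfolding vG less.prems(3)[symmetric] by blast
    ultimately obtain G' where G': "contracts_to\<^sup>*\<^sup>* ?G G'" "graph_iso G' (complete_graph r)"
      using less.hyps[of ?G "(`) ?q ` \<B>"] less.prems(4) by auto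
    have "contracts_to G ?G" unfolding contracts_to_def using ab e by blast
    then show ?thesis using G' by (meson converse_rtranclp_into_rtranclp)
  qed
qed

theorem clique_model_has_minor:
  assumes G: "simple_graph G" and "clique_model (edge_rel G) (verts G) r"
  shows "has_minor G (complete_graph r)"
proof -
  obtain \<B> where \<B>: "branch_sets (edge_rel G) (verts G) \<B>" "card \<B> = r"
    using assms(2) unfolding clique_model_def by blast
  \<comment> \<open>Vertices outside of the branch sets are deleted, so that only contractions
    remain.\<close>
  let ?H = "(\<Union>\<B>, {e \<in> edges G. e \<subseteq> \<Union>\<B>})"
  have sub: "\<Union>\<B> \<subseteq> verts G" using \<B>(1) unfolding branch_sets_def by blast
  have sH: "simple_graph ?H"
    using G finite_subset[OF sub] unfolding simple_graph_def by auto
  have lk: "linked (edge_rel ?H) B C" if "linked (edge_rel G) B C" "B \<subseteq> \<Union>\<B>" "C \<subseteq> \<Union>\<B>" for B C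
    using that unfolding linked_def edge_rel_def by (simp add: subset_iff)
  have "conn (edge_rel ?H) B" if "B \<in> \<B>" for B
    unfolding conn_def
  proof (intro conjI allI impI)
    have c: "conn (edge_rel G) B" using that \<B>(1) unfolding branch_sets_def by blast
    then show "B \<noteq> {}" by (rule conn_not_empty)
    fix S assume S: "S \<subset> B" "S \<noteq> {}"
    then have "linked (edge_rel G) S (B - S)" using c unfolding conn_def by blast
    then show "linked (edge_rel ?H) S (B - S)" by (rule lk) (use S that in blast)+
  qed
  then have "branch_sets (edge_rel ?H) (verts ?H) \<B>"
    using \<B>(1) lk unfolding branch_sets_def by (simp add: Union_upper)
  from branch_sets_contracts_to_complete[OF sH this _ \<B>(2)]
  obtain G' where "contracts_to\<^sup>*\<^sup>* ?H G'" "graph_iso G' (complete_graph r)" by auto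
  moreover have "subgraph ?H G" unfolding subgraph_def using sH sub by auto
  ultimately show ?thesis unfolding has_minor_def by blast
qed

section \<open>Functionals vanishing on a span\<close>

lemma separating_functional:
  fixes scale :: "'k::field \<Rightarrow> 'v::ab_group_add \<Rightarrow> 'v"
  assumes "vector_space scale" "module.subspace scale U" "x \<notin> U"
  obtains f where "\<And>a b. f (a + b) = f a + f b" "\<And>c a. f (scale c a) = c * f a"
    "\<And>u. u \<in> U \<Longrightarrow> f u = 0" "f x = 1"
proof -
  interpret s: vector_space scale by fact
  interpret t: vector_space "(*) :: 'k \<Rightarrow> 'k \<Rightarrow> 'k" by unfold_locales (auto simp: algebra_simps)
  interpret p: vector_space_pair scale "(*) :: 'k \<Rightarrow> 'k \<Rightarrow> 'k" by unfold_locales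
  obtain B where B: "B \<subseteq> U" "s.independent B" "U \<subseteq> s.span B"
    using s.maximal_independent_subset by blast
  have "s.span B \<subseteq> U" using B(1) assms(2) by (rule s.span_minimal)
  then have xB: "x \<notin> s.span B" using assms(3) by blast
  then have "s.independent (insert x B)" using B(2) s.independent_insertI by blast
  from p.linear_independent_extend[OF this, of "\<lambda>y. if y = x then 1 else 0"]
  obtain f where f: "Vector_Spaces.linear scale (*) f" "\<forall>y\<in>insert x B. f y = (if y = x then 1 else 0)" by blast
  interpret f: Vector_Spaces.linear scale "(*)" f by (rule f(1))
  have "f b = 0" if "b \<in> B" for b using f(2) that xB s.span_base by auto
  then have "f u = 0" if "u \<in> U" for u
    using p.linear_eq_0_on_span[OF f(1)] that B(3) by blast
  moreover have "f x = 1" using f(2) by simp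
  ultimately show thesis using that f.add f.scale by blast
qed

lemma generated_ideal_props:
  assumes "I = generated_ideal R mul X"
  shows "x \<in> X \<Longrightarrow> x \<in> I" "0 \<in> I" "x \<in> I \<Longrightarrow> y \<in> I \<Longrightarrow> x + y \<in> I" "a \<in> R \<Longrightarrow> x \<in> I \<Longrightarrow> mul a x \<in> I"
  unfolding assms generated_ideal_def hull_def two_sided_ideal_def by blast+

lemma generated_ideal_subset:
  assumes "two_sided_ideal R mul R" "X \<subseteq> R"
  shows "generated_ideal R mul X \<subseteq> R"
  unfolding generated_ideal_def using assms by (meson hull_minimal)

text \<open>The dual form of membership in a shifting: a functional on the quotient that kills all
  earlier elements but not \<open>x\<close>.\<close>

lemma span_mod_functional:
  fixes scale :: "'k::field \<Rightarrow> 'v::ab_group_add \<Rightarrow> 'v"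
  assumes V: "vector_space scale" and I: "0 \<in> I" "\<forall>x\<in>I. \<forall>y\<in>I. x + y \<in> I"
    "\<forall>c. \<forall>x\<in>I. scale c x \<in> I" and x: "x \<notin> span_mod scale I X"
  shows "\<exists>f. (\<forall>a b. f (a + b) = f a + f b) \<and> (\<forall>c a. f (scale c a) = c * f a) \<and>
    (\<forall>u\<in>I \<union> X. f u = 0) \<and> f x = 1"
proof -
  interpret s: vector_space scale by fact
  have "s.subspace (span_mod scale I X)"
    unfolding s.subspace_def
  proof (intro conjI ballI allI)
    show "0 \<in> span_mod scale I X" unfolding span_mod_def using I(1) s.span_zero by force
    fix a assume "a \<in> span_mod scale I X"
    then obtain u where u: "u \<in> s.span X" "a - u \<in> I" unfolding span_mod_def by blast
    show "scale c a \<in> span_mod scale I X" for c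
    proof -
      have "scale c a - scale c u \<in> I" using I(3)[rule_format, OF u(2), of c] by (simp add: s.scale_right_diff_distrib)
      then show ?thesis unfolding span_mod_def using s.span_scale[OF u(1)] by blast
    qed
    fix b assume "b \<in> span_mod scale I X"
    then obtain v where v: "v \<in> s.span X" "b - v \<in> I" unfolding span_mod_def by blast
    have "a + b - (u + v) \<in> I" using I(2)[rule_format, OF u(2) v(2)] by (simp add: algebra_simps)
    then show "a + b \<in> span_mod scale I X" unfolding span_mod_def using s.span_add[OF u(1) v(1)] by blast
  qed
  from separating_functional[OF V this x] obtain f where f: "\<And>a b. f (a + b) = f a + f b"
    "\<And>c a. f (scale c a) = c * f a" "\<And>u. u \<in> span_mod scale I X \<Longrightarrow> f u = 0" "f x = 1" by blast
  have "u \<in> span_mod scale I X" if "u \<in> I" for u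
    using that s.span_zero unfolding span_mod_def by force
  moreover have "u \<in> span_mod scale I X" if "u \<in> X" for u
    using that s.span_base I(1) unfolding span_mod_def by force
  ultimately show ?thesis using f by (intro exI[of _ f]) auto
qed

lemma functional_zero_sum:
  fixes f :: "'v::ab_group_add \<Rightarrow> 'k::field"
  assumes "\<forall>a b. f (a + b) = f a + f b"
  shows "f 0 = 0" "f (- a) = - f a" "f (\<Sum>i\<in>S. g i) = (\<Sum>i\<in>S. f (g i))"
proof -
  have "f 0 + 0 = f 0 + f 0" using assms[rule_format, of 0 0] by simp
  then show 0: "f 0 = 0" by (simp only: add_left_cancel)
  show "f (- a) = - f a" using assms[rule_format, of a "- a"] 0 by (simp add: eq_neg_iff_add_eq_0 add.commute)
  show "f (\<Sum>i\<in>S. g i) = (\<Sum>i\<in>S. f (g i))"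
    using 0 assms by (induction S rule: infinite_finite_induct) auto
qed

text \<open>The bilinear form with matrix \<open>W\<close> on rows \<open>a\<close> and
  \<open>b\<close> of \<open>A\<close>. When \<open>W\<close> lists the values of a functional on
  products of basis elements, this is its value on the product of two generic elements.\<close>

definition quad :: "nat \<Rightarrow> (nat \<Rightarrow> nat \<Rightarrow> 'k::field) \<Rightarrow> (nat \<Rightarrow> nat \<Rightarrow> 'k) \<Rightarrow> nat \<Rightarrow> nat \<Rightarrow> 'k" where
  "quad n A W a b = (\<Sum>i\<in>{1..n}. \<Sum>j\<in>{1..n}. A a i * A b j * W i j)"

lemma quad_swap:
  assumes "\<And>i j. i \<in> {1..n} \<Longrightarrow> j \<in> {1..n} \<Longrightarrow> W i j = s * W j i"
  shows "quad n A W b a = s * quad n A W a b"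
proof -
  have "quad n A W b a = (\<Sum>j\<in>{1..n}. \<Sum>i\<in>{1..n}. A b i * A a j * W i j)"
    unfolding quad_def by (rule sum.swap)
  also have "\<dots> = (\<Sum>j\<in>{1..n}. \<Sum>i\<in>{1..n}. s * (A a j * A b i * W j i))"
  proof (intro sum.cong refl)
    fix i j assume "i \<in> {1..n}" "j \<in> {1..n}"
    from assms[OF this] show "A b i * A a j * W i j = s * (A a j * A b i * W j i)" by simp
  qed
  finally show ?thesis by (simp add: quad_def sum_distrib_left)
qed

text \<open>For \<open>a\<close> up to \<open>d\<close>, the product of row \<open>a\<close> of
  \<open>A\<close> with \<open>W\<close> is orthogonal to all rows of \<open>A\<close>. These span,
  so the product is zero; this is the equilibrium condition that makes \<open>W\<close> a
  stress.\<close>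

lemma quad_zero_imp:
  fixes A :: "nat \<Rightarrow> nat \<Rightarrow> 'k::field_char_0"
  assumes A: "generic_matrix n A" and W: "\<And>i j. i \<in> {1..n} \<Longrightarrow> j \<in> {1..n} \<Longrightarrow> W i j = s * W j i"
    and free: "stress_free s {1..d} E {1..n} (\<lambda>a i j. A a j)"
    and supp: "\<And>i j. i \<in> {1..n} \<Longrightarrow> j \<in> {1..n} \<Longrightarrow> \<not> E i j \<Longrightarrow> W i j = 0"
    and zero: "\<And>a b. a \<in> {1..d} \<Longrightarrow> b \<in> {1..n} \<Longrightarrow> quad n A W a b = 0"
  shows "quad n A W a b = 0"
proof -
  have row: "(\<Sum>i\<in>{1..n}. A a i * W i j) = 0" if a: "a \<in> {1..d}" and j: "j \<in> {1..n}" for a j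
  proof -
    have "\<forall>j\<in>{1..n}. (\<Sum>i\<in>{1..n}. A a i * W i j) = 0"
    proof (rule generic_independent[OF A, where Q = "\<lambda>_. False" and d = n])
      fix b assume b: "b \<in> {1..n}"
      have "quad n A W a b = (\<Sum>j\<in>{1..n}. \<Sum>i\<in>{1..n}. A a i * A b j * W i j)"
        unfolding quad_def by (rule sum.swap)
      also have "\<dots> = (\<Sum>j\<in>{1..n}. A b j * (\<Sum>i\<in>{1..n}. A a i * W i j))"
        by (simp add: sum_distrib_left algebra_simps)
      finally show "(\<Sum>j\<in>{1..n}. (A b j - (if False then A b x else 0)) * (\<Sum>i\<in>{1..n}. A a i * W i j)) = 0" for x
        using zero[OF a b] by simp
    qed auto
    then show ?thesis using j by blast
  qed
  have "stress s {1..d} E {1..n} (\<lambda>a i j. A a j) W"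
    unfolding stress_def
  proof (intro conjI ballI impI)
    fix i a assume ia: "i \<in> {1..n}" "a \<in> {1..d}"
    have "(\<Sum>j\<in>{1..n}. A a j * W i j) = (\<Sum>j\<in>{1..n}. s * (A a j * W j i))"
    proof (rule sum.cong)
      fix j assume "j \<in> {1..n}"
      from W[OF ia(1) this] show "A a j * W i j = s * (A a j * W j i)" by simp
    qed simp
    then show "(\<Sum>j\<in>{1..n}. A a j * W i j) = 0"
      using row[OF ia(2,1)] by (simp flip: sum_distrib_left)
  qed (use W supp in blast)+
  then have "W i j = 0" if "i \<in> {1..n}" "j \<in> {1..n}" for i j
    using free that unfolding stress_free_def by blast
  then show ?thesis unfolding quad_def by (intro sum.neutral ballI) simp
qed

definition complex_rel :: "nat \<Rightarrow> nat set set \<Rightarrow> nat \<Rightarrow> nat \<Rightarrow> bool" where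
  "complex_rel n K i j \<longleftrightarrow> i \<in> {1..n} \<and> j \<in> {1..n} \<and> i \<noteq> j \<and> {i, j} \<in> K"

lemma adjacency_complex_rel: "adjacency (complex_rel n K)"
  by unfold_locales (auto simp: complex_rel_def insert_commute)

section \<open>Exterior shifting\<close>

lemma wedge_add_left: "wedge (x + y) z = wedge x z + wedge y z"
  unfolding wedge_def by (auto simp: fun_eq_iff algebra_simps sum.distrib)

lemma wedge_add_right: "wedge z (x + y) = wedge z x + wedge z y"
  unfolding wedge_def by (auto simp: fun_eq_iff algebra_simps sum.distrib)

lemma wedge_scale_left: "wedge (ext_scale c x) z = ext_scale c (wedge x z)"
  unfolding wedge_def ext_scale_def by (auto simp: fun_eq_iff sum_distrib_left algebra_simps)

lemma wedge_scale_right: "wedge z (ext_scale c x) = ext_scale c (wedge z x)"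
  unfolding wedge_def ext_scale_def by (auto simp: fun_eq_iff sum_distrib_left algebra_simps)

lemma wedge_zero: "wedge 0 z = 0" "wedge z 0 = 0"
  unfolding wedge_def by (auto simp: fun_eq_iff)

lemma wedge_sum_left: "wedge (\<Sum>i\<in>S. g i) z = (\<Sum>i\<in>S. wedge (g i) z)"
  by (induction S rule: infinite_finite_induct) (simp_all only: sum.infinite sum.empty sum.insert wedge_zero wedge_add_left not_False_eq_True)

lemma wedge_sum_right: "wedge z (\<Sum>i\<in>S. g i) = (\<Sum>i\<in>S. wedge z (g i))"
  by (induction S rule: infinite_finite_induct) (simp_all only: sum.infinite sum.empty sum.insert wedge_zero wedge_add_right not_False_eq_True)

lemma wedge_generic_vectors:
  "wedge (generic_vector n A a) (generic_vector n A b) =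
    (\<Sum>i\<in>{1..n}. \<Sum>j\<in>{1..n}. ext_scale (A a i * A b j) (wedge (ext_gen i) (ext_gen j)))"
proof -
  have "wedge (ext_scale c x) (ext_scale d y) = ext_scale (c * d) (wedge x y)" for c d and x y :: "'a ext"
    unfolding wedge_scale_left wedge_scale_right by (simp add: ext_scale_def fun_eq_iff)
  then show ?thesis unfolding generic_vector_def wedge_sum_left
    by (intro sum.cong refl) (simp only: wedge_sum_right)
qed

text \<open>At an infinite set \<open>wedge\<close> is a sum over infinitely many subsets and hence
  0 by convention, so the unit law requires that \<open>x\<close> vanishes there.\<close>

lemma wedge_ext_one:
  assumes "\<And>U. infinite U \<Longrightarrow> x U = 0"
  shows "wedge x ext_one = x"
proof
  fix U
  show "wedge x ext_one U = x U"
  proof (cases "finite U")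
    case True
    have "wedge x ext_one U = (\<Sum>S\<in>{U}. (- 1) ^ card {(s, t). s \<in> S \<and> t \<in> U - S \<and> t < s} * x S * ext_one (U - S))"
      unfolding wedge_def
      by (rule sum.mono_neutral_right) (use True in \<open>auto simp: ext_one_def\<close>)
    then show ?thesis by (simp add: ext_one_def)
  next
    case False
    then show ?thesis using assms by (simp add: wedge_def)
  qed
qed

lemma ext_one_wedge:
  assumes "\<And>U. infinite U \<Longrightarrow> x U = 0"
  shows "wedge ext_one x = x"
proof
  fix U
  show "wedge ext_one x U = x U"
  proof (cases "finite U")
    case True
    have "wedge ext_one x U = (\<Sum>S\<in>{{}}. (- 1) ^ card {(s, t). s \<in> S \<and> t \<in> U - S \<and> t < s} * ext_one S * x (U - S))"
      unfolding wedge_def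
      by (rule sum.mono_neutral_right) (use True in \<open>auto simp: ext_one_def\<close>)
    then show ?thesis by (simp add: ext_one_def)
  next
    case False
    then show ?thesis using assms by (simp add: wedge_def)
  qed
qed

lemma generic_vector_infinite: "infinite U \<Longrightarrow> generic_vector n A i U = 0"
proof -
  assume U: "infinite U"
  have "(\<Sum>j\<in>S. ext_scale (A i j) (ext_gen j)) U = 0" for S
    using U by (induction S rule: infinite_finite_induct) (auto simp: ext_scale_def ext_gen_def)
  then show ?thesis by (simp add: generic_vector_def)
qed

lemma wedge_over_pair:
  assumes "a < b" "\<And>U. infinite U \<Longrightarrow> g b U = 0"
  shows "wedge_over g {a, b} = wedge (g a) (g b)"
proof -
  have "sorted_list_of_set {a, b} = [a, b]"
    using sorted_list_of_set.idem_if_sorted_distinct[of "[a, b]"] assms(1) by simp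
  then show ?thesis by (simp add: wedge_over_def wedge_ext_one assms(2))
qed

lemma wedge_ext_gen_gen:
  "wedge (ext_gen i) (ext_gen j) U =
    (if i \<noteq> j \<and> U = {i, j} then (if j < i then - 1 else 1) else (0 :: 'k::field))"
proof (cases "i \<noteq> j \<and> U = {i, j}")
  case True
  have "wedge (ext_gen i) (ext_gen j) U = (\<Sum>S\<in>{{i}}. (- 1) ^ card {(s, t). s \<in> S \<and> t \<in> U - S \<and> t < s} *
      ext_gen i S * (ext_gen j (U - S) :: 'k))"
    unfolding wedge_def by (rule sum.mono_neutral_right) (use True in \<open>auto simp: ext_gen_def\<close>)
  also have "\<dots> = (- 1) ^ card {(s, t). s \<in> {i} \<and> t \<in> {i, j} - {i} \<and> t < s}"
    using True by (auto simp: ext_gen_def)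
  also have "{(s, t). s \<in> {i} \<and> t \<in> {i, j} - {i} \<and> t < s} = (if j < i then {(i, j)} else {})"
    using True by auto
  finally show ?thesis using True by simp
next
  case False
  have "wedge (ext_gen i) (ext_gen j) U = (0 :: 'k)"
    unfolding wedge_def by (rule sum.neutral) (use False in \<open>auto simp: ext_gen_def\<close>)
  then show ?thesis using False by auto
qed

lemma ext_carrier_ideal: "two_sided_ideal (ext_carrier n :: 'k::field ext set) wedge (ext_carrier n)"
proof -
  have "wedge a b \<in> ext_carrier n" if ab: "a \<in> ext_carrier n" "b \<in> ext_carrier n" for a b :: "'k ext"
  proof -
    have "wedge a b U = 0" if U: "\<not> U \<subseteq> {1..n}" for U
      unfolding wedge_def
    proof (rule sum.neutral, rule ballI)
      fix S assume "S \<in> Pow U"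
      then have "\<not> S \<subseteq> {1..n} \<or> \<not> U - S \<subseteq> {1..n}" using U by blast
      then have "a S = 0 \<or> b (U - S) = 0" using ab unfolding ext_carrier_def by blast
      then show "(- 1) ^ card {(s, t). s \<in> S \<and> t \<in> U - S \<and> t < s} * a S * b (U - S) = 0" by auto
    qed
    then show ?thesis by (simp add: ext_carrier_def)
  qed
  then show ?thesis unfolding two_sided_ideal_def by (auto simp: ext_carrier_def)
qed

text \<open>Scaling is multiplication by a multiple of the unit. The ideal lies in the carrier,
  whose elements vanish at infinite sets, so the unit law is available.\<close>

lemma ext_face_ideal_scale:
  fixes x :: "'k::field ext"
  assumes "x \<in> ext_face_ideal n K"
  shows "ext_scale c x \<in> ext_face_ideal n K"
proof -
  have "ext_face_ideal n K \<subseteq> (ext_carrier n :: 'k ext set)"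
    unfolding ext_face_ideal_def
  proof (rule generated_ideal_subset[OF ext_carrier_ideal], rule subsetI)
    fix x :: "'k ext" assume "x \<in> {wedge_over ext_gen S |S. S \<subseteq> {1..n} \<and> S \<notin> K}"
    then obtain S where S: "S \<subseteq> {1..n}" "x = wedge_over ext_gen S" by blast
    then have "finite S" using finite_subset by blast
    then show "x \<in> ext_carrier n" unfolding S(2) wedge_over_ext_gen[OF \<open>finite S\<close>] using S(1)
      by (auto simp: ext_carrier_def)
  qed
  then have "x U = 0" if "infinite U" for U
  proof -
    have "\<not> U \<subseteq> {1..n}" using that by (meson finite_atLeastAtMost finite_subset)
    then show ?thesis using \<open>ext_face_ideal n K \<subseteq> _\<close> assms unfolding ext_carrier_def by auto
  qed
  then have "ext_scale c x = wedge (ext_scale c ext_one) x" by (simp add: wedge_scale_left ext_one_wedge)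
  moreover have "ext_scale c ext_one \<in> ext_carrier n"
    by (auto simp: ext_carrier_def ext_scale_def ext_one_def)
  ultimately show ?thesis using generated_ideal_props(4)[OF ext_face_ideal_def] assms by metis
qed

text \<open>Used with \<open>m = r - 1\<close>: all pairs that meet the first r - 2 indices come
  earlier, whence r - 2 coordinates for exterior stresses.\<close>

lemma set_lex_less_pair:
  assumes "a < m" "b \<noteq> a"
  shows "set_lex_less {a, b} {m, Suc m}"
proof -
  let ?D = "sym_diff {a, b} {m, Suc m}"
  have "Min ?D = min a b"
    by (rule Min_eqI) (use assms in \<open>auto simp: min_def\<close>)
  moreover have "{a, b} \<noteq> {m, Suc m}" using assms(1) by auto
  ultimately show ?thesis using assms(2) unfolding set_lex_less_def by (auto simp: min_def)
qed

text \<open>The weights are the values of the separating functional on products of two basis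
  vectors: the face ideal yields the support, and the earlier pairs yield equilibrium.\<close>

theorem exterior_shift_stress:
  fixes A :: "nat \<Rightarrow> nat \<Rightarrow> 'k::field_char_0"
  assumes A: "generic_matrix n A" and r: "2 \<le> r" and mem: "{r - 1, r} \<in> exterior_shift n A K"
    and free: "stress_free (- 1) {1..r - 2} (complex_rel n K) {1..n} (\<lambda>a i j. A a j)"
  shows False
proof -
  let ?g = "generic_vector n A" and ?I = "ext_face_ideal n K :: 'k ext set"
  let ?X = "{wedge_over ?g S' |S'. S' \<subseteq> {1..n} \<and> card S' = card {r - 1, r} \<and> set_lex_less S' {r - 1, r}}"
  have rn: "r \<le> n" and nm: "wedge_over ?g {r - 1, r} \<notin> span_mod ext_scale ?I ?X"
    using mem unfolding exterior_shift_def by auto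
  note I = generated_ideal_props[OF ext_face_ideal_def[of n K]]
  have "\<forall>x\<in>?I. \<forall>y\<in>?I. x + y \<in> ?I" "\<forall>c. \<forall>x\<in>?I. ext_scale c x \<in> ?I"
    using I(3) ext_face_ideal_scale by blast+
  from span_mod_functional[OF vector_space_ext I(2) this nm]
  obtain f where fadd: "\<forall>a b. f (a + b) = f a + f b" and fscale: "\<forall>c a. f (ext_scale c a) = c * f a"
    and f0: "\<forall>u\<in>?I \<union> ?X. f u = 0" and f1: "f (wedge_over ?g {r - 1, r}) = 1"
    by (elim exE conjE)
  define W where "W i j = f (wedge (ext_gen i) (ext_gen j))" for i j
  have W: "W i j = - 1 * W j i" for i j
  proof -
    have "wedge (ext_gen i) (ext_gen j) = - (wedge (ext_gen j) (ext_gen i) :: 'k ext)"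
      by (auto simp: fun_eq_iff wedge_ext_gen_gen insert_commute)
    then show ?thesis unfolding W_def by (simp add: functional_zero_sum[OF fadd])
  qed
  have supp: "W i j = 0" if ij: "i \<in> {1..n}" "j \<in> {1..n}" "\<not> complex_rel n K i j" for i j
  proof (cases "i = j")
    case True
    then have "W i j = - W i j" using W[of i j] by simp
    then show ?thesis by simp
  next
    case False
    then have "{i, j} \<notin> K" using ij by (simp add: complex_rel_def)
    then have "wedge_over ext_gen {i, j} \<in> ?I" using ij by (intro I(1)) auto
    moreover have "wedge (ext_gen i) (ext_gen j) =
        ext_scale (if j < i then - 1 else 1) (wedge_over ext_gen {i, j} :: 'k ext)"
      using False by (auto simp: fun_eq_iff wedge_ext_gen_gen wedge_over_ext_gen ext_scale_def)
    ultimately show ?thesis unfolding W_def by (simp add: fscale f0)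
  qed
  have Q: "f (wedge (?g a) (?g b)) = quad n A W a b" for a b
    unfolding wedge_generic_vectors quad_def W_def by (simp add: functional_zero_sum[OF fadd] fscale)
  have sw: "quad n A W b a = - quad n A W a b" for a b
    by (subst quad_swap[where s = "- 1"]) (rule W, simp)
  have wp: "wedge_over ?g {a, b} = wedge (?g a) (?g b)" if "a < b" for a b
    by (rule wedge_over_pair[OF that generic_vector_infinite])
  have lt: "quad n A W a b = 0" if "a < b" "{a, b} \<subseteq> {1..n}" "set_lex_less {a, b} {r - 1, r}" for a b
  proof -
    have "wedge (?g a) (?g b) \<in> ?X"
      unfolding wp[OF that(1), symmetric] using that r by auto
    then show ?thesis using f0 Q[of a b] by simp
  qed
  have "quad n A W (r - 1) r = 0"
  proof (rule quad_zero_imp[OF A W free supp])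
    fix a b assume ab: "a \<in> {1..r - 2}" "b \<in> {1..n}"
    have "a < r - 1" "Suc (r - 1) = r" "a \<in> {1..n}" using ab r rn by auto
    then have sl: "a \<noteq> b \<Longrightarrow> set_lex_less {a, b} {r - 1, r}" using set_lex_less_pair[of a "r - 1" b] by auto
    consider "a = b" | "a < b" | "b < a" by linarith
    then show "quad n A W a b = 0"
    proof cases
      case 1
      then have "quad n A W a b = - quad n A W a b" using sw[of a a] by simp
      then show ?thesis by simp
    next
      case 2
      then show ?thesis using lt[of a b] sl ab \<open>a \<in> {1..n}\<close> by auto
    next
      case 3
      then have "quad n A W b a = 0" using lt[of b a] sl ab \<open>a \<in> {1..n}\<close> by (auto simp: insert_commute)
      then show ?thesis using sw[of a b] by simp
    qed
  qed
  moreover have "quad n A W (r - 1) r = 1"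
    using f1 Q[of "r - 1" r] wp[of "r - 1" r] r by simp
  ultimately show False by simp
qed

section \<open>Symmetric shifting\<close>

lemma monomial_in_superset:
  assumes "finite I" "Poly_Mapping.keys m \<subseteq> I"
  shows "monomial_in y m = (\<Prod>i\<in>I. y i ^ Poly_Mapping.lookup m i)"
  unfolding monomial_in_def by (rule prod.mono_neutral_left) (use assms in \<open>auto simp: in_keys_iff\<close>)

lemma monomial_in_add: "monomial_in y (m + m') = monomial_in y m * monomial_in y m'"
proof -
  let ?I = "Poly_Mapping.keys m \<union> Poly_Mapping.keys m'"
  have "Poly_Mapping.keys (m + m') \<subseteq> ?I" by (rule Poly_Mapping.keys_add)
  then show ?thesis
    by (simp add: monomial_in_superset[of ?I] lookup_add power_add prod.distrib)
qed

lemma monomial_in_single: "monomial_in y (Poly_Mapping.single i 1) = y i"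
  by (simp add: monomial_in_def)

definition mono2 :: "nat \<Rightarrow> nat \<Rightarrow> monomial" where
  "mono2 a b = Poly_Mapping.single a 1 + Poly_Mapping.single b 1"

lemma monomial_in_mono2: "monomial_in y (mono2 a b) = y a * y b"
  by (simp add: mono2_def monomial_in_add monomial_in_single del: One_nat_def)

lemma lookup_mono2: "Poly_Mapping.lookup (mono2 a b) i = of_bool (i = a) + of_bool (i = b)"
  by (simp add: mono2_def lookup_add lookup_single when_def)

lemma keys_mono2: "Poly_Mapping.keys (mono2 a b) = {a, b}"
  by (auto simp: in_keys_iff lookup_mono2)

lemma degree_mono2: "monomial_degree (mono2 a b) = 2"
  unfolding monomial_degree_def keys_mono2 by (cases "a = b") (simp_all add: lookup_mono2)

text \<open>All products with a factor among the first r - 1 forms precede the square of y_r, whence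
  r - 1 coordinates, one more than in the exterior case.\<close>

lemma mono2_lex_less:
  assumes "a < r"
  shows "monomial_lex_less (mono2 a b) (mono2 r r)"
proof -
  let ?P = "\<lambda>i. Poly_Mapping.lookup (mono2 a b) i \<noteq> Poly_Mapping.lookup (mono2 r r) i"
  have L: "(LEAST i. ?P i) = min a b"
  proof (rule Least_equality)
    show "?P (min a b)" using assms by (auto simp: lookup_mono2 min_def)
    show "min a b \<le> i" if "?P i" for i
    proof (rule ccontr)
      assume "\<not> min a b \<le> i"
      then have "i \<noteq> a" "i \<noteq> b" "i \<noteq> r" using assms by auto
      then show False using that by (simp add: lookup_mono2)
    qed
  qed
  have "?P (min a b)" using assms by (auto simp: lookup_mono2 min_def)
  then have "mono2 a b \<noteq> mono2 r r" by auto
  moreover have "Poly_Mapping.lookup (mono2 r r) (min a b) < Poly_Mapping.lookup (mono2 a b) (min a b)"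
    using assms by (auto simp: lookup_mono2 min_def)
  ultimately show ?thesis unfolding monomial_lex_less_def Let_def L by (simp add: degree_mono2)
qed

text \<open>The shift makes a weakly increasing index list strictly increasing, so the list has as
  many entries as the face. For two indices p and q the face is {p - 1, q}, which leaves p = q =
  r.\<close>

lemma shifted_face_edge:
  assumes "shifted_face is = {r - 1, r}" "sorted is" "\<forall>i\<in>set is. length is \<le> i" "2 \<le> r"
  shows "is = [r, r]"
proof -
  let ?l = "length is" and ?g = "\<lambda>j. is ! j + Suc j - length is"
  have im: "?g ` {..<?l} = {r - 1, r}" using assms(1) unfolding shifted_face_def by auto
  have less: "?g i < ?g j" if "i < j" "j < ?l" for i j
  proof -
    have "is ! i \<le> is ! j" using assms(2) that by (simp add: sorted_iff_nth_mono)
    moreover have "?l \<le> is ! i" using assms(3) that by simp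
    ultimately show ?thesis using that by simp
  qed
  have "inj_on ?g {..<?l}"
    by (rule linorder_inj_onI) (use less in fastforce)+
  then have "card (?g ` {..<?l}) = ?l" by (subst card_image) simp_all
  then have len: "?l = 2" using assms(4) unfolding im by simp
  then obtain p q where pq: "is = [p, q]"
    by (metis (no_types, lifting) One_nat_def Suc_1 length_0_conv length_Suc_conv)
  have "{..<?l} = {0, 1}" using len by auto
  then have "{p - 1, q} = {r - 1, r}" using im by (simp add: pq)
  moreover have "p \<le> q" "2 \<le> p" using assms(2,3) unfolding pq by simp_all
  ultimately have "p - 1 = r - 1 \<and> q = r" using assms(4) by (auto simp: doubleton_eq_iff)
  then show ?thesis using pq \<open>2 \<le> p\<close> assms(4) by auto
qed

lemma generic_form_mult:
  "generic_form n A a * generic_form n A b =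
    (\<Sum>i\<in>{1..n}. \<Sum>j\<in>{1..n}. poly_scale (A a i * A b j) (poly_var i * poly_var j))"
proof -
  have "poly_scale c x * poly_scale d y = poly_scale (c * d) (x * y)" for c d and x y :: "'a polynomial"
    unfolding poly_scale_def by (simp add: mult_single ac_simps flip: mult.assoc)
  then show ?thesis unfolding generic_form_def sum_product by simp
qed

lemma symmetric_shift_edge:
  assumes "{r - 1, r} \<in> symmetric_shift n A K" "2 \<le> r"
  shows "mono2 r r \<in> GIN n A K"
proof -
  obtain l where l: "l \<in> gin n A K" "shifted_face l = {r - 1, r}"
    using assms(1) unfolding symmetric_shift_def by blast
  have "l = [r, r]" by (rule shifted_face_edge) (use l assms(2) in \<open>auto simp: gin_def\<close>)
  then have "monomial_of_list l = mono2 r r" by (simp add: monomial_of_list_def mono2_def)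
  then show ?thesis using l(1) by (simp add: gin_def)
qed

text \<open>As in the exterior case, but the functional need not vanish on squares of variables; the
  relation therefore includes the diagonal.\<close>

theorem symmetric_shift_stress:
  fixes A :: "nat \<Rightarrow> nat \<Rightarrow> 'k::field_char_0"
  assumes A: "generic_matrix n A" and r: "2 \<le> r" and mem: "{r - 1, r} \<in> symmetric_shift n A K"
    and free: "stress_free 1 {1..r - 1} (\<lambda>i j. complex_rel n K i j \<or> i = j) {1..n} (\<lambda>a i j. A a j)"
  shows False
proof -
  let ?y = "generic_form n A" and ?I = "face_ideal n K :: 'k polynomial set"
  note gin = symmetric_shift_edge[OF mem r]
  let ?X = "{monomial_in ?y m' |m'. Poly_Mapping.keys m' \<subseteq> {1..n} \<and>
    monomial_degree m' = monomial_degree (mono2 r r) \<and> monomial_lex_less m' (mono2 r r)}"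
  have rn: "r \<le> n" and nm: "monomial_in ?y (mono2 r r) \<notin> span_mod poly_scale ?I ?X"
    using gin unfolding GIN_def by (auto simp: keys_mono2)
  note I = generated_ideal_props[OF face_ideal_def[of n K]]
  have "poly_scale c x \<in> ?I" if "x \<in> ?I" for c x
    unfolding poly_scale_def by (rule I(4)[OF _ that]) (auto simp: poly_carrier_def split: if_splits)
  then have "\<forall>x\<in>?I. \<forall>y\<in>?I. x + y \<in> ?I" "\<forall>c. \<forall>x\<in>?I. poly_scale c x \<in> ?I"
    using I(3) by blast+
  from span_mod_functional[OF vector_space_poly I(2) this nm]
  obtain f where fadd: "\<forall>a b. f (a + b) = f a + f b" and fscale: "\<forall>c a. f (poly_scale c a) = c * f a"
    and f0: "\<forall>u\<in>?I \<union> ?X. f u = 0" and f1: "f (monomial_in ?y (mono2 r r)) = 1"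
    by (elim exE conjE)
  define W where "W i j = f (poly_var i * poly_var j)" for i j
  have Q: "f (?y a * ?y b) = quad n A W a b" for a b
    unfolding generic_form_mult quad_def W_def by (simp add: functional_zero_sum[OF fadd] fscale)
  have "quad n A W r r = 0"
  proof (rule quad_zero_imp[OF A _ free])
    show "W i j = 1 * W j i" for i j unfolding W_def by (simp add: mult.commute)
    show "W i j = 0" if "i \<in> {1..n}" "j \<in> {1..n}" "\<not> (complex_rel n K i j \<or> i = j)" for i j
    proof -
      have "{i, j} \<notin> K" using that by (auto simp: complex_rel_def)
      then have "monomial_in poly_var (mono2 i j) \<in> ?I"
        by (intro I(1)) (use that keys_mono2 in auto)
      then show ?thesis using f0 unfolding W_def monomial_in_mono2 by blast
    qed
    fix a b assume ab: "a \<in> {1..r - 1}" "b \<in> {1..n}"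
    have "monomial_lex_less (mono2 a b) (mono2 r r)" using ab by (intro mono2_lex_less) auto
    moreover have "{a, b} \<subseteq> {1..n}" using ab rn by auto
    ultimately have "monomial_in ?y (mono2 a b) \<in> ?X"
      unfolding mem_Collect_eq keys_mono2 degree_mono2
      by (intro exI[of _ "mono2 a b"]) (simp add: keys_mono2 degree_mono2)
    then have "f (monomial_in ?y (mono2 a b)) = 0" using f0 by blast
    then show "quad n A W a b = 0" by (simp only: monomial_in_mono2 Q)
  qed
  then show False using f1 Q[of r r] unfolding monomial_in_mono2 by simp
qed

lemma complex_minor:
  fixes G :: "'a graph"
  assumes G: "simple_graph G" and n: "n = card (verts G)" and \<phi>: "bij_betw \<phi> (verts G) {1..n}"
    and model: "clique_model (complex_rel n (relabel \<phi> (graph_complex G))) {1..n} r"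
  shows "has_minor G (complete_graph r)"
proof (rule clique_model_has_minor[OF G])
  let ?K = "relabel \<phi> (graph_complex G)"
  obtain \<B> where \<B>: "branch_sets (complex_rel n ?K) {1..n} \<B>" "card \<B> = r"
    using model unfolding clique_model_def by blast
  define \<psi> where "\<psi> = inv_into (verts G) \<phi>"
  have \<psi>: "bij_betw \<psi> {1..n} (verts G)" unfolding \<psi>_def by (rule bij_betw_inv_into[OF \<phi>])
  have "edge_rel G (\<psi> i) (\<psi> j)" if ij: "complex_rel n ?K i j" for i j
  proof -
    have ij': "i \<noteq> j" "{i, j} \<in> ?K" using ij by (auto simp: complex_rel_def)
    then obtain S where S: "S \<in> graph_complex G" "{i, j} = \<phi> ` S" unfolding relabel_def by blast
    have Se: "S \<in> edges G"
      using S ij'(1) unfolding graph_complex_def by (auto simp: doubleton_eq_iff)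
    then have "S \<subseteq> verts G" using G by (simp add: simple_graph_def)
    then have "\<psi> ` \<phi> ` S = S" unfolding \<psi>_def
      by (rule inv_into_image_cancel[OF bij_betw_imp_inj_on[OF \<phi>]])
    then have "{\<psi> i, \<psi> j} = S" unfolding S(2)[symmetric] by simp
    then show ?thesis using Se by (simp add: edge_rel_def)
  qed
  then have "branch_sets (edge_rel G) (\<psi> ` {1..n}) ((`) \<psi> ` \<B>)" "card ((`) \<psi> ` \<B>) = card \<B>"
    using branch_sets_image[OF \<B>(1) bij_betw_imp_inj_on[OF \<psi>]] by blast+
  then show "clique_model (edge_rel G) (verts G) r"
    unfolding clique_model_def using \<B>(2) bij_betw_imp_surj_on[OF \<psi>] by auto
qed

theorem theorem1p4:
  fixes G :: "'a graph" and \<phi> :: "'a \<Rightarrow> nat" and A :: "nat \<Rightarrow> nat \<Rightarrow> 'k::field_char_0"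
    and n r :: nat
  assumes "2 \<le> r" and "r \<le> 6"
    and "simple_graph G" and "n = card (verts G)"
    and "bij_betw \<phi> (verts G) {1..n}"
    and "generic_matrix n A"
  shows "({r - 1, r} \<in> symmetric_shift n A (relabel \<phi> (graph_complex G))
            \<longrightarrow> has_minor G (complete_graph r)) \<and>
         ({r - 1, r} \<in> exterior_shift n A (relabel \<phi> (graph_complex G))
            \<longrightarrow> has_minor G (complete_graph r))"
proof -
  let ?K = "relabel \<phi> (graph_complex G)"
  have free: "stress_free s {1..r - 2} (complex_rel n ?K) {1..n} (edge_vec s A)"
    if "\<not> has_minor G (complete_graph r)" "r \<le> n" "s = 1 \<or> s = - 1" for s
    using generic_stress_free[OF assms(6,1,2) that(2,3) adjacency_complex_rel order_refl]
      complex_minor[OF assms(3-5)] that(1) by blast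
  show ?thesis
  proof (intro conjI impI; rule ccontr)
    assume mem: "{r - 1, r} \<in> symmetric_shift n A ?K" and no: "\<not> has_minor G (complete_graph r)"
    \<comment> \<open>Genericity controls only indices up to n, so \<open>r \<le> n\<close> is
      needed to speak of generic rows; membership in the shifting provides it.\<close>
    have rn: "r \<le> n" using symmetric_shift_edge[OF mem assms(1)] by (auto simp: GIN_def keys_mono2)
    have "Suc (r - 2) = r - 1" using assms(1) by simp
    then have "stress_free 1 {1..r - 1} (\<lambda>i j. complex_rel n ?K i j \<or> i = j) {1..n} (\<lambda>a i j. A a j)"
      using generic_linear_stress_free[OF assms(6) order_refl, of "r - 2" "complex_rel n ?K"]
        free[OF no rn, of 1] rn by (simp add: complex_rel_def)
    then show False by (rule symmetric_shift_stress[OF assms(6,1) mem])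
  next
    assume mem: "{r - 1, r} \<in> exterior_shift n A ?K" and no: "\<not> has_minor G (complete_graph r)"
    have "r \<le> n" using mem by (auto simp: exterior_shift_def)
    then have "stress_free (- 1) {1..r - 2} (complex_rel n ?K) {1..n} (edge_vec (- 1) A)"
      using free[OF no] by blast
    moreover have "edge_vec (- 1) A = (\<lambda>a i j. A a j)" by (simp add: fun_eq_iff edge_vec_def)
    ultimately show False using exterior_shift_stress[OF assms(6,1) mem] by simp
  qed
qed

end
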